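(* Let $\eta\in(0,2)$. There is a constant $K'>0$ and a sequence $(u_n)$ of positive real numbers tending to $0$ such that the following holds: for all $n\in\mathbb{N}$, $n\ge 2$, and $d\in(0,1)$ satisfying $$d\geq\frac{1}{3}+\frac{\log\log n-\log(2-\eta)}{3\log n},$$ with probability $p\geq 1-u_n$, a group $\Gamma$ in $\mathcal{M}(n,d)$ satisfies $$c_{\mathrm{ub}}(\Gamma)\geq K'\left(\frac{(2n-1)^{3d}}{n}\right)^{\frac16}.$$
   Context: Triangular density model: a random group in $\mathcal{M}(n,d)$ is $\Gamma=\langle S\mid R\rangle$ with $|S|=n$ and $R$ chosen uniformly among all subsets of cardinality $(2n-1)^{3d}$ (rounded to an integer) of the set of cyclically reduced words of length $3$ in $S\cup S^{-1}$. For $c\ge1$, $\mathcal{R}_c(\Gamma)$ is the class of homomorphisms $\pi$ from the discrete group $\Gamma$ to the invertible bounded operators on a Hilbert space $\mathcal{H}_\pi$ with $\sup_{s\in\Gamma}\|\pi(s)\|\le c$. Such $\pi$ almost has invariant vectors if for every finite $Q\subset\Gamma$ and $\varepsilon>0$ there is $\xi\in\mathcal{H}_\pi$ with $\sup_{s\in Q}\|\pi(s)\xi-\xi\|<\varepsilon\|\xi\|$. $\Gamma$ has Property (T)$_c$ if every $\pi\in\mathcal{R}_c(\Gamma)$ that almost has invariant vectors has a nonzero invariant vector. $c_{\mathrm{ub}}(\Gamma)=\inf\{c\geq 1: \Gamma\text{ does not have Property (T)}_c\}\in[1,\infty]$, with $\inf\varnothing=\infty$. *)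

theory Defs
  imports "HOL-Algebra.Module" "HOL-Probability.Probability"
begin

section \<open>Group presentations\<close>

text \<open>The letter \<open>(s, True)\<close> stands for the generator \<open>s\<close>, and \<open>(s, False)\<close> for its formal inverse.\<close>

definition inv_letter :: "'a \<times> bool \<Rightarrow> 'a \<times> bool"
  where "inv_letter x = (fst x, \<not> snd x)"

definition words :: "'a set \<Rightarrow> ('a \<times> bool) list set"
  where "words S = lists (S \<times> UNIV)"

inductive_set presentation_rel ::
  "'a set \<Rightarrow> ('a \<times> bool) list set \<Rightarrow> (('a \<times> bool) list \<times> ('a \<times> bool) list) set"
  for S R where
  refl: "w \<in> words S \<Longrightarrow> (w, w) \<in> presentation_rel S R"
| sym: "(v, w) \<in> presentation_rel S R \<Longrightarrow> (w, v) \<in> presentation_rel S R"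
| trans: "(u, v) \<in> presentation_rel S R \<Longrightarrow> (v, w) \<in> presentation_rel S R
    \<Longrightarrow> (u, w) \<in> presentation_rel S R"
| cancel: "u \<in> words S \<Longrightarrow> v \<in> words S \<Longrightarrow> x \<in> S \<times> UNIV
    \<Longrightarrow> (u @ [x, inv_letter x] @ v, u @ v) \<in> presentation_rel S R"
| relator: "u \<in> words S \<Longrightarrow> v \<in> words S \<Longrightarrow> r \<in> R \<inter> words S
    \<Longrightarrow> (u @ r @ v, u @ v) \<in> presentation_rel S R"

definition presented_group :: "'a set \<Rightarrow> ('a \<times> bool) list set \<Rightarrow> ('a \<times> bool) list set monoid"
  where "presented_group S R =
    \<lparr>carrier = words S // presentation_rel S R,
     monoid.mult = (\<lambda>A B. \<Union>u\<in>A. \<Union>v\<in>B. presentation_rel S R `` {u @ v}),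
     one = presentation_rel S R `` {[]}\<rparr>"

lemma words_append [simp]: "u @ v \<in> words S \<longleftrightarrow> u \<in> words S \<and> v \<in> words S"
  by (auto simp: words_def)

lemma words_Nil [simp]: "[] \<in> words S"
  by (simp add: words_def)

lemma presentation_rel_words: "(v, w) \<in> presentation_rel S R \<Longrightarrow> v \<in> words S \<and> w \<in> words S"
  by (induction rule: presentation_rel.induct) (auto simp: words_def inv_letter_def)

lemma equiv_presentation_rel: "equiv (words S) (presentation_rel S R)"
proof (rule equivI)
  show "presentation_rel S R \<subseteq> words S \<times> words S"
    by (auto dest: presentation_rel_words)
  show "refl_on (words S) (presentation_rel S R)"
    by (rule refl_onI) (rule presentation_rel.refl)
  show "sym (presentation_rel S R)"
    by (rule symI) (rule presentation_rel.sym)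
  show "trans (presentation_rel S R)"
    by (rule transI) (rule presentation_rel.trans)
qed

lemma presentation_rel_append_left:
  "(v, w) \<in> presentation_rel S R \<Longrightarrow> u \<in> words S \<Longrightarrow> (u @ v, u @ w) \<in> presentation_rel S R"
proof (induction rule: presentation_rel.induct)
  case (refl w)
  then show ?case by (simp add: presentation_rel.refl)
next
  case (sym v w)
  then show ?case by (blast intro: presentation_rel.sym)
next
  case (trans v w z)
  then show ?case by (blast intro: presentation_rel.trans)
next
  case (cancel a b x)
  then show ?case using presentation_rel.cancel[of "u @ a" S b x R] by simp
next
  case (relator a b r)
  then show ?case using presentation_rel.relator[of "u @ a" S b r R] by simp
qed

lemma presentation_rel_append_right:
  "(v, w) \<in> presentation_rel S R \<Longrightarrow> u \<in> words S \<Longrightarrow> (v @ u, w @ u) \<in> presentation_rel S R"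
proof (induction rule: presentation_rel.induct)
  case (refl w)
  then show ?case by (simp add: presentation_rel.refl)
next
  case (sym v w)
  then show ?case by (blast intro: presentation_rel.sym)
next
  case (trans v w z)
  then show ?case by (blast intro: presentation_rel.trans)
next
  case (cancel a b x)
  then show ?case using presentation_rel.cancel[of a S "b @ u" x R] by simp
next
  case (relator a b r)
  then show ?case using presentation_rel.relator[of a S "b @ u" r R] by simp
qed

lemma presented_group_mult:
  assumes "u \<in> words S" "v \<in> words S"
  shows "presentation_rel S R `` {u} \<otimes>\<^bsub>presented_group S R\<^esub> presentation_rel S R `` {v}
    = presentation_rel S R `` {u @ v}"
proof -
  have "congruent2 (presentation_rel S R) (presentation_rel S R)
      (\<lambda>u v. presentation_rel S R `` {u @ v})"
  proof (rule congruent2I')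
    fix a a' b b' assume *: "(a, a') \<in> presentation_rel S R" "(b, b') \<in> presentation_rel S R"
    then have "(a @ b, a' @ b') \<in> presentation_rel S R"
      by (meson presentation_rel.trans presentation_rel_append_left presentation_rel_append_right
          presentation_rel_words)
    then show "presentation_rel S R `` {a @ b} = presentation_rel S R `` {a' @ b'}"
      by (rule equiv_class_eq[OF equiv_presentation_rel])
  qed
  from UN_equiv_class2[OF equiv_presentation_rel equiv_presentation_rel this assms]
  show ?thesis by (simp add: presented_group_def)
qed

lemma words_inverse: "w \<in> words S \<Longrightarrow> rev (map inv_letter w) \<in> words S"
  by (induction w) (auto simp: words_def inv_letter_def)

lemma words_cancel_inverse:
  "w \<in> words S \<Longrightarrow> (rev (map inv_letter w) @ w, []) \<in> presentation_rel S R"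
proof (induction w)
  case (Cons x w)
  then have x: "inv_letter x \<in> S \<times> UNIV" and w: "w \<in> words S"
    by (auto simp: words_def inv_letter_def)
  from presentation_rel.cancel[OF words_inverse[OF w] w x, of R]
  have "(rev (map inv_letter (x # w)) @ x # w, rev (map inv_letter w) @ w) \<in> presentation_rel S R"
    by (simp add: inv_letter_def)
  then show ?case using Cons.IH[OF w] by (rule presentation_rel.trans)
qed (simp add: presentation_rel.refl)

lemma group_presented_group: "group (presented_group S R)"
proof (rule groupI)
  let ?G = "presented_group S R"
  have carrier: "\<exists>w\<in>words S. x = presentation_rel S R `` {w}" if "x \<in> carrier ?G" for x
    using that by (auto simp: presented_group_def quotient_def)
  have class_in: "presentation_rel S R `` {w} \<in> carrier ?G" if "w \<in> words S" for w
    using that by (simp add: presented_group_def quotientI)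
  have one: "\<one>\<^bsub>?G\<^esub> = presentation_rel S R `` {[]}"
    by (simp add: presented_group_def)
  show "\<one>\<^bsub>?G\<^esub> \<in> carrier ?G" unfolding one by (simp add: class_in)
  show "x \<otimes>\<^bsub>?G\<^esub> y \<in> carrier ?G" if x: "x \<in> carrier ?G" and y: "y \<in> carrier ?G" for x y
  proof -
    obtain u v where "u \<in> words S" "x = presentation_rel S R `` {u}"
        "v \<in> words S" "y = presentation_rel S R `` {v}"
      using carrier[OF x] carrier[OF y] by (elim bexE)
    then show ?thesis by (simp add: presented_group_mult class_in)
  qed
  show "x \<otimes>\<^bsub>?G\<^esub> y \<otimes>\<^bsub>?G\<^esub> z = x \<otimes>\<^bsub>?G\<^esub> (y \<otimes>\<^bsub>?G\<^esub> z)"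
    if x: "x \<in> carrier ?G" and y: "y \<in> carrier ?G" and z: "z \<in> carrier ?G" for x y z
  proof -
    obtain u v w where "u \<in> words S" "x = presentation_rel S R `` {u}"
        "v \<in> words S" "y = presentation_rel S R `` {v}"
        "w \<in> words S" "z = presentation_rel S R `` {w}"
      using carrier[OF x] carrier[OF y] carrier[OF z] by (elim bexE)
    then show ?thesis by (simp add: presented_group_mult)
  qed
  show "\<one>\<^bsub>?G\<^esub> \<otimes>\<^bsub>?G\<^esub> x = x" if "x \<in> carrier ?G" for x
    using carrier[OF that] by (elim bexE) (simp add: one presented_group_mult)
  show "\<exists>y\<in>carrier ?G. y \<otimes>\<^bsub>?G\<^esub> x = \<one>\<^bsub>?G\<^esub>" if x: "x \<in> carrier ?G" for x
  proof -
    obtain w where w: "w \<in> words S" "x = presentation_rel S R `` {w}" using carrier[OF x] by (elim bexE)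
    let ?v = "rev (map inv_letter w)"
    have v: "?v \<in> words S" using w(1) by (rule words_inverse)
    have "presentation_rel S R `` {?v} \<otimes>\<^bsub>?G\<^esub> x = presentation_rel S R `` {?v @ w}"
      using w v by (simp add: presented_group_mult)
    also have "\<dots> = \<one>\<^bsub>?G\<^esub>" unfolding one
      by (rule equiv_class_eq[OF equiv_presentation_rel words_cancel_inverse[OF w(1)]])
    finally show ?thesis using class_in[OF v] by (rule bexI)
  qed
qed

section \<open>The triangular density model\<close>

definition cyclically_reduced :: "('a \<times> bool) list \<Rightarrow> bool"
  where "cyclically_reduced w \<longleftrightarrow>
    (\<forall>i<length w. w ! (Suc i mod length w) \<noteq> inv_letter (w ! i))"

definition triangular_words :: "nat \<Rightarrow> (nat \<times> bool) list set"
  where "triangular_words n = {w \<in> words {..<n}. length w = 3 \<and> cyclically_reduced w}"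

definition relator_sets :: "nat \<Rightarrow> real \<Rightarrow> (nat \<times> bool) list set set"
  where "relator_sets n d =
    {R. R \<subseteq> triangular_words n \<and> card R = nat (round ((2 * real n - 1) powr (3 * d)))}"

definition triangular_model :: "nat \<Rightarrow> real \<Rightarrow> (nat \<times> bool) list set monoid pmf"
  where "triangular_model n d = map_pmf (presented_group {..<n}) (pmf_of_set (relator_sets n d))"

lemma cyclically_reduced_triple:
  "cyclically_reduced [x, y, z] \<longleftrightarrow> y \<noteq> inv_letter x \<and> z \<noteq> inv_letter y \<and> x \<noteq> inv_letter z"
  unfolding cyclically_reduced_def by (simp add: All_less_Suc mod_Suc) blast

lemma finite_triangular_words: "finite (triangular_words n)"
proof -
  have "triangular_words n \<subseteq> {w. set w \<subseteq> {..<n} \<times> UNIV \<and> length w = 3}"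
    by (auto simp: triangular_words_def words_def)
  then show ?thesis
    by (rule finite_subset) (rule finite_lists_length_eq, simp)
qed

lemma finite_relator_sets: "finite (relator_sets n d)"
  by (rule finite_subset[of _ "Pow (triangular_words n)"])
    (auto simp: relator_sets_def finite_triangular_words)

lemma card_triangular_words:
  assumes "n \<ge> 1"
  shows "card (triangular_words n) = (2 * n - 1) ^ 3 + 1"
proof -
  let ?L = "{..<n} \<times> (UNIV :: bool set)"
  have card_L: "card ?L = 2 * n" by (simp add: card_cartesian_product)
  define Z where "Z x y = ?L - {inv_letter x, inv_letter y}" for x y :: "nat \<times> bool"
  define P where "P = Sigma ?L (\<lambda>x. Sigma (?L - {inv_letter x}) (\<lambda>y. Z x y))"
  have inv: "inv_letter x = inv_letter y \<longleftrightarrow> x = y" "x = inv_letter y \<longleftrightarrow> y = inv_letter x"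
    "inv_letter x \<noteq> x" "inv_letter x \<in> ?L \<longleftrightarrow> x \<in> ?L" for x y :: "nat \<times> bool"
    by (auto simp: inv_letter_def prod_eq_iff mem_Times_iff)
  have inj: "inj_on (\<lambda>(x, y, z). [x, y, z]) P"
    by (rule inj_onI) (clarsimp split: prod.splits)
  have image: "(\<lambda>(x, y, z). [x, y, z]) ` P = triangular_words n" (is "?f ` P = _")
  proof (intro subset_antisym subsetI)
    fix w assume "w \<in> ?f ` P"
    then obtain x y z where xyz: "w = [x, y, z]" "(x, y, z) \<in> P" by auto
    from xyz(2) have "x \<in> ?L" "y \<in> ?L" "y \<noteq> inv_letter x"
        "z \<in> ?L" "z \<noteq> inv_letter x" "z \<noteq> inv_letter y"
      unfolding P_def Z_def by simp_all
    with xyz(1) show "w \<in> triangular_words n"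
      using inv(2)[of x z] by (simp add: triangular_words_def words_def cyclically_reduced_triple)
  next
    fix w assume w: "w \<in> triangular_words n"
    then have "length w = 3" by (simp add: triangular_words_def)
    then obtain x y z where xyz: "w = [x, y, z]"
      unfolding numeral_3_eq_3 length_Suc_conv length_0_conv by blast
    have "(x, y, z) \<in> P"
      using w inv(2)[of x z] unfolding xyz P_def Z_def
      by (simp add: triangular_words_def words_def cyclically_reduced_triple)
    then show "w \<in> ?f ` P" unfolding xyz by (rule rev_image_eqI) simp
  qed
  have Z: "card (Z x y) = (if y = x then 2 * n - 1 else 2 * n - 2)" if "x \<in> ?L" "y \<in> ?L" for x y
    using that inv unfolding Z_def by (subst card_Diff_subset) (auto simp: card_L)
  have inner: "card (Sigma (?L - {inv_letter x}) (\<lambda>y. Z x y)) = (2 * n - 1) + (2 * n - 2) * (2 * n - 2)"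
    if x: "x \<in> ?L" for x
  proof -
    have "card (Sigma (?L - {inv_letter x}) (\<lambda>y. Z x y)) = (\<Sum>y\<in>?L - {inv_letter x}. card (Z x y))"
      by (subst card_SigmaI) (auto simp: Z_def)
    also have "\<dots> = card (Z x x) + (\<Sum>y\<in>?L - {inv_letter x} - {x}. card (Z x y))"
      using x inv(3)[of x] by (subst sum.remove[of _ x]) auto
    also have "(\<Sum>y\<in>?L - {inv_letter x} - {x}. card (Z x y)) = (\<Sum>y\<in>?L - {inv_letter x} - {x}. 2 * n - 2)"
      by (rule sum.cong) (use Z[OF x] in auto)
    also have "\<dots> = (2 * n - 2) * (2 * n - 2)"
      using x inv(3)[of x] inv(4)[of x]
      by (simp add: card_Diff_subset card_L) arith
    finally show ?thesis using Z[OF x x] by simp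
  qed
  have "card (triangular_words n) = card P" using card_image[OF inj] image by simp
  also have "\<dots> = (\<Sum>x\<in>?L. card (Sigma (?L - {inv_letter x}) (\<lambda>y. Z x y)))"
    unfolding P_def by (subst card_SigmaI) (auto simp: Z_def)
  also have "\<dots> = 2 * n * ((2 * n - 1) + (2 * n - 2) * (2 * n - 2))"
    using inner by (simp add: card_L)
  also have "\<dots> = (2 * n - 1) ^ 3 + 1"
  proof -
    obtain m where "n = Suc m" using assms by (cases n) auto
    then show ?thesis by (simp add: power3_eq_cube algebra_simps)
  qed
  finally show ?thesis .
qed

lemma relator_sets_nonempty:
  assumes "n \<ge> 1" "d \<le> 1"
  shows "relator_sets n d \<noteq> {}"
proof -
  have "(2 * real n - 1) powr (3 * d) \<le> (2 * real n - 1) powr real 3"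
    using assms by (intro powr_mono) auto
  also have "\<dots> = (2 * real n - 1) ^ 3"
    using assms by (subst powr_realpow) auto
  also have "\<dots> = of_int ((2 * int n - 1) ^ 3)" by simp
  finally have "round ((2 * real n - 1) powr (3 * d)) \<le> (2 * int n - 1) ^ 3"
    by (metis round_mono round_of_int)
  moreover have "int ((2 * n - 1) ^ 3) = (2 * int n - 1) ^ 3"
    using assms by (simp add: of_nat_diff)
  ultimately have "nat (round ((2 * real n - 1) powr (3 * d))) \<le> card (triangular_words n)"
    unfolding card_triangular_words[OF assms(1)] by linarith
  then obtain R where "R \<subseteq> triangular_words n"
      "card R = nat (round ((2 * real n - 1) powr (3 * d)))"
    by (meson obtain_subset_with_card_n)
  then show ?thesis by (auto simp: relator_sets_def)
qed

section \<open>Complex Hilbert spaces\<close>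

definition complex_ring :: "complex ring"
  where "complex_ring = \<lparr>carrier = UNIV, monoid.mult = (*), one = 1, zero = 0, add = (+)\<rparr>"

text \<open>
  Hilbert spaces are carrier-based, so that one can quantify over all of them inside a formula.
  As for every module in HOL-Algebra, the ring multiplication and unit in the record are
  irrelevant.
\<close>

record 'v inner_space = "(complex, 'v) module" +
  cinner :: "'v \<Rightarrow> 'v \<Rightarrow> complex"

definition vnorm :: "'v inner_space \<Rightarrow> 'v \<Rightarrow> real"
  where "vnorm H x = sqrt (Re (cinner H x x))"

text \<open>The locale \<open>Metric_space\<close> requires symmetry and nonnegativity also outside the carrier.\<close>

definition vdist :: "'v inner_space \<Rightarrow> 'v \<Rightarrow> 'v \<Rightarrow> real"
  where "vdist H x y =
    (if x \<in> carrier H \<and> y \<in> carrier H then vnorm H (x \<ominus>\<^bsub>H\<^esub> y) else 0)"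

locale complex_inner_space = Module.module complex_ring H for H :: "'v inner_space" (structure) +
  assumes cinner_commute:
      "x \<in> carrier H \<Longrightarrow> y \<in> carrier H \<Longrightarrow> cinner H y x = cnj (cinner H x y)"
    and cinner_add_left:
      "x \<in> carrier H \<Longrightarrow> y \<in> carrier H \<Longrightarrow> z \<in> carrier H
        \<Longrightarrow> cinner H (x \<oplus> y) z = cinner H x z + cinner H y z"
    and cinner_smult_left:
      "x \<in> carrier H \<Longrightarrow> y \<in> carrier H \<Longrightarrow> cinner H (a \<odot> x) y = a * cinner H x y"
    and cinner_ge_zero: "x \<in> carrier H \<Longrightarrow> 0 \<le> Re (cinner H x x)"
    and cinner_eq_zero: "x \<in> carrier H \<Longrightarrow> cinner H x x = 0 \<Longrightarrow> x = \<zero>"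

locale complex_hilbert_space = complex_inner_space +
  assumes complete: "Metric_space.mcomplete (carrier H) (vdist H)"

definition bounded_operator :: "'v inner_space \<Rightarrow> ('v \<Rightarrow> 'v) \<Rightarrow> bool"
  where "bounded_operator H T \<longleftrightarrow>
    T \<in> carrier H \<rightarrow>\<^sub>E carrier H \<and>
    (\<forall>x\<in>carrier H. \<forall>y\<in>carrier H. T (x \<oplus>\<^bsub>H\<^esub> y) = T x \<oplus>\<^bsub>H\<^esub> T y) \<and>
    (\<forall>a. \<forall>x\<in>carrier H. T (a \<odot>\<^bsub>H\<^esub> x) = a \<odot>\<^bsub>H\<^esub> T x) \<and>
    (\<exists>C. \<forall>x\<in>carrier H. vnorm H (T x) \<le> C * vnorm H x)"

definition operator_monoid :: "'v inner_space \<Rightarrow> ('v \<Rightarrow> 'v) monoid"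
  where "operator_monoid H =
    \<lparr>carrier = {T. bounded_operator H T}, monoid.mult = compose (carrier H),
     one = (\<lambda>x\<in>carrier H. x)\<rparr>"

definition operator_norm :: "'v inner_space \<Rightarrow> ('v \<Rightarrow> 'v) \<Rightarrow> real"
  where "operator_norm H T = (SUP x\<in>{x \<in> carrier H. vnorm H x \<le> 1}. vnorm H (T x))"

section \<open>Uniformly bounded representations and Property (T)\<close>

definition uniformly_bounded_rep ::
  "real \<Rightarrow> 'g monoid \<Rightarrow> 'v inner_space \<Rightarrow> ('g \<Rightarrow> 'v \<Rightarrow> 'v) \<Rightarrow> bool"
  where "uniformly_bounded_rep c G H \<pi> \<longleftrightarrow>
    complex_hilbert_space H \<and> \<pi> \<in> hom G (units_of (operator_monoid H)) \<and>
    (\<forall>s\<in>carrier G. operator_norm H (\<pi> s) \<le> c)"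

definition almost_has_invariant_vectors ::
  "'g monoid \<Rightarrow> 'v inner_space \<Rightarrow> ('g \<Rightarrow> 'v \<Rightarrow> 'v) \<Rightarrow> bool"
  where "almost_has_invariant_vectors G H \<pi> \<longleftrightarrow>
    (\<forall>Q \<epsilon>. Q \<subseteq> carrier G \<and> finite Q \<and> \<epsilon> > 0 \<longrightarrow>
      (\<exists>\<xi>\<in>carrier H. \<forall>s\<in>Q. vnorm H (\<pi> s \<xi> \<ominus>\<^bsub>H\<^esub> \<xi>) < \<epsilon> * vnorm H \<xi>))"

definition has_nonzero_invariant_vector ::
  "'g monoid \<Rightarrow> 'v inner_space \<Rightarrow> ('g \<Rightarrow> 'v \<Rightarrow> 'v) \<Rightarrow> bool"
  where "has_nonzero_invariant_vector G H \<pi> \<longleftrightarrow>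
    (\<exists>\<xi>\<in>carrier H. \<xi> \<noteq> \<zero>\<^bsub>H\<^esub> \<and> (\<forall>s\<in>carrier G. \<pi> s \<xi> = \<xi>))"

definition property_T :: "'v itself \<Rightarrow> real \<Rightarrow> 'g monoid \<Rightarrow> bool"
  where "property_T _ c G \<longleftrightarrow>
    (\<forall>(H :: 'v inner_space) \<pi>. uniformly_bounded_rep c G H \<pi> \<longrightarrow>
      almost_has_invariant_vectors G H \<pi> \<longrightarrow> has_nonzero_invariant_vector G H \<pi>)"

text \<open>
  The type \<open>nat \<Rightarrow> complex\<close> is large enough to carry all separable Hilbert spaces, and for a countable
  group no other type gives a smaller value; see \<open>property_T_universe\<close> below.
\<close>

definition c_ub :: "'g monoid \<Rightarrow> ereal"
  where "c_ub G = (INF c \<in> {c. c \<ge> 1 \<and> \<not> property_T TYPE(nat \<Rightarrow> complex) c G}. ereal c)"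

section \<open>Independence of the universe\<close>

text \<open>
  In the definition of \<open>c_ub\<close>, the representations live on Hilbert spaces whose carrier is a set of
  elements of type \<open>nat \<Rightarrow> complex\<close>. For countable \<open>G\<close> this is no restriction: if Property (T)
  holds for these Hilbert spaces, then it holds for Hilbert spaces over every type. Indeed, choose
  one almost invariant vector for each finite \<open>Q\<close> and each \<open>\<epsilon> = 1/(k+1)\<close>; the closed invariant
  subspace generated by these countably many vectors is separable, hence has at most the
  cardinality of the continuum, so it can be transported to \<open>nat \<Rightarrow> complex\<close>.
\<close>

lemma complex_ring_simps [simp]:
  "carrier complex_ring = UNIV" "a \<otimes>\<^bsub>complex_ring\<^esub> b = a * b"
  "a \<oplus>\<^bsub>complex_ring\<^esub> b = a + b" "\<one>\<^bsub>complex_ring\<^esub> = 1" "\<zero>\<^bsub>complex_ring\<^esub> = 0"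
  by (simp_all add: complex_ring_def)

lemma cring_complex_ring: "cring complex_ring"
proof (rule cringI)
  show "abelian_group complex_ring"
    by (rule abelian_groupI) (auto intro: exI[of _ "- x" for x] simp: add_eq_0_iff2)
  show "comm_monoid complex_ring"
    by (rule comm_monoidI) auto
qed (auto simp: algebra_simps)

context complex_inner_space
begin

lemma cinner_zero_left [simp]: "x \<in> carrier H \<Longrightarrow> cinner H \<zero> x = 0"
  using cinner_add_left[of \<zero> \<zero> x] by simp

lemma cinner_add_right:
  "x \<in> carrier H \<Longrightarrow> y \<in> carrier H \<Longrightarrow> z \<in> carrier H
    \<Longrightarrow> cinner H x (y \<oplus> z) = cinner H x y + cinner H x z"
  by (simp add: cinner_commute[of _ x] cinner_add_left)

lemma cinner_smult_right:
  "x \<in> carrier H \<Longrightarrow> y \<in> carrier H \<Longrightarrow> cinner H x (a \<odot> y) = cnj a * cinner H x y"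
  by (simp add: cinner_commute[of _ x] cinner_smult_left)

lemma Im_cinner_self: "x \<in> carrier H \<Longrightarrow> Im (cinner H x x) = 0"
  using cinner_commute[of x x] by (simp add: complex_eq_iff)

lemma vnorm_ge_zero: "x \<in> carrier H \<Longrightarrow> 0 \<le> vnorm H x"
  by (simp add: vnorm_def cinner_ge_zero)

lemma vnorm_square: "x \<in> carrier H \<Longrightarrow> (vnorm H x)\<^sup>2 = Re (cinner H x x)"
  by (simp add: vnorm_def cinner_ge_zero)

lemma vnorm_eq_zero: "x \<in> carrier H \<Longrightarrow> vnorm H x = 0 \<longleftrightarrow> x = \<zero>"
  using cinner_eq_zero[of x] Im_cinner_self[of x]
  by (auto simp: vnorm_def complex_eq_iff)

lemma vnorm_smult:
  assumes "x \<in> carrier H"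
  shows "vnorm H (a \<odot> x) = cmod a * vnorm H x"
proof -
  have "cinner H (a \<odot> x) (a \<odot> x) = (a * cnj a) * cinner H x x"
    using assms by (simp add: cinner_smult_left cinner_smult_right)
  also have "\<dots> = of_real ((cmod a)\<^sup>2) * cinner H x x"
    by (simp only: complex_norm_square)
  finally have "Re (cinner H (a \<odot> x) (a \<odot> x)) = (cmod a)\<^sup>2 * Re (cinner H x x)" by simp
  then show ?thesis by (simp add: vnorm_def real_sqrt_mult)
qed

lemma Re_cinner_le:
  assumes x: "x \<in> carrier H" and y: "y \<in> carrier H"
  shows "Re (cinner H x y) \<le> vnorm H x * vnorm H y"
proof (cases "y = \<zero>")
  case True
  then show ?thesis using x cinner_commute[of \<zero> x] vnorm_ge_zero by (simp add: vnorm_eq_zero)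
next
  case False
  define a b c where "a = Re (cinner H x x)" and "b = Re (cinner H x y)" and "c = Re (cinner H y y)"
  have "(vnorm H y)\<^sup>2 \<noteq> 0" using False vnorm_eq_zero[OF y] by simp
  then have "c \<noteq> 0" unfolding c_def vnorm_square[OF y] .
  then have c: "c > 0" using cinner_ge_zero[OF y] by (simp add: c_def)
  define t where "t = - b / c"
  have yx: "Re (cinner H y x) = b" using cinner_commute[OF x y] by (simp add: b_def)
  have "0 \<le> Re (cinner H (x \<oplus> of_real t \<odot> y) (x \<oplus> of_real t \<odot> y))"
    using x y by (intro cinner_ge_zero) auto
  also have "\<dots> = a + t * b + t * b + t * t * c"
    using x y by (simp add: cinner_add_left cinner_add_right cinner_smult_left cinner_smult_right
        a_def b_def[symmetric] c_def yx algebra_simps)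
  also have "\<dots> = a - b\<^sup>2 / c"
    using c by (simp add: t_def field_simps power2_eq_square)
  finally have "b\<^sup>2 \<le> a * c" using c by (simp add: field_simps)
  then have "b\<^sup>2 \<le> (vnorm H x * vnorm H y)\<^sup>2"
    using x y by (simp add: power_mult_distrib vnorm_square a_def c_def)
  then have "b \<le> vnorm H x * vnorm H y"
    using x y by (intro power2_le_imp_le[of b]) (auto simp: vnorm_ge_zero)
  then show ?thesis by (simp add: b_def)
qed

lemma vnorm_triangle:
  assumes x: "x \<in> carrier H" and y: "y \<in> carrier H"
  shows "vnorm H (x \<oplus> y) \<le> vnorm H x + vnorm H y"
proof (rule power2_le_imp_le)
  have "Re (cinner H y x) = Re (cinner H x y)" using cinner_commute[OF x y] by simp
  then have "(vnorm H (x \<oplus> y))\<^sup>2 = (vnorm H x)\<^sup>2 + 2 * Re (cinner H x y) + (vnorm H y)\<^sup>2"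
    using x y by (simp add: vnorm_square cinner_add_left cinner_add_right)
  also have "\<dots> \<le> (vnorm H x + vnorm H y)\<^sup>2"
    using Re_cinner_le[OF x y] by (simp add: power2_sum)
  finally show "(vnorm H (x \<oplus> y))\<^sup>2 \<le> (vnorm H x + vnorm H y)\<^sup>2" .
qed (use x y vnorm_ge_zero in auto)

lemma uminus_eq_smult: "x \<in> carrier H \<Longrightarrow> \<ominus> x = (- 1) \<odot> x"
proof -
  assume x: "x \<in> carrier H"
  have "(- 1 + 1) \<odot> x = ((- 1) \<odot> x) \<oplus> (1 \<odot> x)"
    using smult_l_distr[of "- 1" 1 x] x by simp
  moreover have "(0 :: complex) \<odot> x = \<zero>" using smult_l_null[OF x] by simp
  moreover have "1 \<odot> x = x" using smult_one[OF x] by simp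
  ultimately have "((- 1) \<odot> x) \<oplus> x = \<zero>" by simp
  then show ?thesis using x by (intro M.minus_equality) auto
qed

lemma vdist_commute: "x \<in> carrier H \<Longrightarrow> y \<in> carrier H \<Longrightarrow> vdist H x y = vdist H y x"
proof -
  assume x: "x \<in> carrier H" and y: "y \<in> carrier H"
  have "x \<ominus> y = \<ominus> (y \<ominus> x)"
    using x y by (simp add: M.minus_eq M.minus_add M.a_comm)
  then show ?thesis
    using x y uminus_eq_smult[of "y \<ominus> x"] by (simp add: vdist_def vnorm_smult)
qed

lemma minus_add_minus:
  "x \<in> carrier H \<Longrightarrow> y \<in> carrier H \<Longrightarrow> z \<in> carrier H \<Longrightarrow> x \<ominus> z = (x \<ominus> y) \<oplus> (y \<ominus> z)"
  by (simp add: M.minus_eq M.a_assoc M.r_neg1)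

lemma minus_eq_zero: "x \<in> carrier H \<Longrightarrow> y \<in> carrier H \<Longrightarrow> x \<ominus> y = \<zero> \<longleftrightarrow> x = y"
  by (metis M.minus_eq M.minus_equality M.minus_minus M.a_inv_closed M.r_neg)

lemma vdist_triangle:
  assumes "x \<in> carrier H" "y \<in> carrier H" "z \<in> carrier H"
  shows "vdist H x z \<le> vdist H x y + vdist H y z"
  using assms vnorm_triangle[of "x \<ominus> y" "y \<ominus> z"] minus_add_minus[OF assms]
  by (simp add: vdist_def)

sublocale Met: Metric_space "carrier H" "vdist H"
proof
  show "0 \<le> vdist H x y" for x y
    by (simp add: vdist_def vnorm_ge_zero)
  show "vdist H x y = vdist H y x" for x y
    using vdist_commute[of x y] by (cases "x \<in> carrier H \<and> y \<in> carrier H") (auto simp: vdist_def)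
  show "vdist H x y = 0 \<longleftrightarrow> x = y" if "x \<in> carrier H" "y \<in> carrier H" for x y
    using that by (auto simp: vdist_def vnorm_eq_zero minus_eq_zero)
  show "vdist H x z \<le> vdist H x y + vdist H y z"
    if "x \<in> carrier H" "y \<in> carrier H" "z \<in> carrier H" for x y z
    using that by (rule vdist_triangle)
qed

end

definition transport :: "'v inner_space \<Rightarrow> 'v set \<Rightarrow> ('v \<Rightarrow> 'w) \<Rightarrow> 'w inner_space"
  where "transport H V j =
    \<lparr>carrier = j ` V, monoid.mult = (\<lambda>a b. undefined), one = undefined, zero = j \<zero>\<^bsub>H\<^esub>,
     add = (\<lambda>a b. j (inv_into V j a \<oplus>\<^bsub>H\<^esub> inv_into V j b)),
     module.smult = (\<lambda>c a. j (c \<odot>\<^bsub>H\<^esub> inv_into V j a)),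
     cinner = (\<lambda>a b. cinner H (inv_into V j a) (inv_into V j b))\<rparr>"

locale transported_subspace = complex_hilbert_space H for H :: "'v inner_space" (structure) +
  fixes V :: "'v set" and j :: "'v \<Rightarrow> 'w"
  assumes subset: "V \<subseteq> carrier H"
    and zero_in: "\<zero> \<in> V"
    and add_in: "x \<in> V \<Longrightarrow> y \<in> V \<Longrightarrow> x \<oplus> y \<in> V"
    and smult_in: "x \<in> V \<Longrightarrow> a \<odot> x \<in> V"
    and closed: "x \<in> carrier H \<Longrightarrow> (\<And>\<epsilon>. \<epsilon> > 0 \<Longrightarrow> \<exists>y\<in>V. vdist H y x < \<epsilon>) \<Longrightarrow> x \<in> V"
    and inj: "inj_on j V"
begin

abbreviation K :: "'w inner_space" where "K \<equiv> transport H V j"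

lemma in_carrier: "x \<in> V \<Longrightarrow> x \<in> carrier H"
  using subset by blast

lemma K_simps:
  "carrier K = j ` V"
  "\<zero>\<^bsub>K\<^esub> = j \<zero>"
  "x \<in> V \<Longrightarrow> y \<in> V \<Longrightarrow> j x \<oplus>\<^bsub>K\<^esub> j y = j (x \<oplus> y)"
  "x \<in> V \<Longrightarrow> c \<odot>\<^bsub>K\<^esub> j x = j (c \<odot> x)"
  "x \<in> V \<Longrightarrow> y \<in> V \<Longrightarrow> cinner K (j x) (j y) = cinner H x y"
  "x \<in> V \<Longrightarrow> vnorm K (j x) = vnorm H x"
  using inj by (simp_all add: transport_def vnorm_def inv_into_f_f)

lemma uminus_in: "x \<in> V \<Longrightarrow> \<ominus> x \<in> V"
  by (simp add: uminus_eq_smult in_carrier smult_in)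

lemma j_eq_iff: "x \<in> V \<Longrightarrow> y \<in> V \<Longrightarrow> j x = j y \<longleftrightarrow> x = y"
  using inj by (auto dest: inj_onD)

lemma abelian_group_K: "abelian_group K"
proof (rule abelian_groupI; unfold K_simps(1))
  show "\<exists>y\<in>j ` V. y \<oplus>\<^bsub>K\<^esub> x = \<zero>\<^bsub>K\<^esub>" if x: "x \<in> j ` V" for x
  proof -
    obtain v where v: "v \<in> V" "x = j v" using x by (elim imageE)
    then have "j (\<ominus> v) \<oplus>\<^bsub>K\<^esub> x = \<zero>\<^bsub>K\<^esub>"
      by (simp add: K_simps uminus_in in_carrier M.l_neg)
    then show ?thesis using v uminus_in by blast
  qed
qed (auto simp: K_simps add_in zero_in in_carrier M.a_ac)

lemma complex_inner_space_K: "complex_inner_space K"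
proof (intro complex_inner_space.intro complex_inner_space_axioms.intro)
  show "Module.module complex_ring K"
  proof (rule Module.moduleI[OF cring_complex_ring abelian_group_K]; unfold K_simps(1))
    show "(a \<oplus>\<^bsub>complex_ring\<^esub> b) \<odot>\<^bsub>K\<^esub> x = a \<odot>\<^bsub>K\<^esub> x \<oplus>\<^bsub>K\<^esub> b \<odot>\<^bsub>K\<^esub> x" if "x \<in> j ` V" for a b x
      using that smult_l_distr[of a b] by (auto simp: K_simps smult_in in_carrier)
    show "a \<odot>\<^bsub>K\<^esub> (x \<oplus>\<^bsub>K\<^esub> y) = a \<odot>\<^bsub>K\<^esub> x \<oplus>\<^bsub>K\<^esub> a \<odot>\<^bsub>K\<^esub> y" if "x \<in> j ` V" "y \<in> j ` V" for a x y
      using that smult_r_distr[of a] by (auto simp: K_simps smult_in add_in in_carrier)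
    show "(a \<otimes>\<^bsub>complex_ring\<^esub> b) \<odot>\<^bsub>K\<^esub> x = a \<odot>\<^bsub>K\<^esub> (b \<odot>\<^bsub>K\<^esub> x)" if "x \<in> j ` V" for a b x
      using that smult_assoc1[of a b] by (auto simp: K_simps smult_in in_carrier)
    show "\<one>\<^bsub>complex_ring\<^esub> \<odot>\<^bsub>K\<^esub> x = x" if "x \<in> j ` V" for x
      using that smult_one by (auto simp: K_simps in_carrier)
  qed (auto simp: K_simps smult_in)
  show "cinner K y x = cnj (cinner K x y)" if "x \<in> carrier K" "y \<in> carrier K" for x y
    using that unfolding K_simps(1) by (auto simp: K_simps intro!: cinner_commute in_carrier)
  show "x = \<zero>\<^bsub>K\<^esub>" if "x \<in> carrier K" "cinner K x x = 0" for x
    using that unfolding K_simps(1) by (auto simp: K_simps dest: cinner_eq_zero[OF in_carrier])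
qed (auto simp: K_simps add_in smult_in in_carrier cinner_add_left cinner_smult_left cinner_ge_zero)

lemma diff_K: "x \<in> V \<Longrightarrow> y \<in> V \<Longrightarrow> j x \<ominus>\<^bsub>K\<^esub> j y = j (x \<ominus> y)"
proof -
  assume x: "x \<in> V" and y: "y \<in> V"
  have "\<ominus>\<^bsub>K\<^esub> (j y) = j (\<ominus> y)"
    using y by (intro abelian_group.minus_equality[OF abelian_group_K])
      (auto simp: K_simps uminus_in in_carrier M.l_neg)
  then show ?thesis
    using x y by (simp add: abelian_group.minus_eq[OF abelian_group_K] M.minus_eq K_simps uminus_in)
qed

lemma diff_in: "x \<in> V \<Longrightarrow> y \<in> V \<Longrightarrow> x \<ominus> y \<in> V"
  by (simp add: M.minus_eq add_in uminus_in)

lemma vdist_K: "x \<in> V \<Longrightarrow> y \<in> V \<Longrightarrow> vdist K (j x) (j y) = vdist H x y"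
  by (simp add: vdist_def K_simps(1) in_carrier diff_K diff_in K_simps(6))

lemma complex_hilbert_space_K: "complex_hilbert_space K"
proof (intro complex_hilbert_space.intro complex_hilbert_space_axioms.intro)
  interpret K: complex_inner_space K by (rule complex_inner_space_K)
  show "complex_inner_space K" by (rule complex_inner_space_K)
  show "K.Met.mcomplete"
    unfolding K.Met.mcomplete_def
  proof (intro allI impI)
    fix \<sigma> assume \<sigma>: "K.Met.MCauchy \<sigma>"
    define x where "x n = inv_into V j (\<sigma> n)" for n
    have "range \<sigma> \<subseteq> carrier K"
      using \<sigma> unfolding K.Met.MCauchy_def by (rule conjunct1)
    then have "\<sigma> n \<in> j ` V" for n
      unfolding K_simps(1) by blast
    then have x: "x n \<in> V" "\<sigma> n = j (x n)" for n
      by (simp_all add: x_def f_inv_into_f inv_into_into)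
    have "Met.MCauchy x"
      using \<sigma> unfolding K.Met.MCauchy_def Met.MCauchy_def
      by (auto simp: x vdist_K in_carrier)
    then obtain l where l: "limitin Met.mtopology x l sequentially"
      using complete unfolding Met.mcomplete_def by blast
    then have l_in: "l \<in> carrier H" by (simp add: Met.limitin_metric)
    have "l \<in> V"
    proof (rule closed[OF l_in])
      fix \<epsilon> :: real assume "\<epsilon> > 0"
      then have "\<forall>\<^sub>F n in sequentially. x n \<in> carrier H \<and> vdist H (x n) l < \<epsilon>"
        using l by (simp add: Met.limitin_metric)
      then obtain n where "vdist H (x n) l < \<epsilon>" by (auto simp: eventually_sequentially)
      then show "\<exists>y\<in>V. vdist H y l < \<epsilon>" using x by blast
    qed
    then have "limitin K.Met.mtopology \<sigma> (j l) sequentially"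
      using l x unfolding K.Met.limitin_metric Met.limitin_metric by (simp add: vdist_K K_simps(1) in_carrier)
    then show "\<exists>l. limitin K.Met.mtopology \<sigma> l sequentially" by blast
  qed
qed

end

lemma operator_unit_bounded: "T \<in> carrier (units_of (operator_monoid H)) \<Longrightarrow> bounded_operator H T"
  by (simp add: units_of_def Units_def operator_monoid_def)

context complex_inner_space
begin

lemma operator_norm_bdd:
  assumes "bounded_operator H T"
  shows "bdd_above ((\<lambda>x. vnorm H (T x)) ` {x \<in> carrier H. vnorm H x \<le> 1})"
proof -
  obtain C where C: "\<forall>x\<in>carrier H. vnorm H (T x) \<le> C * vnorm H x"
    using assms by (auto simp: bounded_operator_def)
  have "vnorm H (T x) \<le> \<bar>C\<bar>" if "x \<in> carrier H" "vnorm H x \<le> 1" for x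
  proof -
    have "C * vnorm H x \<le> \<bar>C\<bar> * 1"
      using that vnorm_ge_zero[OF that(1)] by (intro mult_mono) auto
    then show ?thesis using C that by force
  qed
  then show ?thesis by (intro bdd_aboveI[of _ "\<bar>C\<bar>"]) auto
qed

end

lemma countable_presented_group:
  "countable (carrier (presented_group (S :: 'a :: countable set) R))"
  by (simp add: presented_group_def quotient_def)

lemma property_T_universe:
  fixes G :: "'g monoid"
  assumes "group G" and "countable (carrier G)"
    and T: "property_T TYPE(nat \<Rightarrow> complex) c G"
  shows "property_T TYPE('v) c G"
  unfolding property_T_def
proof (intro allI impI)
  fix H :: "'v inner_space" and \<pi>
  assume rep: "uniformly_bounded_rep c G H \<pi>" and ai: "almost_has_invariant_vectors G H \<pi>"
  interpret G: group G by fact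
  interpret complex_hilbert_space H using rep by (simp add: uniformly_bounded_rep_def)
  have hom: "\<pi> \<in> hom G (units_of (operator_monoid H))"
    and norm_le: "\<And>s. s \<in> carrier G \<Longrightarrow> operator_norm H (\<pi> s) \<le> c"
    using rep by (auto simp: uniformly_bounded_rep_def)
  have bounded: "bounded_operator H (\<pi> s)" if "s \<in> carrier G" for s
    using hom_in_carrier[OF hom that] by (rule operator_unit_bounded)
  have pi_in: "\<pi> s x \<in> carrier H" if "s \<in> carrier G" "x \<in> carrier H" for s x
    using bounded[OF that(1)] that(2) by (auto simp: bounded_operator_def)
  have pi_add: "\<pi> s (x \<oplus>\<^bsub>H\<^esub> y) = \<pi> s x \<oplus>\<^bsub>H\<^esub> \<pi> s y"
    if "s \<in> carrier G" "x \<in> carrier H" "y \<in> carrier H" for s x y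
    using bounded[OF that(1)] that(2,3) by (auto simp: bounded_operator_def)
  have pi_smult: "\<pi> s (a \<odot>\<^bsub>H\<^esub> x) = a \<odot>\<^bsub>H\<^esub> \<pi> s x" if "s \<in> carrier G" "x \<in> carrier H" for s a x
    using bounded[OF that(1)] that(2) by (auto simp: bounded_operator_def)
  have pi_bound: "\<exists>C. \<forall>x\<in>carrier H. vnorm H (\<pi> s x) \<le> C * vnorm H x" if "s \<in> carrier G" for s
    using bounded[OF that] by (auto simp: bounded_operator_def)
  have pi_diff: "\<pi> s (x \<ominus>\<^bsub>H\<^esub> y) = \<pi> s x \<ominus>\<^bsub>H\<^esub> \<pi> s y"
    if "s \<in> carrier G" "x \<in> carrier H" "y \<in> carrier H" for s x y
    using that by (simp add: M.minus_eq pi_add uminus_eq_smult pi_smult pi_in)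
  have pi_mult: "\<pi> (s \<otimes>\<^bsub>G\<^esub> t) x = \<pi> s (\<pi> t x)"
    if "s \<in> carrier G" "t \<in> carrier G" "x \<in> carrier H" for s t x
    using hom_mult[OF hom that(1,2)] that(3)
    by (simp add: units_of_def operator_monoid_def compose_eq)
  have pi_one: "\<pi> \<one>\<^bsub>G\<^esub> x = x" if x: "x \<in> carrier H" for x
  proof -
    have "\<pi> \<one>\<^bsub>G\<^esub> \<in> Units (operator_monoid H)"
      using hom_in_carrier[OF hom G.one_closed] by (simp add: units_of_def)
    then obtain T where "compose (carrier H) T (\<pi> \<one>\<^bsub>G\<^esub>) = (\<lambda>x\<in>carrier H. x)"
      by (auto simp: Units_def operator_monoid_def)
    then have T: "T (\<pi> \<one>\<^bsub>G\<^esub> y) = y" if "y \<in> carrier H" for y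
      using that by (metis compose_eq restrict_apply')
    have "\<pi> \<one>\<^bsub>G\<^esub> (\<pi> \<one>\<^bsub>G\<^esub> x) = \<pi> \<one>\<^bsub>G\<^esub> x" using pi_mult[of "\<one>\<^bsub>G\<^esub>" "\<one>\<^bsub>G\<^esub>" x] x by simp
    then show ?thesis using T[of "\<pi> \<one>\<^bsub>G\<^esub> x"] T[of x] x pi_in[of "\<one>\<^bsub>G\<^esub>" x] by simp
  qed

  define P where "P = {Q. finite Q \<and> Q \<subseteq> carrier G} \<times> (UNIV :: nat set)"
  have "countable P"
    unfolding P_def using countable_Collect_finite_subset[OF assms(2)] by auto
  have "\<forall>p\<in>P. \<exists>\<xi>. \<xi> \<in> carrier H \<and>
      (\<forall>s\<in>fst p. vnorm H (\<pi> s \<xi> \<ominus>\<^bsub>H\<^esub> \<xi>) < 1 / real (Suc (snd p)) * vnorm H \<xi>)"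
  proof
    fix p assume "p \<in> P"
    then have "fst p \<subseteq> carrier G \<and> finite (fst p) \<and> 1 / real (Suc (snd p)) > 0"
      by (auto simp: P_def)
    with ai show "\<exists>\<xi>. \<xi> \<in> carrier H \<and>
      (\<forall>s\<in>fst p. vnorm H (\<pi> s \<xi> \<ominus>\<^bsub>H\<^esub> \<xi>) < 1 / real (Suc (snd p)) * vnorm H \<xi>)"
      unfolding almost_has_invariant_vectors_def by blast
  qed
  from bchoice[OF this] obtain \<xi> where
    xi_in: "\<And>p. p \<in> P \<Longrightarrow> \<xi> p \<in> carrier H" and
    xi: "\<And>p s. p \<in> P \<Longrightarrow> s \<in> fst p \<Longrightarrow>
      vnorm H (\<pi> s (\<xi> p) \<ominus>\<^bsub>H\<^esub> \<xi> p) < 1 / real (Suc (snd p)) * vnorm H (\<xi> p)"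
    by blast

  define A where "A = (\<lambda>(a, b). Complex a b) ` (\<rat> \<times> \<rat>)"
  have "countable A" unfolding A_def by (intro countable_image countable_SIGMA countable_rat)
  define step where "step E = E \<union> (\<lambda>(x, y). x \<oplus>\<^bsub>H\<^esub> y) ` (E \<times> E) \<union> (\<lambda>(a, x). a \<odot>\<^bsub>H\<^esub> x) ` (A \<times> E)
    \<union> (\<lambda>(s, x). \<pi> s x) ` (carrier G \<times> E)" for E
  define L where "L n = (step ^^ n) (insert \<zero>\<^bsub>H\<^esub> (\<xi> ` P))" for n
  have L_Suc: "L (Suc n) = step (L n)" for n by (simp add: L_def)
  have L_mono: "L m \<subseteq> L n" if "m \<le> n" for m n
    using that by (rule lift_Suc_mono_le[rotated]) (auto simp: L_Suc step_def)
  define D where "D = (\<Union>n. L n)"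
  have "countable (L n)" for n
  proof (induction n)
    case 0
    then show ?case using \<open>countable P\<close> by (simp add: L_def)
  next
    case (Suc n)
    then show ?case unfolding L_Suc step_def
      by (intro countable_Un countable_image countable_SIGMA \<open>countable A\<close> assms(2)) auto
  qed
  then have countable_D: "countable D" by (simp add: D_def)
  have "L n \<subseteq> carrier H" for n
  proof (induction n)
    case 0
    then show ?case using xi_in by (auto simp: L_def)
  next
    case (Suc n)
    then show ?case unfolding L_Suc step_def by (auto intro!: pi_in smult_closed)
  qed
  then have D_in: "x \<in> carrier H" if "x \<in> D" for x using that by (auto simp: D_def)
  have D_zero: "\<zero>\<^bsub>H\<^esub> \<in> D" by (auto simp: D_def L_def intro!: exI[of _ 0])
  have D_xi: "\<xi> p \<in> D" if "p \<in> P" for p using that by (auto simp: D_def L_def intro!: exI[of _ 0])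
  have D_add: "x \<oplus>\<^bsub>H\<^esub> y \<in> D" if xy: "x \<in> D" "y \<in> D" for x y
  proof -
    obtain m n where "x \<in> L m" "y \<in> L n" using xy by (auto simp: D_def)
    then have "x \<in> L (max m n)" "y \<in> L (max m n)"
      using L_mono[of m "max m n"] L_mono[of n "max m n"] by auto
    then have "x \<oplus>\<^bsub>H\<^esub> y \<in> L (Suc (max m n))" unfolding L_Suc step_def by force
    then show ?thesis unfolding D_def by blast
  qed
  have D_smult: "a \<odot>\<^bsub>H\<^esub> x \<in> D" if "a \<in> A" and x: "x \<in> D" for a x
  proof -
    obtain n where "x \<in> L n" using x by (auto simp: D_def)
    then have "a \<odot>\<^bsub>H\<^esub> x \<in> L (Suc n)" unfolding L_Suc step_def using \<open>a \<in> A\<close> by force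
    then show ?thesis unfolding D_def by blast
  qed
  have D_pi: "\<pi> s x \<in> D" if "s \<in> carrier G" and x: "x \<in> D" for s x
  proof -
    obtain n where "x \<in> L n" using x by (auto simp: D_def)
    then have "\<pi> s x \<in> L (Suc n)" unfolding L_Suc step_def using \<open>s \<in> carrier G\<close> by force
    then show ?thesis unfolding D_def by blast
  qed

  define V where "V = {x \<in> carrier H. \<forall>\<epsilon>>0. \<exists>d\<in>D. vdist H d x < \<epsilon>}"
  have V_in: "x \<in> carrier H" if "x \<in> V" for x using that by (simp add: V_def)
  have V_approx: "\<exists>d\<in>D. vdist H d x < \<epsilon>" if "x \<in> V" "\<epsilon> > 0" for x \<epsilon>
    using that by (simp add: V_def)
  have D_V: "x \<in> V" if "x \<in> D" for x
    using that D_in[OF that] by (auto simp: V_def intro!: bexI[of _ x])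
  have V_closed: "x \<in> V" if x: "x \<in> carrier H" and *: "\<And>\<epsilon>. \<epsilon> > 0 \<Longrightarrow> \<exists>y\<in>V. vdist H y x < \<epsilon>" for x
    unfolding V_def
  proof (intro CollectI conjI allI impI x)
    fix \<epsilon> :: real assume "\<epsilon> > 0"
    then obtain y where y: "y \<in> V" "vdist H y x < \<epsilon> / 2" using *[of "\<epsilon> / 2"] by auto
    obtain d where d: "d \<in> D" "vdist H d y < \<epsilon> / 2" using V_approx[OF y(1), of "\<epsilon> / 2"] \<open>\<epsilon> > 0\<close> by auto
    have "vdist H d x \<le> vdist H d y + vdist H y x"
      using d(1) y(1) x D_in V_in by (intro vdist_triangle) auto
    then show "\<exists>d\<in>D. vdist H d x < \<epsilon>" using d y by (intro bexI[of _ d]) auto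
  qed
  have V_add: "x \<oplus>\<^bsub>H\<^esub> y \<in> V" if xy: "x \<in> V" "y \<in> V" for x y
    unfolding V_def
  proof (intro CollectI conjI allI impI)
    show "x \<oplus>\<^bsub>H\<^esub> y \<in> carrier H" using xy V_in by simp
    fix \<epsilon> :: real assume "\<epsilon> > 0"
    then obtain d e where d: "d \<in> D" "vdist H d x < \<epsilon> / 2" and e: "e \<in> D" "vdist H e y < \<epsilon> / 2"
      using V_approx[OF xy(1), of "\<epsilon> / 2"] V_approx[OF xy(2), of "\<epsilon> / 2"] by auto
    have c: "x \<in> carrier H" "y \<in> carrier H" "d \<in> carrier H" "e \<in> carrier H"
      using xy d(1) e(1) V_in D_in by auto
    have "(d \<oplus>\<^bsub>H\<^esub> e) \<ominus>\<^bsub>H\<^esub> (x \<oplus>\<^bsub>H\<^esub> y) = (d \<ominus>\<^bsub>H\<^esub> x) \<oplus>\<^bsub>H\<^esub> (e \<ominus>\<^bsub>H\<^esub> y)"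
      using c by (simp add: M.minus_eq M.minus_add M.a_ac)
    then have "vdist H (d \<oplus>\<^bsub>H\<^esub> e) (x \<oplus>\<^bsub>H\<^esub> y) \<le> vdist H d x + vdist H e y"
      using c vnorm_triangle[of "d \<ominus>\<^bsub>H\<^esub> x" "e \<ominus>\<^bsub>H\<^esub> y"] by (simp add: vdist_def)
    then show "\<exists>d\<in>D. vdist H d (x \<oplus>\<^bsub>H\<^esub> y) < \<epsilon>"
      using d e D_add by (intro bexI[of _ "d \<oplus>\<^bsub>H\<^esub> e"]) auto
  qed
  have lipschitz_V: "f x \<in> V" if x: "x \<in> V" and f: "\<And>y. y \<in> carrier H \<Longrightarrow> f y \<in> carrier H"
      and fD: "\<And>d. d \<in> D \<Longrightarrow> f d \<in> D"
      and C: "\<And>y z. y \<in> carrier H \<Longrightarrow> z \<in> carrier H \<Longrightarrow> vdist H (f y) (f z) \<le> C * vdist H y z"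
    for f C x
    unfolding V_def
  proof (intro CollectI conjI allI impI)
    show "f x \<in> carrier H" using x V_in f by simp
    fix \<epsilon> :: real assume "\<epsilon> > 0"
    then have "\<epsilon> / (\<bar>C\<bar> + 1) > 0" by (intro divide_pos_pos) auto
    then obtain d where d: "d \<in> D" "vdist H d x < \<epsilon> / (\<bar>C\<bar> + 1)" using V_approx[OF x] by blast
    have "vdist H (f d) (f x) \<le> C * vdist H d x" using C D_in V_in d x by auto
    also have "\<dots> \<le> (\<bar>C\<bar> + 1) * vdist H d x" by (intro mult_right_mono) auto
    also have "\<dots> < \<epsilon>" using d(2) by (simp add: pos_less_divide_eq mult.commute add_nonneg_pos)
    finally show "\<exists>d\<in>D. vdist H d (f x) < \<epsilon>" using fD d by blast
  qed
  have V_smult_A: "a \<odot>\<^bsub>H\<^esub> x \<in> V" if "a \<in> A" "x \<in> V" for a x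
  proof (rule lipschitz_V[of x "\<lambda>x. a \<odot>\<^bsub>H\<^esub> x" "cmod a"])
    show "vdist H (a \<odot>\<^bsub>H\<^esub> y) (a \<odot>\<^bsub>H\<^esub> z) \<le> cmod a * vdist H y z"
      if "y \<in> carrier H" "z \<in> carrier H" for y z
    proof -
      have "a \<odot>\<^bsub>H\<^esub> y \<ominus>\<^bsub>H\<^esub> a \<odot>\<^bsub>H\<^esub> z = a \<odot>\<^bsub>H\<^esub> (y \<ominus>\<^bsub>H\<^esub> z)"
        using that by (simp add: M.minus_eq smult_r_distr smult_r_minus)
      then show ?thesis using that by (simp add: vdist_def vnorm_smult)
    qed
  qed (use that D_smult in auto)
  have V_smult: "a \<odot>\<^bsub>H\<^esub> x \<in> V" if x: "x \<in> V" for a x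
  proof (rule V_closed)
    show "a \<odot>\<^bsub>H\<^esub> x \<in> carrier H" using x V_in by simp
    fix \<epsilon> :: real assume "\<epsilon> > 0"
    define \<delta> where "\<delta> = \<epsilon> / (vnorm H x + 1) / 2"
    have x': "x \<in> carrier H" using x V_in by simp
    have pos: "vnorm H x + 1 > 0" using vnorm_ge_zero[OF x'] by simp
    then have "\<delta> > 0" using \<open>\<epsilon> > 0\<close> by (simp add: \<delta>_def)
    obtain p q where p: "p \<in> \<rat>" "\<bar>p - Re a\<bar> < \<delta>" and q: "q \<in> \<rat>" "\<bar>q - Im a\<bar> < \<delta>"
      using Rats_dense_in_real[of "Re a - \<delta>" "Re a + \<delta>"] Rats_dense_in_real[of "Im a - \<delta>" "Im a + \<delta>"]
        \<open>\<delta> > 0\<close> by (auto simp: abs_less_iff)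
    define b where "b = Complex p q"
    have "cmod (b - a) \<le> \<bar>Re (b - a)\<bar> + \<bar>Im (b - a)\<bar>" by (rule cmod_le)
    also have "\<dots> < 2 * \<delta>" using p q by (simp add: b_def)
    also have "2 * \<delta> = \<epsilon> / (vnorm H x + 1)" unfolding \<delta>_def by (rule field_sum_of_halves[folded mult_2])
    finally have ba: "cmod (b - a) < \<epsilon> / (vnorm H x + 1)" .
    have "b \<odot>\<^bsub>H\<^esub> x \<ominus>\<^bsub>H\<^esub> a \<odot>\<^bsub>H\<^esub> x = (b - a) \<odot>\<^bsub>H\<^esub> x"
    proof -
      have "(b - a) \<odot>\<^bsub>H\<^esub> x \<oplus>\<^bsub>H\<^esub> a \<odot>\<^bsub>H\<^esub> x = b \<odot>\<^bsub>H\<^esub> x"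
        using smult_l_distr[of "b - a" a x] x' by simp
      then show ?thesis using x' by (metis M.add.inv_solve_right' M.minus_eq UNIV_I complex_ring_simps(1) smult_closed)
    qed
    then have "vdist H (b \<odot>\<^bsub>H\<^esub> x) (a \<odot>\<^bsub>H\<^esub> x) = cmod (b - a) * vnorm H x"
      using x' by (simp add: vdist_def vnorm_smult)
    also have "\<dots> \<le> cmod (b - a) * (vnorm H x + 1)" by (intro mult_left_mono) auto
    also have "\<dots> < \<epsilon>" using ba pos by (simp add: pos_less_divide_eq)
    finally have "vdist H (b \<odot>\<^bsub>H\<^esub> x) (a \<odot>\<^bsub>H\<^esub> x) < \<epsilon>" .
    moreover have "b \<in> A" using p q by (auto simp: A_def b_def)
    ultimately show "\<exists>y\<in>V. vdist H y (a \<odot>\<^bsub>H\<^esub> x) < \<epsilon>" using V_smult_A x by blast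
  qed
  have V_pi: "\<pi> s x \<in> V" if s: "s \<in> carrier G" and x: "x \<in> V" for s x
  proof -
    obtain C where C: "\<forall>x\<in>carrier H. vnorm H (\<pi> s x) \<le> C * vnorm H x" using pi_bound[OF s] by blast
    show ?thesis
    proof (rule lipschitz_V[of x "\<pi> s" C])
      show "vdist H (\<pi> s y) (\<pi> s z) \<le> C * vdist H y z" if "y \<in> carrier H" "z \<in> carrier H" for y z
        using that C s by (simp add: vdist_def pi_in pi_diff[symmetric])
    qed (use x pi_in D_pi s in auto)
  qed

  define approx where "approx x k = (SOME d. d \<in> D \<and> vdist H d x < 1 / real (Suc k))" for x k
  have approx: "approx x k \<in> D" "vdist H (approx x k) x < 1 / real (Suc k)" if "x \<in> V" for x k
    using someI_ex[of "\<lambda>d. d \<in> D \<and> vdist H d x < 1 / real (Suc k)"] V_approx[OF that, of "1 / real (Suc k)"]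
    unfolding approx_def by auto
  define j :: "'v \<Rightarrow> nat \<Rightarrow> complex" where "j x k = of_nat (to_nat_on D (approx x k))" for x k
  have inj: "inj_on j V"
  proof (rule inj_onI)
    fix x y assume x: "x \<in> V" and y: "y \<in> V" and "j x = j y"
    have x': "x \<in> carrier H" and y': "y \<in> carrier H" using x y V_in by auto
    have le: "vdist H x y \<le> 2 * inverse (real (Suc k))" for k
    proof -
      have "j x k = j y k" using \<open>j x = j y\<close> by simp
      then have eq: "approx x k = approx y k"
        using approx(1)[OF x] approx(1)[OF y] countable_D by (simp add: j_def)
      have "vdist H x y \<le> vdist H x (approx x k) + vdist H (approx x k) y"
        using x' y' D_in[OF approx(1)[OF x]] by (intro vdist_triangle)
      also have "vdist H x (approx x k) = vdist H (approx x k) x" by (rule Met.commute)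
      finally show ?thesis
        using approx(2)[OF x, of k] approx(2)[OF y, of k] eq by (simp add: inverse_eq_divide)
    qed
    have "(\<lambda>k. 2 * inverse (real (Suc k))) \<longlonglongrightarrow> 2 * 0"
      by (intro tendsto_mult tendsto_const LIMSEQ_inverse_real_of_nat)
    then have "vdist H x y \<le> 2 * 0"
      by (rule LIMSEQ_le_const) (use le in blast)
    then show "x = y" using x' y' Met.nonneg[of x y] Met.zero[of x y] by simp
  qed

  interpret transported_subspace H V j
    by unfold_locales (use V_in D_V D_zero V_add V_smult V_closed inj in auto)

  define \<rho> where "\<rho> s = (\<lambda>a\<in>carrier K. j (\<pi> s (inv_into V j a)))" for s
  have rho: "\<rho> s (j x) = j (\<pi> s x)" if "x \<in> V" for s x
    using that inj by (simp add: \<rho>_def K_simps(1) inv_into_f_f)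
  have rho_bounded: "bounded_operator K (\<rho> s)" if s: "s \<in> carrier G" for s
    unfolding bounded_operator_def
  proof (intro conjI)
    show "\<rho> s \<in> carrier K \<rightarrow>\<^sub>E carrier K"
    proof (rule PiE_I)
      show "\<rho> s a \<in> carrier K" if "a \<in> carrier K" for a
        using that s V_pi unfolding K_simps(1) by (auto simp: rho)
    qed (simp add: \<rho>_def)
    show "\<forall>a\<in>carrier K. \<forall>b\<in>carrier K. \<rho> s (a \<oplus>\<^bsub>K\<^esub> b) = \<rho> s a \<oplus>\<^bsub>K\<^esub> \<rho> s b"
      using s unfolding K_simps(1) by (auto simp: rho K_simps add_in V_pi pi_add in_carrier)
    show "\<forall>a. \<forall>x\<in>carrier K. \<rho> s (a \<odot>\<^bsub>K\<^esub> x) = a \<odot>\<^bsub>K\<^esub> \<rho> s x"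
      using s unfolding K_simps(1) by (auto simp: rho K_simps smult_in V_pi pi_smult in_carrier)
    show "\<exists>C. \<forall>a\<in>carrier K. vnorm K (\<rho> s a) \<le> C * vnorm K a"
    proof -
      obtain C where "\<forall>x\<in>carrier H. vnorm H (\<pi> s x) \<le> C * vnorm H x" using pi_bound[OF s] by blast
      then show ?thesis
        using s unfolding K_simps(1) by (intro exI[of _ C]) (auto simp: rho K_simps V_pi in_carrier)
    qed
  qed
  have rho_mult: "\<rho> (s \<otimes>\<^bsub>G\<^esub> t) = compose (carrier K) (\<rho> s) (\<rho> t)"
    if "s \<in> carrier G" "t \<in> carrier G" for s t
  proof
    fix a
    show "\<rho> (s \<otimes>\<^bsub>G\<^esub> t) a = compose (carrier K) (\<rho> s) (\<rho> t) a"
    proof (cases "a \<in> carrier K")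
      case True
      then obtain x where "x \<in> V" "a = j x" unfolding K_simps(1) by blast
      then show ?thesis using that True by (simp add: compose_eq rho V_pi pi_mult in_carrier)
    next
      case False
      then show ?thesis by (simp add: \<rho>_def compose_def)
    qed
  qed
  have rho_one: "\<rho> \<one>\<^bsub>G\<^esub> = (\<lambda>a\<in>carrier K. a)"
  proof
    fix a
    show "\<rho> \<one>\<^bsub>G\<^esub> a = (\<lambda>a\<in>carrier K. a) a"
    proof (cases "a \<in> carrier K")
      case True
      then obtain x where "x \<in> V" "a = j x" unfolding K_simps(1) by blast
      then show ?thesis using True by (simp add: rho pi_one in_carrier)
    next
      case False
      then show ?thesis by (simp add: \<rho>_def)
    qed
  qed
  have rho_unit: "\<rho> s \<in> Units (operator_monoid K)" if "s \<in> carrier G" for s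
    unfolding Units_def operator_monoid_def
    using that rho_bounded[of s] rho_bounded[of "inv\<^bsub>G\<^esub> s"] rho_mult[of s "inv\<^bsub>G\<^esub> s"]
      rho_mult[of "inv\<^bsub>G\<^esub> s" s] rho_one
    by (auto intro!: bexI[of _ "\<rho> (inv\<^bsub>G\<^esub> s)"])
  have "\<rho> \<in> hom G (units_of (operator_monoid K))"
    by (rule homI) (simp_all add: units_of_def rho_unit, simp add: operator_monoid_def rho_mult)
  moreover have "operator_norm K (\<rho> s) \<le> c" if s: "s \<in> carrier G" for s
  proof -
    have "operator_norm K (\<rho> s) \<le> operator_norm H (\<pi> s)"
      unfolding operator_norm_def
    proof (rule cSUP_mono)
      show "{x \<in> carrier K. vnorm K x \<le> 1} \<noteq> {}"
        using zero_in vnorm_eq_zero[of "\<zero>\<^bsub>H\<^esub>"] unfolding K_simps(1)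
        by (auto simp: K_simps intro!: bexI[of _ "\<zero>\<^bsub>H\<^esub>"])
      show "bdd_above ((\<lambda>x. vnorm H (\<pi> s x)) ` {x \<in> carrier H. vnorm H x \<le> 1})"
        by (rule operator_norm_bdd[OF bounded[OF s]])
      show "\<exists>x\<in>{x \<in> carrier H. vnorm H x \<le> 1}. vnorm K (\<rho> s a) \<le> vnorm H (\<pi> s x)"
        if a: "a \<in> {x \<in> carrier K. vnorm K x \<le> 1}" for a
      proof -
        obtain x where "x \<in> V" "a = j x" using a unfolding K_simps(1) by blast
        then show ?thesis using a s
          by (intro bexI[of _ x]) (auto simp: rho V_pi K_simps(6) in_carrier)
      qed
    qed
    then show ?thesis using norm_le[OF s] by simp
  qed
  ultimately have "uniformly_bounded_rep c G K \<rho>"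
    by (simp add: uniformly_bounded_rep_def complex_hilbert_space_K)
  moreover have "almost_has_invariant_vectors G K \<rho>"
    unfolding almost_has_invariant_vectors_def
  proof (intro allI impI)
    fix Q and \<epsilon> :: real assume Q: "Q \<subseteq> carrier G \<and> finite Q \<and> \<epsilon> > 0"
    then obtain k where k: "1 / real (Suc k) < \<epsilon>" using nat_approx_posE by blast
    have p: "(Q, k) \<in> P" using Q by (simp add: P_def)
    let ?x = "\<xi> (Q, k)"
    have x: "?x \<in> V" using D_V D_xi p by simp
    have "vnorm K (\<rho> s (j ?x) \<ominus>\<^bsub>K\<^esub> j ?x) < \<epsilon> * vnorm K (j ?x)" if s: "s \<in> Q" for s
    proof -
      have s': "s \<in> carrier G" using s Q by auto
      have "vnorm K (\<rho> s (j ?x) \<ominus>\<^bsub>K\<^esub> j ?x) = vnorm H (\<pi> s ?x \<ominus>\<^bsub>H\<^esub> ?x)"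
        using x s' by (simp add: rho V_pi diff_K diff_in K_simps(6))
      also have "\<dots> < 1 / real (Suc k) * vnorm H ?x" using xi[OF p, of s] s by simp
      also have "\<dots> \<le> \<epsilon> * vnorm H ?x"
        using k vnorm_ge_zero[OF in_carrier[OF x]] by (intro mult_right_mono) auto
      finally show ?thesis using x by (simp add: K_simps(6))
    qed
    then show "\<exists>\<xi>\<in>carrier K. \<forall>s\<in>Q. vnorm K (\<rho> s \<xi> \<ominus>\<^bsub>K\<^esub> \<xi>) < \<epsilon> * vnorm K \<xi>"
      using x unfolding K_simps(1) by blast
  qed
  ultimately have "has_nonzero_invariant_vector G K \<rho>"
    using T unfolding property_T_def by blast
  then obtain a where a: "a \<in> j ` V" "a \<noteq> j \<zero>\<^bsub>H\<^esub>" "\<forall>s\<in>carrier G. \<rho> s a = a"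
    unfolding has_nonzero_invariant_vector_def K_simps by blast
  then obtain x where x: "x \<in> V" "a = j x" by blast
  have "\<forall>s\<in>carrier G. \<pi> s x = x"
  proof
    fix s assume s: "s \<in> carrier G"
    then have "j (\<pi> s x) = j x" using a(3) x rho[OF x(1), of s] by simp
    then show "\<pi> s x = x" by (rule inj_onD[OF inj _ V_pi[OF s x(1)] x(1)])
  qed
  moreover have "x \<noteq> \<zero>\<^bsub>H\<^esub>" using x(2) a(2) by auto
  ultimately show "has_nonzero_invariant_vector G H \<pi>"
    unfolding has_nonzero_invariant_vector_def using in_carrier[OF x(1)] by (intro bexI conjI)
qed

text \<open>Hence Hilbert spaces over other types cannot lower \<open>c_ub\<close> of a countable group.\<close>

lemma c_ub_presented_group_le:
  fixes S :: "'a :: countable set"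
  assumes "c \<ge> 1" "\<not> property_T TYPE('v) c (presented_group S R)"
  shows "c_ub (presented_group S R) \<le> ereal c"
  unfolding c_ub_def
  using assms property_T_universe[OF group_presented_group countable_presented_group]
  by (intro INF_lower) blast

end

theory Submission
  imports Defs "HOL-Real_Asymp.Real_Asymp"
begin

text \<open>Let \<open>\<pi>\<close> be a representation bounded by \<open>c\<close> and let \<open>N x\<close> be the supremum of the norms of
  \<open>\<pi> s x\<close>, an invariant norm with \<open>\<parallel>x\<parallel> \<le> N x \<le> c \<parallel>x\<parallel>\<close>. For a vector \<open>\<xi>\<close> put \<open>f s = \<pi> s \<xi>\<close> for
  letters \<open>s\<close>, and let \<open>W\<close> be the averaging operator of the link graph. Since every relator has length
  3, \<open>\<pi> s (W f s\<^sup>-\<^sup>1) = W f s\<close>. If \<open>W\<close> contracts functions of mean zero by a factor \<open>\<epsilon>\<close>, then \<open>W f\<close>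
  is within \<open>c \<epsilon>\<close> times the deviation of \<open>f\<close> of the constant function \<open>b\<close>, the barycenter of \<open>f\<close>;
  so \<open>b\<close> is almost fixed by the generators. Precisely, if \<open>c \<epsilon> \<le> 1/5\<close> then the generators
  move \<open>b\<close> at most half as much as \<open>\<xi>\<close>, and iterating \<open>\<xi> \<mapsto> b\<close> yields an invariant vector near \<open>\<xi>\<close>.
  Hence \<open>c_ub\<close> is at least \<open>1 / (5 \<epsilon>)\<close>.

  With \<open>m\<close> relators the link graph is a sum of random graphs of degree about \<open>\<lambda> = m / n\<close>, where
  \<open>\<lambda> \<ge> 4/5 log n\<close>. As in the method of Kahn and Szemeredi, their quadratic forms are split at each
  vector into light pairs, controlled by exponential moments and a net, and heavy pairs, controlled
  by the degrees and by the sparsity of small subgraphs. Aiming only at \<open>\<epsilon> = O(\<lambda> powr (-1/6))\<close>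
  leaves enough room to treat the heavy pairs by crude estimates.\<close>

section \<open>Uniformly random subsets\<close>

text \<open>Two norms compete. The spectral gap is a statement about the Hilbert norm, while
  displacements can be moved by the group without loss only in \<open>N\<close>, which need not come
  from an inner product. The vectors are therefore transported in \<open>N\<close>, where convexity
  suffices, and in the contraction estimate the Hilbert norm replaces \<open>N\<close> just once;
  this costs a single factor \<open>c\<close> and leads to a bound of order 1 / \<epsilon>. On the
  probabilistic side the obstacle is that for \<lambda> of order log n the degrees do not
  concentrate. So the unnormalized quadratic form is compared with a constant multiple of the square
  of the sum, and degrees enter only through crude upper and lower bounds of order \<lambda>. The
  lower bound fails with probability at most 2 n exp (- 8/5 \<lambda>), which tends to 0 because 8/5
  times 4/5 exceeds 1. With x = \<lambda> powr (1/6), every error in the quadratic form is O(x^5)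
  against degrees of order x^6, whence \<epsilon> = O(1 / x).\<close>

definition subsets_of_card :: "'a set \<Rightarrow> nat \<Rightarrow> 'a set set"
  where "subsets_of_card T m = {R. R \<subseteq> T \<and> card R = m}"

locale random_subset =
  fixes T :: "'a set" and m :: nat
  assumes finite_T: "finite T" and m_le: "m \<le> card T" and T_nonempty: "T \<noteq> {}"
begin

definition p :: real where "p = real m / real (card T)"

abbreviation prob :: "('a set \<Rightarrow> bool) \<Rightarrow> real"
  where "prob P \<equiv> measure_pmf.prob (pmf_of_set (subsets_of_card T m)) {R. P R}"

lemma card_T_pos: "card T > 0"
  using finite_T T_nonempty by (simp add: card_gt_0_iff)

lemma p_nonneg: "0 \<le> p" and p_le_1: "p \<le> 1"
  using m_le card_T_pos by (simp_all add: p_def)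

lemma finite_subsets: "finite (subsets_of_card T m)"
  by (rule finite_subset[of _ "Pow T"]) (auto simp: subsets_of_card_def finite_T)

lemma card_subsets: "card (subsets_of_card T m) = card T choose m"
  unfolding subsets_of_card_def by (rule n_subsets[OF finite_T])

lemma subsets_nonempty: "subsets_of_card T m \<noteq> {}"
  using card_subsets m_le zero_less_binomial[OF m_le] by (metis card.empty less_irrefl)

lemma finite_member: "R \<in> subsets_of_card T m \<Longrightarrow> finite R"
  using finite_T finite_subset by (auto simp: subsets_of_card_def)

lemma prob_eq: "prob P = real (card {R \<in> subsets_of_card T m. P R}) / real (card (subsets_of_card T m))"
proof -
  have "subsets_of_card T m \<inter> {R. P R} = {R \<in> subsets_of_card T m. P R}" by auto
  then show ?thesis
    using measure_pmf_of_set[OF subsets_nonempty finite_subsets, of "{R. P R}"] by simp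
qed

lemma prob_mono: "(\<And>R. R \<in> subsets_of_card T m \<Longrightarrow> P R \<Longrightarrow> Q R) \<Longrightarrow> prob P \<le> prob Q"
  unfolding prob_eq by (intro divide_right_mono) (auto intro!: card_mono finite_subsets)

lemma prob_disj: "prob (\<lambda>R. P R \<or> Q R) \<le> prob P + prob Q"
proof -
  have "{R. P R \<or> Q R} = {R. P R} \<union> {R. Q R}" by auto
  then show ?thesis by (simp add: measure_Un_le)
qed

lemma prob_Bex:
  assumes "finite I" and "\<And>i. i \<in> I \<Longrightarrow> prob (P i) \<le> b i"
  shows "prob (\<lambda>R. \<exists>i\<in>I. P i R) \<le> (\<Sum>i\<in>I. b i)"
proof -
  have "{R. \<exists>i\<in>I. P i R} = (\<Union>i\<in>I. {R. P i R})" by auto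
  moreover have "measure_pmf.prob (pmf_of_set (subsets_of_card T m)) (\<Union>i\<in>I. {R. P i R}) \<le> (\<Sum>i\<in>I. prob (P i))"
    by (rule measure_UNION_le) (use assms(1) in auto)
  ultimately show ?thesis using sum_mono[of I, OF assms(2)] by force
qed

lemma prob_not: "prob (\<lambda>R. \<not> P R) = 1 - prob P"
proof -
  have "{R. \<not> P R} = UNIV - {R. P R}" by auto
  then show ?thesis using measure_pmf.prob_compl[of "{R. P R}"] by simp
qed

section \<open>Comparison with independent choices and tail bounds\<close>

text \<open>Inclusions of distinct elements are negatively correlated. Adding one element to
  \<open>K\<close>: transpositions show that, among the sets containing \<open>K\<close>, all
  elements outside \<open>K\<close> occur equally often, so double counting gives the proportion (m
  - k) / (|T| - k) with k = |K|, which is at most m / |T|.\<close>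

lemma card_supersets:
  assumes "K \<subseteq> T"
  shows "real (card {R \<in> subsets_of_card T m. K \<subseteq> R}) \<le> p ^ card K * real (card (subsets_of_card T m))"
proof -
  have fK: "finite K" using assms finite_T finite_subset by auto
  show ?thesis using fK assms
  proof (induction K rule: finite_induct)
    case empty
    then show ?case by simp
  next
    case (insert x K)
    define C where "C = {R \<in> subsets_of_card T m. K \<subseteq> R}"
    have fC: "finite C" unfolding C_def using finite_subsets by simp
    have Kx: "K \<subseteq> T" "x \<in> T" "x \<notin> K" using insert by auto
    have cards: "card {R \<in> C. y \<in> R} = card {R \<in> C. x \<in> R}" if y: "y \<in> T - K" for y
    proof (rule bij_betw_same_card)
      define \<tau> where "\<tau> = Transposition.transpose x y"
      have tau: "\<tau> ` \<tau> ` R = R" for R unfolding \<tau>_def by (simp add: image_comp)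
      have K: "\<tau> ` K = K" unfolding \<tau>_def
        using Kx y by (intro transpose_image_eq) auto
      have T: "\<tau> ` T = T" unfolding \<tau>_def
        using Kx y by (intro transpose_image_eq) auto
      have card: "card (\<tau> ` R) = card R" for R
        unfolding \<tau>_def by (rule card_image, rule inj_onI) (metis transpose_involutory)
      have mem: "\<tau> ` R \<in> C" if "R \<in> C" for R
        using that K T card image_mono[of R T \<tau>] image_mono[of K R \<tau>]
        unfolding C_def subsets_of_card_def by simp
      show "bij_betw (image \<tau>) {R \<in> C. y \<in> R} {R \<in> C. x \<in> R}"
      proof (rule bij_betw_byWitness[where f' = "image \<tau>"])
        have "\<tau> x = y" "\<tau> y = x" by (simp_all add: \<tau>_def)
        then show "image \<tau> ` {R \<in> C. y \<in> R} \<subseteq> {R \<in> C. x \<in> R}"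
          "image \<tau> ` {R \<in> C. x \<in> R} \<subseteq> {R \<in> C. y \<in> R}"
          using mem by (auto intro: rev_image_eqI)
      qed (auto simp: tau)
    qed
    have "(\<Sum>y\<in>T - K. card {R \<in> C. y \<in> R}) = (\<Sum>y\<in>T - K. \<Sum>R\<in>C. if y \<in> R then 1 else 0)"
      using fC by (intro sum.cong HOL.refl) (simp add: sum.If_cases Int_def)
    also have "\<dots> = (\<Sum>R\<in>C. \<Sum>y\<in>T - K. if y \<in> R then 1 else 0)" by (rule sum.swap)
    also have "\<dots> = (\<Sum>R\<in>C. m - card K)"
    proof (rule sum.cong[OF HOL.refl])
      fix R assume R: "R \<in> C"
      then have "(T - K) \<inter> {y. y \<in> R} = R - K" by (auto simp: C_def subsets_of_card_def)
      then show "(\<Sum>y\<in>T - K. if y \<in> R then 1 else 0) = m - card K"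
        using R finite_T insert(1) by (simp add: sum.If_cases card_Diff_subset C_def subsets_of_card_def)
    qed
    finally have "card (T - K) * card {R \<in> C. x \<in> R} = card C * (m - card K)"
      using cards by simp
    then have eq: "(card T - card K) * card {R \<in> C. x \<in> R} = card C * (m - card K)"
      using insert(1) Kx by (simp add: card_Diff_subset)
    have less: "card K < card T" using Kx finite_T by (metis psubsetI psubset_card_mono)
    have "real (card {R \<in> C. x \<in> R}) \<le> p * card C"
    proof (cases "card K \<le> m")
      case True
      have "real (card T - card K) * real (card {R \<in> C. x \<in> R}) = real (card C) * real (m - card K)"
        using eq by (metis of_nat_mult)
      then have "real (card {R \<in> C. x \<in> R}) = real (card C) * (real (m - card K) / real (card T - card K))"
        using less by (simp add: field_simps)
      also have "\<dots> \<le> real (card C) * p"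
        using True less m_le card_T_pos mult_left_mono[of "real m" "real (card T)" "real (card K)"]
        unfolding p_def by (intro mult_left_mono) (auto simp: divide_simps of_nat_diff algebra_simps)
      finally show ?thesis by (simp add: mult.commute)
    next
      case False
      then have "card {R \<in> C. x \<in> R} = 0" using eq less by simp
      then show ?thesis using p_nonneg by simp
    qed
    also have "\<dots> \<le> p * (p ^ card K * real (card (subsets_of_card T m)))"
      using insert.IH Kx p_nonneg unfolding C_def by (intro mult_left_mono) auto
    finally have le: "real (card {R \<in> C. x \<in> R}) \<le> p * (p ^ card K * real (card (subsets_of_card T m)))" .
    have "{R \<in> C. x \<in> R} = {R \<in> subsets_of_card T m. insert x K \<subseteq> R}" by (auto simp: C_def)
    then show ?case using le insert(1,2) by (simp add: mult.assoc)
  qed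
qed

text \<open>Domination by independent inclusion with probability \<open>p\<close>: the product is
  expanded over subsets \<open>K\<close>; as the coefficients are nonnegative, each monomial can be
  bounded by \<open>card_supersets\<close> and the sum folded back.\<close>

lemma sum_prod_le:
  assumes u: "\<And>r. r \<in> T \<Longrightarrow> u r \<ge> 0"
  shows "(\<Sum>R\<in>subsets_of_card T m. \<Prod>r\<in>R. 1 + u r)
    \<le> real (card (subsets_of_card T m)) * (\<Prod>r\<in>T. 1 + p * u r)"
proof -
  let ?S = "subsets_of_card T m"
  have "(\<Sum>R\<in>?S. \<Prod>r\<in>R. 1 + u r) = (\<Sum>R\<in>?S. \<Sum>K\<in>Pow R. \<Prod>r\<in>K. u r)"
    using finite_member prod_add[of _ u "\<lambda>_. 1"] by (simp add: add.commute)
  also have "\<dots> = (\<Sum>R\<in>?S. \<Sum>K\<in>Pow T. if K \<subseteq> R then \<Prod>r\<in>K. u r else 0)"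
  proof (rule sum.cong[OF HOL.refl])
    fix R assume "R \<in> ?S"
    then have "Pow T \<inter> {K. K \<subseteq> R} = Pow R" by (auto simp: subsets_of_card_def)
    then show "(\<Sum>K\<in>Pow R. \<Prod>r\<in>K. u r) = (\<Sum>K\<in>Pow T. if K \<subseteq> R then \<Prod>r\<in>K. u r else 0)"
      using finite_T by (simp add: sum.If_cases)
  qed
  also have "\<dots> = (\<Sum>K\<in>Pow T. \<Sum>R\<in>?S. if K \<subseteq> R then \<Prod>r\<in>K. u r else 0)" by (rule sum.swap)
  also have "\<dots> = (\<Sum>K\<in>Pow T. real (card {R \<in> ?S. K \<subseteq> R}) * (\<Prod>r\<in>K. u r))"
    using finite_subsets by (intro sum.cong HOL.refl) (simp add: sum.If_cases Int_def)
  also have "\<dots> \<le> (\<Sum>K\<in>Pow T. p ^ card K * real (card ?S) * (\<Prod>r\<in>K. u r))"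
    using u by (intro sum_mono mult_right_mono card_supersets prod_nonneg) auto
  also have "\<dots> = real (card ?S) * (\<Sum>K\<in>Pow T. \<Prod>r\<in>K. p * u r)"
    by (simp add: sum_distrib_left prod.distrib mult_ac)
  also have "(\<Sum>K\<in>Pow T. \<Prod>r\<in>K. p * u r) = (\<Prod>r\<in>T. 1 + p * u r)"
    using prod_add[OF finite_T, of "\<lambda>r. p * u r" "\<lambda>_. 1"] by (simp add: add.commute)
  finally show ?thesis .
qed

lemma bij_complement: "bij_betw (\<lambda>R. T - R) (subsets_of_card T m) (subsets_of_card T (card T - m))"
proof (rule bij_betw_byWitness[where f' = "\<lambda>R. T - R"])
  show "(\<lambda>R. T - R) ` subsets_of_card T m \<subseteq> subsets_of_card T (card T - m)"
    using finite_T by (auto simp: subsets_of_card_def card_Diff_subset finite_subset)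
  show "(\<lambda>R. T - R) ` subsets_of_card T (card T - m) \<subseteq> subsets_of_card T m"
    using finite_T m_le by (auto simp: subsets_of_card_def card_Diff_subset finite_subset)
qed (auto simp: subsets_of_card_def)

text \<open>The case of nonpositive weights follows from the other one by passing to complements.\<close>

lemma sum_exp_le:
  assumes w: "(\<forall>r\<in>T. w r \<ge> 0) \<or> (\<forall>r\<in>T. w r \<le> 0)"
  shows "(\<Sum>R\<in>subsets_of_card T m. exp (\<Sum>r\<in>R. w r))
    \<le> real (card (subsets_of_card T m)) * (\<Prod>r\<in>T. 1 + p * (exp (w r) - 1))"
  using w
proof
  assume w: "\<forall>r\<in>T. w r \<ge> 0"
  have "(\<Sum>R\<in>subsets_of_card T m. exp (\<Sum>r\<in>R. w r)) = (\<Sum>R\<in>subsets_of_card T m. \<Prod>r\<in>R. 1 + (exp (w r) - 1))"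
    by (intro sum.cong HOL.refl) (simp add: exp_sum[OF finite_member])
  also have "\<dots> \<le> real (card (subsets_of_card T m)) * (\<Prod>r\<in>T. 1 + p * (exp (w r) - 1))"
    by (rule sum_prod_le) (use w in simp)
  finally show ?thesis .
next
  assume w: "\<forall>r\<in>T. w r \<le> 0"
  interpret c: random_subset T "card T - m"
    by unfold_locales (use finite_T T_nonempty in auto)
  have cp: "c.p = 1 - p"
    using m_le card_T_pos by (simp add: c.p_def p_def of_nat_diff field_simps)
  have cc: "card (subsets_of_card T (card T - m)) = card (subsets_of_card T m)"
    using bij_betw_same_card[OF bij_complement] by simp
  have "(\<Sum>R\<in>subsets_of_card T m. exp (\<Sum>r\<in>R. w r))
      = (\<Sum>R\<in>subsets_of_card T m. (\<Prod>r\<in>T. exp (w r)) * (\<Prod>r\<in>T - R. 1 + (exp (- w r) - 1)))"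
  proof (rule sum.cong[OF HOL.refl])
    fix R assume "R \<in> subsets_of_card T m"
    then have R: "R \<subseteq> T" by (simp add: subsets_of_card_def)
    have "(\<Sum>r\<in>R. w r) = (\<Sum>r\<in>T. w r) + (\<Sum>r\<in>T - R. - w r)"
      using sum.subset_diff[OF R finite_T, of w] by (simp add: sum_negf)
    then show "exp (\<Sum>r\<in>R. w r) = (\<Prod>r\<in>T. exp (w r)) * (\<Prod>r\<in>T - R. 1 + (exp (- w r) - 1))"
      using finite_T by (simp only: exp_add exp_sum finite_Diff) simp
  qed
  also have "\<dots> = (\<Prod>r\<in>T. exp (w r)) * (\<Sum>R\<in>subsets_of_card T (card T - m). \<Prod>r\<in>R. 1 + (exp (- w r) - 1))"
    unfolding sum_distrib_left
    by (rule sum.reindex_bij_betw[OF bij_complement, where g = "\<lambda>R. (\<Prod>r\<in>T. exp (w r)) * (\<Prod>r\<in>R. 1 + (exp (- w r) - 1))"])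
  also have "\<dots> \<le> (\<Prod>r\<in>T. exp (w r)) *
      (real (card (subsets_of_card T m)) * (\<Prod>r\<in>T. 1 + (1 - p) * (exp (- w r) - 1)))"
    using c.sum_prod_le[of "\<lambda>r. exp (- w r) - 1"] w unfolding cp cc
    by (intro mult_left_mono prod_nonneg) auto
  also have "\<dots> = real (card (subsets_of_card T m)) *
      (\<Prod>r\<in>T. exp (w r) * (1 + (1 - p) * (exp (- w r) - 1)))"
    by (simp add: prod.distrib)
  also have "(\<lambda>r. exp (w r) * (1 + (1 - p) * (exp (- w r) - 1))) = (\<lambda>r. 1 + p * (exp (w r) - 1))"
    by (simp add: fun_eq_iff exp_minus field_simps)
  finally show ?thesis .
qed

text \<open>Exponential Markov inequality with parameter 1; other parameters are obtained by scaling
  \<open>w\<close>.\<close>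

lemma prob_sum_ge:
  assumes w: "(\<forall>r\<in>T. w r \<ge> 0) \<or> (\<forall>r\<in>T. w r \<le> 0)"
  shows "prob (\<lambda>R. (\<Sum>r\<in>R. w r) \<ge> t) \<le> exp (p * (\<Sum>r\<in>T. exp (w r) - 1) - t)"
proof -
  let ?S = "subsets_of_card T m"
  have pos: "real (card ?S) > 0" using subsets_nonempty finite_subsets by (simp add: card_gt_0_iff)
  have "(\<Prod>r\<in>T. 1 + p * (exp (w r) - 1)) \<le> (\<Prod>r\<in>T. exp (p * (exp (w r) - 1)))"
  proof (rule prod_mono, intro conjI)
    fix r
    have "0 \<le> (1 - p) + p * exp (w r)"
      using p_nonneg p_le_1 by (intro add_nonneg_nonneg mult_nonneg_nonneg) auto
    then show "0 \<le> 1 + p * (exp (w r) - 1)" by (simp add: algebra_simps)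
  qed (rule exp_ge_add_one_self)
  also have "\<dots> = exp (p * (\<Sum>r\<in>T. exp (w r) - 1))"
    using finite_T by (simp only: exp_sum sum_distrib_left)
  finally have prod_le: "(\<Prod>r\<in>T. 1 + p * (exp (w r) - 1)) \<le> exp (p * (\<Sum>r\<in>T. exp (w r) - 1))" .
  have "real (card {R \<in> ?S. (\<Sum>r\<in>R. w r) \<ge> t}) = (\<Sum>R | R \<in> ?S \<and> (\<Sum>r\<in>R. w r) \<ge> t. 1)" by simp
  also have "\<dots> \<le> (\<Sum>R | R \<in> ?S \<and> (\<Sum>r\<in>R. w r) \<ge> t. exp ((\<Sum>r\<in>R. w r) - t))"
    by (rule sum_mono) auto
  also have "\<dots> \<le> (\<Sum>R\<in>?S. exp ((\<Sum>r\<in>R. w r) - t))"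
    using finite_subsets by (intro sum_mono2) auto
  also have "\<dots> = exp (- t) * (\<Sum>R\<in>?S. exp (\<Sum>r\<in>R. w r))"
    by (simp add: sum_distrib_left exp_diff exp_minus field_simps)
  also have "\<dots> \<le> exp (- t) * (real (card ?S) * (\<Prod>r\<in>T. 1 + p * (exp (w r) - 1)))"
    by (intro mult_left_mono sum_exp_le w) auto
  also have "\<dots> \<le> exp (- t) * (real (card ?S) * exp (p * (\<Sum>r\<in>T. exp (w r) - 1)))"
    by (intro mult_left_mono prod_le) auto
  finally have "real (card {R \<in> ?S. (\<Sum>r\<in>R. w r) \<ge> t}) \<le> exp (p * (\<Sum>r\<in>T. exp (w r) - 1) - t) * real (card ?S)"
    by (simp add: exp_diff exp_minus field_simps)
  then show ?thesis unfolding prob_eq using pos by (simp add: divide_le_eq)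
qed

text \<open>A bound of Bernstein type: exp y \<le> 1 + y + y^2 for |y| \<le> 1 controls the
  exponential moment to second order, so that after centering only the second moment
  remains.\<close>

lemma prob_deviation_ge:
  assumes w: "(\<forall>r\<in>T. w r \<ge> 0) \<or> (\<forall>r\<in>T. w r \<le> 0)" and w1: "\<And>r. r \<in> T \<Longrightarrow> \<bar>w r\<bar> \<le> 1"
  shows "prob (\<lambda>R. (\<Sum>r\<in>R. w r) - p * (\<Sum>r\<in>T. w r) \<ge> t) \<le> exp (p * (\<Sum>r\<in>T. (w r)\<^sup>2) - t)"
proof -
  have le: "exp x - 1 \<le> x + x\<^sup>2" if "\<bar>x\<bar> \<le> 1" for x :: real
  proof (cases "x \<ge> 0")
    case True
    then show ?thesis using exp_bound[of x] that by simp
  next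
    case False
    have "exp x = inverse (exp (- x))" by (simp add: exp_minus)
    also have "\<dots> \<le> inverse (1 - x)"
      using False exp_ge_add_one_self[of "- x"] by (intro le_imp_inverse_le) auto
    also have "\<dots> \<le> 1 + x + x\<^sup>2"
    proof -
      have "1 \<le> (1 + x + x\<^sup>2) * (1 - x)"
      proof -
        have "(1 + x + x\<^sup>2) * (1 - x) = 1 - x ^ 3" by (simp add: algebra_simps power2_eq_square power3_eq_cube)
        moreover have "x ^ 3 \<le> 0" using False by (simp add: power_le_zero_eq)
        ultimately show ?thesis by simp
      qed
      then show ?thesis using False by (simp add: inverse_eq_divide divide_le_eq)
    qed
    finally show ?thesis by simp
  qed
  have "prob (\<lambda>R. (\<Sum>r\<in>R. w r) - p * (\<Sum>r\<in>T. w r) \<ge> t) \<le> prob (\<lambda>R. (\<Sum>r\<in>R. w r) \<ge> t + p * (\<Sum>r\<in>T. w r))"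
    by (rule prob_mono) simp
  also have "\<dots> \<le> exp (p * (\<Sum>r\<in>T. exp (w r) - 1) - (t + p * (\<Sum>r\<in>T. w r)))"
    by (rule prob_sum_ge[OF w])
  also have "\<dots> \<le> exp (p * (\<Sum>r\<in>T. w r + (w r)\<^sup>2) - (t + p * (\<Sum>r\<in>T. w r)))"
    using le w1 p_nonneg by (simp add: mult_left_mono sum_mono)
  also have "\<dots> = exp (p * (\<Sum>r\<in>T. (w r)\<^sup>2) - t)"
    by (simp add: sum.distrib algebra_simps)
  finally show ?thesis .
qed

text \<open>The exponential moment bound requires weights of one sign. A general \<open>w\<close> is
  split into its positive and negative parts; a deviation of 2 t forces a deviation of t in one of
  them, up or down, hence four events.\<close>

lemma prob_abs_deviation_ge:
  assumes w1: "\<And>r. r \<in> T \<Longrightarrow> \<bar>w r\<bar> \<le> 1"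
  shows "prob (\<lambda>R. \<bar>(\<Sum>r\<in>R. w r) - p * (\<Sum>r\<in>T. w r)\<bar> \<ge> 2 * t) \<le> 4 * exp (p * (\<Sum>r\<in>T. (w r)\<^sup>2) - t)"
proof -
  define D where "D w R = (\<Sum>r\<in>R. w r) - p * (\<Sum>r\<in>T. w r)" for w :: "'a \<Rightarrow> real" and R
  define u v where "u r = max (w r) 0" and "v r = max (- w r) 0" for r
  have D: "D w R = D u R - D v R" for R
  proof -
    have "sum w A = sum u A - sum v A" for A
      unfolding sum_subtractf[symmetric] by (rule sum.cong) (auto simp: u_def v_def)
    then show ?thesis by (simp only: D_def right_diff_distrib)
  qed
  have D_neg: "D (\<lambda>r. - f r) R = - D f R" for f R by (simp add: D_def sum_negf)
  have bound: "prob (\<lambda>R. D f R \<ge> t) \<le> exp (p * (\<Sum>r\<in>T. (w r)\<^sup>2) - t)"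
    if "(\<forall>r\<in>T. f r \<ge> 0) \<or> (\<forall>r\<in>T. f r \<le> 0)" and f: "\<And>r. \<bar>f r\<bar> \<le> \<bar>w r\<bar>" for f
  proof -
    have "prob (\<lambda>R. D f R \<ge> t) \<le> exp (p * (\<Sum>r\<in>T. (f r)\<^sup>2) - t)"
      unfolding D_def using that(1) w1 f by (intro prob_deviation_ge) (auto intro: order_trans)
    also have "\<dots> \<le> exp (p * (\<Sum>r\<in>T. (w r)\<^sup>2) - t)"
      using f p_nonneg by (simp add: mult_left_mono sum_mono abs_le_square_iff)
    finally show ?thesis .
  qed
  have "prob (\<lambda>R. \<bar>D w R\<bar> \<ge> 2 * t) \<le> prob (\<lambda>R. (D u R \<ge> t \<or> D (\<lambda>r. - u r) R \<ge> t) \<or> (D v R \<ge> t \<or> D (\<lambda>r. - v r) R \<ge> t))"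
    by (rule prob_mono) (unfold D D_neg, linarith)
  also have "\<dots> \<le> (prob (\<lambda>R. D u R \<ge> t) + prob (\<lambda>R. D (\<lambda>r. - u r) R \<ge> t)) +
      (prob (\<lambda>R. D v R \<ge> t) + prob (\<lambda>R. D (\<lambda>r. - v r) R \<ge> t))"
    by (intro order_trans[OF prob_disj] add_mono prob_disj)
  also have "\<dots> \<le> 4 * exp (p * (\<Sum>r\<in>T. (w r)\<^sup>2) - t)"
  proof -
    have "prob (\<lambda>R. D u R \<ge> t) \<le> exp (p * (\<Sum>r\<in>T. (w r)\<^sup>2) - t)"
      "prob (\<lambda>R. D (\<lambda>r. - u r) R \<ge> t) \<le> exp (p * (\<Sum>r\<in>T. (w r)\<^sup>2) - t)"
      "prob (\<lambda>R. D v R \<ge> t) \<le> exp (p * (\<Sum>r\<in>T. (w r)\<^sup>2) - t)"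
      "prob (\<lambda>R. D (\<lambda>r. - v r) R \<ge> t) \<le> exp (p * (\<Sum>r\<in>T. (w r)\<^sup>2) - t)"
      by (rule bound; auto simp: u_def v_def)+
    then show ?thesis by linarith
  qed
  finally show ?thesis unfolding D_def .
qed

end

section \<open>Heavy and light pairs of sparse random graphs\<close>

lemma sum_edges_le_fibres:
  fixes \<phi> :: "'v \<Rightarrow> 'v \<Rightarrow> real"
  assumes "finite T" "finite U" "a ` T \<subseteq> U" "b ` T \<subseteq> U"
    and fibre: "\<And>s t. s \<in> U \<Longrightarrow> t \<in> U \<Longrightarrow> real (card {r \<in> T. a r = s \<and> b r = t}) \<le> F"
    and nonneg: "\<And>s t. \<phi> s t \<ge> 0"
  shows "(\<Sum>r\<in>T. \<phi> (a r) (b r)) \<le> F * (\<Sum>s\<in>U. \<Sum>t\<in>U. \<phi> s t)"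
proof -
  have "(\<Sum>r\<in>T. \<phi> (a r) (b r)) = (\<Sum>st\<in>U \<times> U. \<Sum>r | r \<in> T \<and> (a r, b r) = st. \<phi> (a r) (b r))"
    by (rule sum.group[symmetric]) (use assms in auto)
  also have "\<dots> = (\<Sum>st\<in>U \<times> U. real (card {r \<in> T. a r = fst st \<and> b r = snd st}) * \<phi> (fst st) (snd st))"
    by (rule sum.cong) auto
  also have "\<dots> \<le> (\<Sum>st\<in>U \<times> U. F * \<phi> (fst st) (snd st))"
    by (intro sum_mono mult_right_mono fibre nonneg) auto
  also have "\<dots> = F * (\<Sum>s\<in>U. \<Sum>t\<in>U. \<phi> s t)"
    by (simp add: sum_distrib_left sum.cartesian_product split_def)
  finally show ?thesis .
qed

lemma sum_vertex_le_degree: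
  fixes \<phi> :: "'v \<Rightarrow> real"
  assumes "finite R" "finite U" "a ` R \<subseteq> U"
    and degree: "\<And>s. s \<in> U \<Longrightarrow> real (card {r \<in> R. a r = s}) \<le> \<Delta>"
    and nonneg: "\<And>s. \<phi> s \<ge> 0"
  shows "(\<Sum>r\<in>R. \<phi> (a r)) \<le> \<Delta> * (\<Sum>s\<in>U. \<phi> s)"
proof -
  have "(\<Sum>r\<in>R. \<phi> (a r)) = (\<Sum>s\<in>U. \<Sum>r | r \<in> R \<and> a r = s. \<phi> (a r))"
    by (rule sum.group[symmetric]) (use assms in auto)
  also have "\<dots> = (\<Sum>s\<in>U. real (card {r \<in> R. a r = s}) * \<phi> s)"
    by (rule sum.cong) auto
  also have "\<dots> \<le> (\<Sum>s\<in>U. \<Delta> * \<phi> s)"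
    by (intro sum_mono mult_right_mono degree nonneg) auto
  finally show ?thesis by (simp add: sum_distrib_left)
qed

lemma abs_mult_le_weighted:
  fixes x y c :: real
  assumes "c > 0"
  shows "\<bar>x * y\<bar> \<le> (c * x\<^sup>2 + y\<^sup>2 / c) / 2"
proof -
  have "0 \<le> (c * \<bar>x\<bar> - \<bar>y\<bar>)\<^sup>2" by simp
  then have "2 * c * \<bar>x * y\<bar> \<le> c\<^sup>2 * x\<^sup>2 + y\<^sup>2"
    by (simp add: power2_diff power_mult_distrib abs_mult mult_ac)
  then show ?thesis using assms by (simp add: field_simps power2_eq_square)
qed

text \<open>Every subgraph has a vertex of degree at most \<open>2 k\<close>; removing these vertices one by one
  orients the graph with outdegrees at most \<open>2 k\<close>, and each edge is charged to its tail with
  weight \<open>c\<close> and to its head with weight \<open>1 / c\<close>.\<close>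

lemma sparse_graph_form_le:
  fixes z :: "'v \<Rightarrow> real"
  assumes "finite X" "finite R" "c > 0"
    and sparse: "\<And>Y. Y \<subseteq> X \<Longrightarrow> Y \<noteq> {} \<Longrightarrow> real (card {r \<in> R. a r \<in> Y \<and> b r \<in> Y}) \<le> k * real (card Y)"
  shows "(\<Sum>r | r \<in> R \<and> a r \<in> X \<and> b r \<in> X. \<bar>z (a r) * z (b r)\<bar>)
    \<le> k * c * (\<Sum>s\<in>X. (z s)\<^sup>2) + (\<Sum>r | r \<in> R \<and> a r \<in> X \<and> b r \<in> X. (z (a r))\<^sup>2 + (z (b r))\<^sup>2) / (2 * c)"
  using assms(1) sparse
proof (induction X rule: finite_psubset_induct)
  case (psubset X)
  show ?case
  proof (cases "X = {}")
    case True
    then show ?thesis by simp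
  next
    case False
    define E where "E = {r \<in> R. a r \<in> X \<and> b r \<in> X}"
    have fE: "finite E" unfolding E_def using assms by simp
    define d where "d s = card {r \<in> E. a r = s \<or> b r = s}" for s
    \<comment> \<open>An edge is counted at most twice in the sum of the degrees (a loop only once),
      so the average degree is at most 2 \<open>k\<close>.\<close>
    have "(\<Sum>s\<in>X. d s) = (\<Sum>s\<in>X. \<Sum>r\<in>E. if a r = s \<or> b r = s then 1 else 0)"
      unfolding d_def using fE by (intro sum.cong HOL.refl) (simp add: sum.If_cases Int_def)
    also have "\<dots> = (\<Sum>r\<in>E. \<Sum>s\<in>X. if a r = s \<or> b r = s then 1 else 0)" by (rule sum.swap)
    also have "\<dots> = (\<Sum>r\<in>E. card (X \<inter> {a r, b r}))"
    proof (rule sum.cong[OF HOL.refl])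
      fix r
      have "X \<inter> {s. a r = s \<or> b r = s} = X \<inter> {a r, b r}" by auto
      then show "(\<Sum>s\<in>X. if a r = s \<or> b r = s then 1 else 0) = card (X \<inter> {a r, b r})"
        using psubset.hyps by (simp add: sum.If_cases)
    qed
    also have "\<dots> \<le> (\<Sum>r\<in>E. 2)"
    proof (rule sum_mono)
      fix r
      have "card (X \<inter> {a r, b r}) \<le> card {a r, b r}" by (rule card_mono) auto
      also have "\<dots> \<le> 2" by (cases "a r = b r") auto
      finally show "card (X \<inter> {a r, b r}) \<le> 2" .
    qed
    finally have "(\<Sum>s\<in>X. d s) \<le> 2 * card E" by simp
    then have "real (\<Sum>s\<in>X. d s) \<le> real (2 * card E)" by (rule of_nat_mono)
    also have "\<dots> \<le> 2 * (k * real (card X))"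
      using psubset.prems[of X] False unfolding E_def by simp
    finally have sum_d: "(\<Sum>s\<in>X. real (d s)) \<le> (\<Sum>s\<in>X. 2 * k)" by (simp add: algebra_simps)
    obtain v where v: "v \<in> X" "real (d v) \<le> 2 * k"
    proof -
      have "\<exists>v\<in>X. real (d v) \<le> 2 * k"
      proof (rule ccontr)
        assume "\<not> (\<exists>v\<in>X. real (d v) \<le> 2 * k)"
        then have "(\<Sum>s\<in>X. 2 * k) < (\<Sum>s\<in>X. real (d s))"
          using False psubset.hyps by (intro sum_strict_mono) (auto simp: not_le)
        then show False using sum_d by simp
      qed
      then show thesis using that by blast
    qed
    define Ev where "Ev = {r \<in> E. a r = v \<or> b r = v}"
    define E' where "E' = {r \<in> R. a r \<in> X - {v} \<and> b r \<in> X - {v}}"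
    have E: "E = E' \<union> Ev" "E' \<inter> Ev = {}" unfolding E_def E'_def Ev_def by auto
    have fin: "finite E'" "finite Ev" using fE E(1) by auto
    \<comment> \<open>The estimate produces only the square at the end other than \<open>v\<close>;
      including both ends gives the second sum the same shape for all edges, so that the
      contributions of \<open>Ev\<close> and \<open>E'\<close> add up.\<close>
    have "(\<Sum>r\<in>Ev. \<bar>z (a r) * z (b r)\<bar>) \<le> (\<Sum>r\<in>Ev. c * (z v)\<^sup>2 / 2 + ((z (a r))\<^sup>2 + (z (b r))\<^sup>2) / (2 * c))"
    proof (rule sum_mono)
      fix r assume "r \<in> Ev"
      then consider "a r = v" | "b r = v" unfolding Ev_def by auto
      then show "\<bar>z (a r) * z (b r)\<bar> \<le> c * (z v)\<^sup>2 / 2 + ((z (a r))\<^sup>2 + (z (b r))\<^sup>2) / (2 * c)"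
      proof cases
        case 1
        have "\<bar>z (a r) * z (b r)\<bar> \<le> (c * (z (a r))\<^sup>2 + (z (b r))\<^sup>2 / c) / 2"
          by (rule abs_mult_le_weighted[OF assms(3)])
        also have "\<dots> \<le> c * (z v)\<^sup>2 / 2 + ((z (a r))\<^sup>2 + (z (b r))\<^sup>2) / (2 * c)"
          using 1 assms(3) by (simp add: field_simps)
        finally show ?thesis .
      next
        case 2
        have "\<bar>z (b r) * z (a r)\<bar> \<le> (c * (z (b r))\<^sup>2 + (z (a r))\<^sup>2 / c) / 2"
          by (rule abs_mult_le_weighted[OF assms(3)])
        also have "\<dots> \<le> c * (z v)\<^sup>2 / 2 + ((z (a r))\<^sup>2 + (z (b r))\<^sup>2) / (2 * c)"
          using 2 assms(3) by (simp add: field_simps)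
        finally show ?thesis by (simp add: mult.commute)
      qed
    qed
    also have "\<dots> = real (d v) * (c * (z v)\<^sup>2 / 2) + (\<Sum>r\<in>Ev. (z (a r))\<^sup>2 + (z (b r))\<^sup>2) / (2 * c)"
      unfolding sum.distrib sum_divide_distrib[symmetric] by (simp add: d_def Ev_def)
    also have "\<dots> \<le> 2 * k * (c * (z v)\<^sup>2 / 2) + (\<Sum>r\<in>Ev. (z (a r))\<^sup>2 + (z (b r))\<^sup>2) / (2 * c)"
      using v assms(3) by (intro add_right_mono mult_right_mono) auto
    finally have 1: "(\<Sum>r\<in>Ev. \<bar>z (a r) * z (b r)\<bar>)
      \<le> k * c * (z v)\<^sup>2 + (\<Sum>r\<in>Ev. (z (a r))\<^sup>2 + (z (b r))\<^sup>2) / (2 * c)" by simp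
    have 2: "(\<Sum>r\<in>E'. \<bar>z (a r) * z (b r)\<bar>)
      \<le> k * c * (\<Sum>s\<in>X - {v}. (z s)\<^sup>2) + (\<Sum>r\<in>E'. (z (a r))\<^sup>2 + (z (b r))\<^sup>2) / (2 * c)"
      unfolding E'_def using v by (intro psubset.IH psubset.prems) auto
    have "(\<Sum>r\<in>E. \<bar>z (a r) * z (b r)\<bar>) = (\<Sum>r\<in>E'. \<bar>z (a r) * z (b r)\<bar>) + (\<Sum>r\<in>Ev. \<bar>z (a r) * z (b r)\<bar>)"
      unfolding E(1) by (rule sum.union_disjoint[OF fin E(2)])
    moreover have "(\<Sum>r\<in>E. (z (a r))\<^sup>2 + (z (b r))\<^sup>2)
        = (\<Sum>r\<in>E'. (z (a r))\<^sup>2 + (z (b r))\<^sup>2) + (\<Sum>r\<in>Ev. (z (a r))\<^sup>2 + (z (b r))\<^sup>2)"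
      unfolding E(1) by (rule sum.union_disjoint[OF fin E(2)])
    moreover have "(\<Sum>s\<in>X. (z s)\<^sup>2) = (z v)\<^sup>2 + (\<Sum>s\<in>X - {v}. (z s)\<^sup>2)"
      by (rule sum.remove[OF psubset.hyps(1) v(1)])
    ultimately show ?thesis using 1 2 unfolding E_def by (simp add: algebra_simps add_divide_distrib)
  qed
qed

text \<open>\<open>X\<close> collects the vertices where the square is at least \<beta> / M; the
  norm bound gives |X| \<le> M / \<beta>, so subsets of \<open>X\<close> are sparse. If a heavy edge
  has an end outside \<open>X\<close>, the coordinate at the other end exceeds \<open>M\<close>
  times the one outside, and the product is absorbed into squares divided by \<open>M\<close>, whose
  total is bounded by the degrees. Edges inside \<open>X\<close> fall under
  \<open>sparse_graph_form_le\<close> with weight \<open>M\<close>. The two parts contribute 2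
  \<Delta> / M and \<Delta> / M + k M.\<close>

lemma heavy_edges_le:
  fixes z :: "'v \<Rightarrow> real"
  assumes fin: "finite U" "finite R" "a ` R \<subseteq> U" "b ` R \<subseteq> U" and pos: "\<beta> > 0" "M > 0"
    and deg_a: "\<And>s. s \<in> U \<Longrightarrow> real (card {r \<in> R. a r = s}) \<le> \<Delta>"
    and deg_b: "\<And>s. s \<in> U \<Longrightarrow> real (card {r \<in> R. b r = s}) \<le> \<Delta>"
    and k: "k \<ge> 0" and \<Delta>: "\<Delta> \<ge> 0"
    and sparse: "\<And>Y. Y \<subseteq> U \<Longrightarrow> Y \<noteq> {} \<Longrightarrow> real (card Y) * \<beta> \<le> M
      \<Longrightarrow> real (card {r \<in> R. a r \<in> Y \<and> b r \<in> Y}) \<le> k * real (card Y)"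
    and z: "(\<Sum>s\<in>U. (z s)\<^sup>2) \<le> 1"
  shows "(\<Sum>r | r \<in> R \<and> \<bar>z (a r) * z (b r)\<bar> > \<beta>. \<bar>z (a r) * z (b r)\<bar>) \<le> 3 * \<Delta> / M + k * M"
proof -
  define X where "X = {s \<in> U. (z s)\<^sup>2 * M \<ge> \<beta>}"
  have XU: "X \<subseteq> U" and fX: "finite X" unfolding X_def using fin by auto
  have "real (card X) * \<beta> = (\<Sum>s\<in>X. \<beta>)" by simp
  also have "\<dots> \<le> (\<Sum>s\<in>X. (z s)\<^sup>2 * M)" by (rule sum_mono) (simp add: X_def)
  also have "\<dots> \<le> (\<Sum>s\<in>U. (z s)\<^sup>2) * M"
    unfolding sum_distrib_right using pos fin XU by (intro sum_mono2) auto
  also have "\<dots> \<le> M" using z pos by simp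
  finally have cX: "real (card X) * \<beta> \<le> M" .
  have sqa: "(\<Sum>r\<in>R. (z (a r))\<^sup>2) \<le> \<Delta>"
    using sum_vertex_le_degree[of R U a \<Delta> "\<lambda>s. (z s)\<^sup>2"] fin deg_a mult_left_mono[OF z \<Delta>] by simp
  have sqb: "(\<Sum>r\<in>R. (z (b r))\<^sup>2) \<le> \<Delta>"
    using sum_vertex_le_degree[of R U b \<Delta> "\<lambda>s. (z s)\<^sup>2"] fin deg_b mult_left_mono[OF z \<Delta>] by simp
  have "(\<Sum>r | r \<in> R \<and> \<bar>z (a r) * z (b r)\<bar> > \<beta>. \<bar>z (a r) * z (b r)\<bar>)
      = (\<Sum>r\<in>R. if \<bar>z (a r) * z (b r)\<bar> > \<beta> then \<bar>z (a r) * z (b r)\<bar> else 0)"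
    using fin by (simp add: sum.If_cases Int_def)
  also have "\<dots> \<le> (\<Sum>r\<in>R. ((z (a r))\<^sup>2 + (z (b r))\<^sup>2) / M
      + (if a r \<in> X \<and> b r \<in> X then \<bar>z (a r) * z (b r)\<bar> else 0))"
  proof (rule sum_mono)
    fix r assume r: "r \<in> R"
    define x y where "x = \<bar>z (a r)\<bar>" and "y = \<bar>z (b r)\<bar>"
    have xy: "x \<ge> 0" "y \<ge> 0" "(z (a r))\<^sup>2 = x\<^sup>2" "(z (b r))\<^sup>2 = y\<^sup>2" "\<bar>z (a r) * z (b r)\<bar> = x * y"
      by (simp_all add: x_def y_def abs_mult)
    have aU: "a r \<in> U" "b r \<in> U" using r fin by auto
    show "(if \<bar>z (a r) * z (b r)\<bar> > \<beta> then \<bar>z (a r) * z (b r)\<bar> else 0) \<le>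
      ((z (a r))\<^sup>2 + (z (b r))\<^sup>2) / M + (if a r \<in> X \<and> b r \<in> X then \<bar>z (a r) * z (b r)\<bar> else 0)"
    proof (cases "x * y > \<beta> \<and> \<not> (a r \<in> X \<and> b r \<in> X)")
      case True
      have "x * y \<le> (x\<^sup>2 + y\<^sup>2) / M"
      proof (cases "a r \<in> X")
        case True
        then have "y\<^sup>2 * M < x * y"
          using \<open>x * y > \<beta> \<and> \<not> (a r \<in> X \<and> b r \<in> X)\<close> aU xy unfolding X_def by auto
        then have "y * M < x" using xy(2) mult_less_cancel_right[of "y * M" y x] by (simp add: power2_eq_square mult_ac)
        then have "x * (y * M) \<le> x * x" using xy by (intro mult_left_mono) auto
        then have "x * y * M \<le> x\<^sup>2 + y\<^sup>2"
          by (simp add: power2_eq_square mult_ac add_increasing add_increasing2)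
        then show ?thesis using pos by (simp add: le_divide_eq)
      next
        case False
        then have "x\<^sup>2 * M < x * y"
          using \<open>x * y > \<beta> \<and> \<not> (a r \<in> X \<and> b r \<in> X)\<close> aU xy unfolding X_def by auto
        then have "x * M < y" using xy(1) mult_less_cancel_right[of "x * M" x y] by (simp add: power2_eq_square mult_ac)
        then have "y * (x * M) \<le> y * y" using xy by (intro mult_left_mono) auto
        then have "x * y * M \<le> x\<^sup>2 + y\<^sup>2"
          by (simp add: power2_eq_square mult_ac add_increasing add_increasing2)
        then show ?thesis using pos by (simp add: le_divide_eq)
      qed
      then show ?thesis using True xy by auto
    next
      case False
      then show ?thesis using xy pos by (auto simp: not_less)
    qed
  qed
  also have "\<dots> = ((\<Sum>r\<in>R. (z (a r))\<^sup>2) + (\<Sum>r\<in>R. (z (b r))\<^sup>2)) / M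
      + (\<Sum>r | r \<in> R \<and> a r \<in> X \<and> b r \<in> X. \<bar>z (a r) * z (b r)\<bar>)"
    using fin by (simp add: sum.distrib sum_divide_distrib[symmetric] sum.If_cases Int_def)
  also have "(\<Sum>r | r \<in> R \<and> a r \<in> X \<and> b r \<in> X. \<bar>z (a r) * z (b r)\<bar>)
      \<le> k * M * (\<Sum>s\<in>X. (z s)\<^sup>2) + (\<Sum>r | r \<in> R \<and> a r \<in> X \<and> b r \<in> X. (z (a r))\<^sup>2 + (z (b r))\<^sup>2) / (2 * M)"
  proof (rule sparse_graph_form_le[OF fX fin(2) pos(2)])
    fix Y assume Y: "Y \<subseteq> X" "Y \<noteq> {}"
    have "real (card Y) * \<beta> \<le> real (card X) * \<beta>"
      using Y fX pos by (intro mult_right_mono) (auto intro: card_mono)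
    then show "real (card {r \<in> R. a r \<in> Y \<and> b r \<in> Y}) \<le> k * real (card Y)"
      using Y XU cX by (intro sparse) auto
  qed
  also have "\<dots> \<le> k * M * 1 + ((\<Sum>r\<in>R. (z (a r))\<^sup>2) + (\<Sum>r\<in>R. (z (b r))\<^sup>2)) / (2 * M)"
  proof (intro add_mono mult_left_mono divide_right_mono)
    show "(\<Sum>s\<in>X. (z s)\<^sup>2) \<le> 1" using sum_mono2[OF fin(1) XU, of "\<lambda>s. (z s)\<^sup>2"] z by simp
    show "(\<Sum>r | r \<in> R \<and> a r \<in> X \<and> b r \<in> X. (z (a r))\<^sup>2 + (z (b r))\<^sup>2)
        \<le> (\<Sum>r\<in>R. (z (a r))\<^sup>2) + (\<Sum>r\<in>R. (z (b r))\<^sup>2)"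
      unfolding sum.distrib[symmetric] using fin by (intro sum_mono2) auto
  qed (use pos k in auto)
  also have "((\<Sum>r\<in>R. (z (a r))\<^sup>2) + (\<Sum>r\<in>R. (z (b r))\<^sup>2)) / M
      + (k * M * 1 + ((\<Sum>r\<in>R. (z (a r))\<^sup>2) + (\<Sum>r\<in>R. (z (b r))\<^sup>2)) / (2 * M))
      = ((\<Sum>r\<in>R. (z (a r))\<^sup>2) + (\<Sum>r\<in>R. (z (b r))\<^sup>2)) * (3 / (2 * M)) + k * M"
  proof -
    have "x / M + (k * M * 1 + x / (2 * M)) = x * (3 / (2 * M)) + k * M" for x
      using pos by (simp add: field_simps)
    then show ?thesis .
  qed
  also have "\<dots> \<le> (\<Delta> + \<Delta>) * (3 / (2 * M)) + k * M"
    using sqa sqb pos by (intro add_right_mono mult_right_mono add_mono) auto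
  finally show ?thesis using pos by (simp add: field_simps)
qed

text \<open>The functions on \<open>U\<close> of norm at most 1 are approximated by those of the form
  \<open>k s / (8 \<surd>|U|)\<close> with \<open>k\<close> in the following set.\<close>

definition grid :: "'v set \<Rightarrow> ('v \<Rightarrow> int) set"
  where "grid U = {k \<in> U \<rightarrow>\<^sub>E {- int (64 * card U)..int (64 * card U)}. (\<Sum>s\<in>U. (k s)\<^sup>2) \<le> 64 * int (card U)}"

lemma finite_grid: "finite U \<Longrightarrow> finite (grid U)"
  by (rule finite_subset[of _ "U \<rightarrow>\<^sub>E {- int (64 * card U)..int (64 * card U)}"])
    (auto simp: grid_def intro: finite_PiE)

section \<open>Size of the grid and passage from the grid to all vectors\<close>

lemma sum_half_powers: "(\<Sum>j\<in>{- int n..int n}. (1 / 2 :: real) ^ nat \<bar>j\<bar>) \<le> 3 - 2 * (1 / 2) ^ n"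
proof (induction n)
  case 0
  then show ?case by simp
next
  case (Suc n)
  have "{- int (Suc n)..int (Suc n)} = insert (- int (Suc n)) (insert (int (Suc n)) {- int n..int n})" by auto
  then have "(\<Sum>j\<in>{- int (Suc n)..int (Suc n)}. (1 / 2 :: real) ^ nat \<bar>j\<bar>)
      = (1 / 2) ^ Suc n + (1 / 2) ^ Suc n + (\<Sum>j\<in>{- int n..int n}. (1 / 2 :: real) ^ nat \<bar>j\<bar>)"
    by (simp add: nat_add_distrib)
  then show ?case using Suc by simp
qed

lemma abs_le_square_int: "\<bar>j\<bar> \<le> j\<^sup>2" for j :: int
proof (cases "j = 0")
  case False
  then show ?thesis using mult_left_mono[of 1 "\<bar>j\<bar>" "\<bar>j\<bar>"] by (simp add: power2_eq_square)
qed simp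

text \<open>For a grid point the absolute values sum to at most 64 |U|, since |j| \<le> j^2 for
  integers. Hence the weight 2^(64 |U|) times the product of the 2^(- |k s|) is at least 1, and
  summing it over all integer points turns the count into a product of one-dimensional sums, each
  below 4 = 2^2.\<close>

lemma card_grid_le:
  assumes "finite U"
  shows "real (card (grid U)) \<le> 2 ^ (66 * card U)"
proof -
  define I where "I = {- int (64 * card U)..int (64 * card U)}"
  have fI: "finite (U \<rightarrow>\<^sub>E I)" using assms by (auto simp: I_def intro: finite_PiE)
  have sub: "grid U \<subseteq> U \<rightarrow>\<^sub>E I" unfolding grid_def I_def by auto
  have "real (card (grid U)) = (\<Sum>k\<in>grid U. 1)" by simp
  also have "\<dots> \<le> (\<Sum>k\<in>grid U. 2 ^ (64 * card U) * (\<Prod>s\<in>U. (1 / 2 :: real) ^ nat \<bar>k s\<bar>))"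
  proof (rule sum_mono)
    fix k assume k: "k \<in> grid U"
    have "(\<Sum>s\<in>U. \<bar>k s\<bar>) \<le> (\<Sum>s\<in>U. (k s)\<^sup>2)"
    proof (rule sum_mono)
      fix s
      show "\<bar>k s\<bar> \<le> (k s)\<^sup>2" by (rule abs_le_square_int)
    qed
    also have "\<dots> \<le> 64 * int (card U)" using k by (simp add: grid_def)
    finally have "(\<Sum>s\<in>U. nat \<bar>k s\<bar>) \<le> 64 * card U"
      by (simp flip: of_nat_le_iff[where 'a = int])
    then have "(1 / 2 :: real) ^ (64 * card U) \<le> (1 / 2) ^ (\<Sum>s\<in>U. nat \<bar>k s\<bar>)"
      by (intro power_decreasing) auto
    then have "2 ^ (64 * card U) * (1 / 2 :: real) ^ (64 * card U) \<le> 2 ^ (64 * card U) * (\<Prod>s\<in>U. (1 / 2) ^ nat \<bar>k s\<bar>)"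
      unfolding power_sum by (intro mult_left_mono) auto
    then show "1 \<le> 2 ^ (64 * card U) * (\<Prod>s\<in>U. (1 / 2 :: real) ^ nat \<bar>k s\<bar>)"
      by (simp flip: power_mult_distrib)
  qed
  also have "\<dots> \<le> (\<Sum>k\<in>U \<rightarrow>\<^sub>E I. 2 ^ (64 * card U) * (\<Prod>s\<in>U. (1 / 2 :: real) ^ nat \<bar>k s\<bar>))"
    using fI sub by (intro sum_mono2) (auto intro!: mult_nonneg_nonneg prod_nonneg)
  also have "\<dots> = 2 ^ (64 * card U) * (\<Prod>s\<in>U. \<Sum>j\<in>I. (1 / 2 :: real) ^ nat \<bar>j\<bar>)"
    unfolding sum_distrib_left[symmetric]
    by (subst prod_sum_PiE[OF assms, of "\<lambda>_. I" "\<lambda>_ j. (1 / 2 :: real) ^ nat \<bar>j\<bar>"]) (auto simp: I_def)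
  also have "(\<Prod>s\<in>U. \<Sum>j\<in>I. (1 / 2 :: real) ^ nat \<bar>j\<bar>) \<le> (\<Prod>s\<in>U. 2 ^ 2)"
  proof (rule prod_mono, intro conjI)
    have "(\<Sum>j\<in>I. (1 / 2 :: real) ^ nat \<bar>j\<bar>) \<le> 3 - 2 * (1 / 2) ^ (64 * card U)"
      unfolding I_def by (rule sum_half_powers)
    also have "\<dots> \<le> 3" by simp
    also have "\<dots> \<le> 2 ^ 2" by simp
    finally show "(\<Sum>j\<in>I. (1 / 2 :: real) ^ nat \<bar>j\<bar>) \<le> 2 ^ 2" .
  qed (auto intro!: sum_nonneg)
  also have "2 ^ (64 * card U) * (\<Prod>s\<in>U. 2 ^ 2) = (2 :: real) ^ (66 * card U)"
  proof -
    have "66 * card U = 64 * card U + 2 * card U" by simp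
    then show ?thesis by (simp only: power_add power_mult prod_constant)
  qed
  finally show ?thesis by simp
qed

text \<open>Coordinates are rounded toward zero, so the norm does not increase; the mesh 1 / (8 sqrt
  |U|) makes the squared error at most |U| times the squared mesh, that is 1/64.\<close>

lemma grid_approximation:
  fixes z :: "'v \<Rightarrow> real"
  assumes fin: "finite U" and ne: "U \<noteq> {}" and z: "(\<Sum>s\<in>U. (z s)\<^sup>2) \<le> 1"
  obtains k where "k \<in> grid U"
    "(\<Sum>s\<in>U. (of_int (k s) / (8 * sqrt (card U)))\<^sup>2) \<le> 1"
    "(\<Sum>s\<in>U. (z s - of_int (k s) / (8 * sqrt (card U)))\<^sup>2) \<le> 1 / 64"
proof -
  define v where "v = real (card U)"
  have v: "v > 0" using fin ne by (simp add: v_def card_gt_0_iff)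
  define h where "h = 1 / (8 * sqrt v)"
  have h: "h > 0" using v by (simp add: h_def)
  have h2: "h\<^sup>2 = 1 / (64 * v)" using v by (simp add: h_def power_divide power_mult_distrib)
  define k where "k = (\<lambda>s\<in>U. if z s \<ge> 0 then \<lfloor>z s / h\<rfloor> else \<lceil>z s / h\<rceil>)"
  have k: "\<bar>of_int (k s) * h\<bar> \<le> \<bar>z s\<bar>" "\<bar>z s - of_int (k s) * h\<bar> \<le> h" if "s \<in> U" for s
  proof -
    have "\<bar>of_int (k s) * h\<bar> \<le> \<bar>z s\<bar> \<and> \<bar>z s - of_int (k s) * h\<bar> \<le> h"
    proof (cases "z s \<ge> 0")
      case True
      then have ks: "k s = \<lfloor>z s / h\<rfloor>" using that by (simp add: k_def)
      have "0 \<le> real_of_int \<lfloor>z s / h\<rfloor>" using True h by simp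
      moreover have "real_of_int \<lfloor>z s / h\<rfloor> * h \<le> z s" "z s \<le> (real_of_int \<lfloor>z s / h\<rfloor> + 1) * h"
        using h by (simp_all flip: pos_le_divide_eq pos_divide_le_eq)
      ultimately show ?thesis using True h unfolding ks by (auto simp: algebra_simps)
    next
      case False
      then have ks: "k s = \<lceil>z s / h\<rceil>" using that by (simp add: k_def)
      have "z s / h \<le> 0" using False h by (simp add: divide_nonpos_pos)
      then have "real_of_int \<lceil>z s / h\<rceil> \<le> 0" by (simp add: ceiling_le_zero)
      then have "real_of_int \<lceil>z s / h\<rceil> * h \<le> 0" using h by (simp add: mult_nonpos_nonneg)
      moreover have "z s \<le> real_of_int \<lceil>z s / h\<rceil> * h" "(real_of_int \<lceil>z s / h\<rceil> - 1) * h \<le> z s"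
        using h by (simp_all flip: pos_le_divide_eq pos_divide_le_eq)
      ultimately show ?thesis using False h unfolding ks by (auto simp: algebra_simps)
    qed
    then show "\<bar>of_int (k s) * h\<bar> \<le> \<bar>z s\<bar>" "\<bar>z s - of_int (k s) * h\<bar> \<le> h" by auto
  qed
  have 1: "(\<Sum>s\<in>U. (of_int (k s) * h)\<^sup>2) \<le> 1"
    using k(1) by (intro order_trans[OF _ z] sum_mono) (simp add: abs_le_square_iff)
  have "(\<Sum>s\<in>U. (z s - of_int (k s) * h)\<^sup>2) \<le> (\<Sum>s\<in>U. h\<^sup>2)"
    using k(2) h by (intro sum_mono) (metis abs_le_square_iff abs_of_pos)
  then have 2: "(\<Sum>s\<in>U. (z s - of_int (k s) * h)\<^sup>2) \<le> 1 / 64"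
    using v by (simp add: h2 v_def)
  have "(\<Sum>s\<in>U. (of_int (k s) * h)\<^sup>2) = of_int (\<Sum>s\<in>U. (k s)\<^sup>2) / (64 * v)"
    by (simp add: power_mult_distrib h2 sum_divide_distrib)
  then have "real_of_int (\<Sum>s\<in>U. (k s)\<^sup>2) \<le> real_of_int (64 * int (card U))"
    using 1 v by (simp add: divide_le_eq v_def)
  then have sq: "(\<Sum>s\<in>U. (k s)\<^sup>2) \<le> 64 * int (card U)" by linarith
  have "k \<in> U \<rightarrow>\<^sub>E {- int (64 * card U)..int (64 * card U)}"
  proof (rule PiE_I)
    fix s assume s: "s \<in> U"
    have "\<bar>k s\<bar> \<le> (k s)\<^sup>2" by (rule abs_le_square_int)
    also have "\<dots> \<le> (\<Sum>s\<in>U. (k s)\<^sup>2)" using s fin by (intro member_le_sum) auto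
    finally have "\<bar>k s\<bar> \<le> int (64 * card U)" using sq by simp
    then show "k s \<in> {- int (64 * card U)..int (64 * card U)}" by auto
  qed (simp add: k_def)
  then have "k \<in> grid U" using sq by (simp add: grid_def)
  moreover have "of_int (k s) / (8 * sqrt (card U)) = of_int (k s) * h" for s
    by (simp add: h_def v_def)
  ultimately show ?thesis using 1 2 that by simp
qed

text \<open>A bootstrap replaces the search for an extremal vector: if \<open>N\<close> bounds the
  form, then so does C + N / 2, by rounding to the grid. Started from the trivial bound and
  iterated, the bounds converge to 2 C.\<close>

lemma quadratic_form_le_of_grid:
  fixes c :: "'r \<Rightarrow> real" and a b :: "'r \<Rightarrow> 'v" and T U
  defines "q \<equiv> \<lambda>z. \<Sum>r\<in>T. c r * z (a r) * z (b r)"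
  assumes fin: "finite U" "finite T" and ne: "U \<noteq> {}" and ab: "a ` T \<subseteq> U" "b ` T \<subseteq> U"
    and C: "\<And>k. k \<in> grid U \<Longrightarrow> (\<Sum>s\<in>U. (of_int (k s) / (8 * sqrt (card U)))\<^sup>2) \<le> 1
      \<Longrightarrow> \<bar>q (\<lambda>s. of_int (k s) / (8 * sqrt (card U)))\<bar> \<le> C"
  shows "\<bar>q z\<bar> \<le> 2 * C * (\<Sum>s\<in>U. (z s)\<^sup>2)"
proof -
  define valid where "valid N \<longleftrightarrow> (\<forall>z. \<bar>q z\<bar> \<le> N * (\<Sum>s\<in>U. (z s)\<^sup>2))" for N
  have q_scale: "q (\<lambda>s. \<tau> * z s) = \<tau>\<^sup>2 * q z" for \<tau> z
    by (simp add: q_def sum_distrib_left power2_eq_square mult_ac)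
  have q_zero: "q z = 0" if "(\<Sum>s\<in>U. (z s)\<^sup>2) = 0" for z
  proof -
    have "z s = 0" if "s \<in> U" for s
      using that \<open>(\<Sum>s\<in>U. (z s)\<^sup>2) = 0\<close> fin by (simp add: sum_nonneg_eq_0_iff)
    then show ?thesis using ab by (auto simp: q_def intro!: sum.neutral)
  qed
  have validI: "valid N" if N: "\<And>z. (\<Sum>s\<in>U. (z s)\<^sup>2) \<le> 1 \<Longrightarrow> \<bar>q z\<bar> \<le> N" for N
    unfolding valid_def
  proof
    fix z :: "'v \<Rightarrow> real"
    define S where "S = (\<Sum>s\<in>U. (z s)\<^sup>2)"
    show "\<bar>q z\<bar> \<le> N * (\<Sum>s\<in>U. (z s)\<^sup>2)"
    proof (cases "S = 0")
      case True
      then show ?thesis using q_zero[of z] by (simp add: S_def)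
    next
      case False
      then have S: "S > 0" by (simp add: S_def less_le sum_nonneg)
      have "(\<Sum>s\<in>U. (1 / sqrt S * z s)\<^sup>2) = S / S"
        using S by (simp add: power_mult_distrib power_divide S_def[symmetric] flip: sum_divide_distrib)
      then have "\<bar>q (\<lambda>s. 1 / sqrt S * z s)\<bar> \<le> N" using S by (intro N) simp
      then have "\<bar>q z\<bar> / S \<le> N" unfolding q_scale using S by (simp add: power_divide abs_mult)
      then show ?thesis using S by (simp add: S_def[symmetric] divide_le_eq)
    qed
  qed
  define N0 where "N0 = (\<Sum>r\<in>T. \<bar>c r\<bar>)"
  have N0: "valid N0"
  proof (rule validI)
    fix z :: "'v \<Rightarrow> real" assume z: "(\<Sum>s\<in>U. (z s)\<^sup>2) \<le> 1"
    have z1: "\<bar>z s\<bar> \<le> 1" if "s \<in> U" for s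
    proof -
      have "(z s)\<^sup>2 \<le> (\<Sum>s\<in>U. (z s)\<^sup>2)" using that fin by (intro member_le_sum) auto
      then show ?thesis using z by (simp add: abs_square_le_1[symmetric])
    qed
    have "\<bar>q z\<bar> \<le> (\<Sum>r\<in>T. \<bar>c r * z (a r) * z (b r)\<bar>)" unfolding q_def by (rule sum_abs)
    also have "\<dots> \<le> (\<Sum>r\<in>T. \<bar>c r\<bar> * 1 * 1)"
      using z1 ab unfolding abs_mult by (intro sum_mono mult_mono) auto
    finally show "\<bar>q z\<bar> \<le> N0" by (simp add: N0_def)
  qed
  have step: "valid (C + N / 2)" if N: "valid N" for N
  proof (rule validI)
    fix z :: "'v \<Rightarrow> real" assume z: "(\<Sum>s\<in>U. (z s)\<^sup>2) \<le> 1"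
    obtain k where k: "k \<in> grid U" "(\<Sum>s\<in>U. (of_int (k s) / (8 * sqrt (card U)))\<^sup>2) \<le> 1"
      "(\<Sum>s\<in>U. (z s - of_int (k s) / (8 * sqrt (card U)))\<^sup>2) \<le> 1 / 64"
      using grid_approximation[OF fin(1) ne z] by blast
    define y where "y = (\<lambda>s. of_int (k s) / (8 * sqrt (card U)))"
    have y: "(\<Sum>s\<in>U. (y s)\<^sup>2) \<le> 1" "(\<Sum>s\<in>U. (z s - y s)\<^sup>2) \<le> 1 / 64" "\<bar>q y\<bar> \<le> C"
      using k C[OF k(1,2)] by (simp_all add: y_def)
    have N_nonneg: "N \<ge> 0"
    proof -
      have "0 \<le> \<bar>q (\<lambda>_. 1)\<bar>" by simp
      also have "\<dots> \<le> N * real (card U)" using N[unfolded valid_def, rule_format, of "\<lambda>_. 1"] by simp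
      finally show ?thesis using fin ne by (simp add: zero_le_mult_iff card_gt_0_iff)
    qed
    \<comment> \<open>Polarization of q z - q y, which is bilinear in z - y and z + y. The factors 4
      and 1/4 balance their norms, at most 1/8 and 2.\<close>
    define f g where "f s = 4 * (z s - y s) + (z s + y s) / 4" and "g s = 4 * (z s - y s) - (z s + y s) / 4" for s
    have "4 * (q z - q y) = q f - q g"
      unfolding q_def f_def g_def sum_subtractf[symmetric] sum_distrib_left
      by (intro sum.cong HOL.refl) (simp add: field_simps)
    then have "4 * \<bar>q z - q y\<bar> \<le> \<bar>q f\<bar> + \<bar>q g\<bar>" by linarith
    also have "\<dots> \<le> N * (\<Sum>s\<in>U. (f s)\<^sup>2) + N * (\<Sum>s\<in>U. (g s)\<^sup>2)"
      using N unfolding valid_def by (intro add_mono) auto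
    also have "\<dots> = N * (\<Sum>s\<in>U. (f s)\<^sup>2 + (g s)\<^sup>2)" by (simp add: sum.distrib distrib_left)
    also have "\<dots> \<le> N * (\<Sum>s\<in>U. 32 * (z s - y s)\<^sup>2 + ((z s)\<^sup>2 + (y s)\<^sup>2) / 4)"
    proof (intro mult_left_mono sum_mono N_nonneg)
      fix s
      have "(f s)\<^sup>2 + (g s)\<^sup>2 = 32 * (z s - y s)\<^sup>2 + (z s + y s)\<^sup>2 / 8"
        by (simp add: f_def g_def power2_eq_square field_simps)
      moreover have "(z s + y s)\<^sup>2 \<le> 2 * ((z s)\<^sup>2 + (y s)\<^sup>2)"
        using sum_squares_bound[of "z s" "y s"] by (simp add: power2_sum)
      ultimately show "(f s)\<^sup>2 + (g s)\<^sup>2 \<le> 32 * (z s - y s)\<^sup>2 + ((z s)\<^sup>2 + (y s)\<^sup>2) / 4" by simp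
    qed
    also have "\<dots> = N * (32 * (\<Sum>s\<in>U. (z s - y s)\<^sup>2) + ((\<Sum>s\<in>U. (z s)\<^sup>2) + (\<Sum>s\<in>U. (y s)\<^sup>2)) / 4)"
      by (simp only: sum.distrib sum_distrib_left sum_divide_distrib[symmetric])
    also have "\<dots> \<le> N * (32 * (1 / 64) + (1 + 1) / 4)"
      using y z by (intro mult_left_mono add_mono divide_right_mono N_nonneg) auto
    finally have "\<bar>q z - q y\<bar> \<le> N / 4" by simp
    then show "\<bar>q z\<bar> \<le> C + N / 2" using y(3) N_nonneg by linarith
  qed
  \<comment> \<open>The zero vector lies on the grid, which forces \<open>C\<close> to be
    nonnegative.\<close>
  have "\<bar>q (\<lambda>s. of_int ((\<lambda>s\<in>U. 0) s) / (8 * sqrt (card U)))\<bar> \<le> C"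
    by (rule C) (auto simp: grid_def power2_eq_square)
  then have C_nonneg: "C \<ge> 0" by linarith
  have iter: "valid (2 * C + N0 / 2 ^ i)" for i
  proof (induction i)
    case 0
    have "N0 * (\<Sum>s\<in>U. (z s)\<^sup>2) \<le> (2 * C + N0) * (\<Sum>s\<in>U. (z s)\<^sup>2)" for z :: "'v \<Rightarrow> real"
      using C_nonneg by (intro mult_right_mono sum_nonneg) auto
    then show ?case using N0 unfolding valid_def by (fastforce intro: order_trans)
  next
    case (Suc i)
    then show ?case using step[OF Suc] by (simp add: field_simps)
  qed
  have "(\<lambda>i. (2 * C + N0 * (1 / 2) ^ i) * (\<Sum>s\<in>U. (z s)\<^sup>2)) \<longlonglongrightarrow> (2 * C + N0 * 0) * (\<Sum>s\<in>U. (z s)\<^sup>2)"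
    by (intro tendsto_intros LIMSEQ_realpow_zero) auto
  then have "\<bar>q z\<bar> \<le> (2 * C + N0 * 0) * (\<Sum>s\<in>U. (z s)\<^sup>2)"
    by (rule LIMSEQ_le_const) (use iter in \<open>auto simp: valid_def power_one_over\<close>)
  then show ?thesis by simp
qed

text \<open>The familiar bound (e v / b)^b, read off from a single term of the binomial expansion of
  (1 + b / v)^v.\<close>

lemma binomial_le_exp:
  assumes "0 < b" "b \<le> v"
  shows "real (v choose b) \<le> exp (real b * (1 + ln (real v / real b)))"
proof -
  define y where "y = real b / real v"
  have y: "y > 0" using assms by (simp add: y_def)
  have "real (v choose b) * y ^ b \<le> (\<Sum>k\<le>v. real (v choose k) * y ^ k)"
    using assms y by (intro member_le_sum[of b "{..v}" "\<lambda>k. real (v choose k) * y ^ k"]) auto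
  also have "\<dots> = (y + 1) ^ v" using binomial_ring[of y 1 v] by simp
  also have "\<dots> \<le> exp y ^ v" using y exp_ge_add_one_self[of y] by (intro power_mono) (auto simp: add.commute)
  also have "\<dots> = exp (real b)" using assms by (simp add: exp_of_nat_mult[symmetric] y_def)
  finally have "real (v choose b) \<le> exp (real b) / y ^ b" using y by (simp add: le_divide_eq)
  also have "y = exp (- ln (real v / real b))" using assms by (simp add: y_def exp_minus field_simps)
  also have "exp (real b) / exp (- ln (real v / real b)) ^ b = exp (real b * (1 + ln (real v / real b)))"
  proof -
    have "exp (- ln (real v / real b)) ^ b = exp (real b * (- ln (real v / real b)))"
      by (rule exp_of_nat_mult[symmetric])
    then show ?thesis by (simp add: distrib_left flip: exp_diff)
  qed
  finally show ?thesis .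
qed

lemma geometric_exp_sum_le:
  assumes "y \<ge> 2 / 3"
  shows "(\<Sum>b\<in>{1..v}. exp (- real b * y)) \<le> 3 * exp (- y)"
proof -
  have "(1 - exp (- y)) * (\<Sum>b\<in>{1..v}. exp (- y) ^ b) = exp (- y) - exp (- y) ^ Suc v"
    using sum_gp_multiplied[of 1 v "exp (- y)"] by (cases "v = 0") auto
  moreover have "exp (- real b * y) = exp (- y) ^ b" for b
    by (simp flip: exp_of_nat_mult)
  ultimately have "(1 - exp (- y)) * (\<Sum>b\<in>{1..v}. exp (- real b * y)) = exp (- y) - exp (- y) ^ Suc v"
    by simp
  also have "\<dots> \<le> exp (- y)" by simp
  finally have 1: "(1 - exp (- y)) * (\<Sum>b\<in>{1..v}. exp (- real b * y)) \<le> exp (- y)" .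
  have "5 / 3 \<le> exp y" using exp_ge_add_one_self[of y] assms by linarith
  then have "exp (- y) \<le> 3 / 5" by (simp add: exp_minus field_simps)
  then have "1 / 3 * (\<Sum>b\<in>{1..v}. exp (- real b * y)) \<le> (1 - exp (- y)) * (\<Sum>b\<in>{1..v}. exp (- real b * y))"
    by (intro mult_right_mono sum_nonneg) auto
  then show ?thesis using 1 by simp
qed

text \<open>The multigraph whose edges are the elements of a random set \<open>R\<close>, where \<open>r\<close> joins \<open>a r\<close> to
  \<open>b r\<close>. Its expected degrees are at most \<open>x ^ 6\<close>, a sixth power because
  all thresholds below are powers of the sixth root of the degree. A pair \<open>s t\<close> is light for the vector
  \<open>z\<close> if \<open>\<bar>z s * z t\<bar> \<le> x ^ 5 / card U\<close>, and heavy otherwise.\<close>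

locale random_graph = random_subset T m for T :: "'r set" and m +
  fixes U :: "'v set" and a b :: "'r \<Rightarrow> 'v" and F x :: real
  assumes finite_U: "finite U" and U_nonempty: "U \<noteq> {}"
    and a_in: "a ` T \<subseteq> U" and b_in: "b ` T \<subseteq> U"
    and fibre: "\<And>s t. s \<in> U \<Longrightarrow> t \<in> U \<Longrightarrow> real (card {r \<in> T. a r = s \<and> b r = t}) \<le> F"
    and mean: "p * F * real (card U) \<le> x ^ 6"
    and x_ge: "x \<ge> 5 / 4"
begin

lemma card_U_pos: "real (card U) > 0"
  using finite_U U_nonempty by (simp add: card_gt_0_iff)

lemma pF_le: "p * F \<le> x ^ 6 / card U"
  using mean card_U_pos by (simp add: le_divide_eq)

lemma expected_sum_le:
  assumes "\<And>s t. \<phi> s t \<ge> 0"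
  shows "p * (\<Sum>r\<in>T. \<phi> (a r) (b r)) \<le> x ^ 6 / card U * (\<Sum>s\<in>U. \<Sum>t\<in>U. \<phi> s t)"
proof -
  have "p * (\<Sum>r\<in>T. \<phi> (a r) (b r)) \<le> p * (F * (\<Sum>s\<in>U. \<Sum>t\<in>U. \<phi> s t))"
    using finite_T finite_U a_in b_in fibre assms p_nonneg
    by (intro mult_left_mono sum_edges_le_fibres) auto
  also have "\<dots> = p * F * (\<Sum>s\<in>U. \<Sum>t\<in>U. \<phi> s t)" by simp
  also have "\<dots> \<le> x ^ 6 / card U * (\<Sum>s\<in>U. \<Sum>t\<in>U. \<phi> s t)"
    using assms by (intro mult_right_mono pF_le sum_nonneg)
  finally show ?thesis .
qed

section \<open>The three exceptional events of the random graph\<close>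

text \<open>The weight \<theta> sits on the edges from \<open>A\<close> to \<open>B\<close>, of
  which at most x^6 |A| |B| / |U| are expected. Formulating the condition as a predicate
  \<open>P\<close> lets one bound serve the degrees at either end and the edges inside a
  set.\<close>

lemma prob_many:
  assumes "\<theta> \<ge> 0" and P: "\<And>r. r \<in> T \<Longrightarrow> P r \<longleftrightarrow> a r \<in> A \<and> b r \<in> B" and "A \<subseteq> U" "B \<subseteq> U"
  shows "prob (\<lambda>R. real (card {r \<in> R. P r}) \<ge> t)
    \<le> exp (x ^ 6 / card U * (real (card A) * real (card B)) * exp \<theta> - \<theta> * t)"
proof -
  define w where "w r = (if P r then \<theta> else 0)" for r
  have "prob (\<lambda>R. real (card {r \<in> R. P r}) \<ge> t) \<le> prob (\<lambda>R. (\<Sum>r\<in>R. w r) \<ge> \<theta> * t)"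
  proof (rule prob_mono)
    fix R assume "R \<in> subsets_of_card T m" "t \<le> real (card {r \<in> R. P r})"
    then show "\<theta> * t \<le> (\<Sum>r\<in>R. w r)"
      using finite_member[of R] assms(1)
      by (simp add: w_def sum.If_cases Int_def mult_left_mono mult.commute)
  qed
  also have "\<dots> \<le> exp (p * (\<Sum>r\<in>T. exp (w r) - 1) - \<theta> * t)"
    by (rule prob_sum_ge) (use assms(1) in \<open>simp add: w_def\<close>)
  also have "p * (\<Sum>r\<in>T. exp (w r) - 1) \<le> p * (\<Sum>r\<in>T. (if a r \<in> A \<and> b r \<in> B then exp \<theta> else 0))"
    using p_nonneg by (intro mult_left_mono sum_mono) (auto simp: w_def P)
  also have "\<dots> \<le> x ^ 6 / card U * (\<Sum>s\<in>U. \<Sum>t\<in>U. if s \<in> A \<and> t \<in> B then exp \<theta> else 0)"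
    by (rule expected_sum_le[of "\<lambda>s t. if s \<in> A \<and> t \<in> B then exp \<theta> else 0"]) simp
  also have "(\<Sum>s\<in>U. \<Sum>t\<in>U. if s \<in> A \<and> t \<in> B then exp \<theta> else 0) = (\<Sum>s\<in>U. if s \<in> A then real (card B) * exp \<theta> else 0)"
  proof (rule sum.cong[OF HOL.refl])
    fix s
    have "U \<inter> {t. t \<in> B} = B" using assms(4) by auto
    then show "(\<Sum>t\<in>U. if s \<in> A \<and> t \<in> B then exp \<theta> else 0) = (if s \<in> A then real (card B) * exp \<theta> else 0)"
      using finite_U by (simp add: sum.If_cases)
  qed
  also have "\<dots> = real (card A) * (real (card B) * exp \<theta>)"
  proof -
    have "U \<inter> {t. t \<in> A} = A" using assms(3) by auto
    then show ?thesis using finite_U by (simp add: sum.If_cases)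
  qed
  finally show ?thesis by (simp add: mult_ac)
qed

definition large_degree :: "'r set \<Rightarrow> bool"
  where "large_degree R \<longleftrightarrow> (\<exists>s\<in>U. real (card {r \<in> R. a r = s}) \<ge> 8 * x ^ 6 \<or> real (card {r \<in> R. b r = s}) \<ge> 8 * x ^ 6)"

text \<open>Taken with \<theta> = 1: the expected degree is at most x^6, and 8 - e \<ge> 5.\<close>

lemma prob_large_degree: "prob large_degree \<le> 2 * card U * exp (- 5 * x ^ 6)"
proof -
  have e: "exp (1 :: real) \<le> 3" by (rule exp_le)
  have x6: "x ^ 6 \<ge> 0" using x_ge by simp
  have "prob (\<lambda>R. \<exists>s\<in>U. real (card {r \<in> R. a r = s}) \<ge> 8 * x ^ 6 \<or> real (card {r \<in> R. b r = s}) \<ge> 8 * x ^ 6)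
    \<le> (\<Sum>s\<in>U. exp (- 5 * x ^ 6) + exp (- 5 * x ^ 6))"
  proof (rule prob_Bex[OF finite_U])
    fix s assume s: "s \<in> U"
    have exps: "exp (x ^ 6 * exp 1 - 8 * x ^ 6) \<le> exp (- 5 * x ^ 6)"
      using mult_left_mono[OF e x6] by simp
    have "prob (\<lambda>R. real (card {r \<in> R. a r = s}) \<ge> 8 * x ^ 6)
        \<le> exp (x ^ 6 / card U * (real (card {s}) * real (card U)) * exp 1 - 1 * (8 * x ^ 6))"
      by (rule prob_many) (use s b_in in auto)
    also have "\<dots> = exp (x ^ 6 * exp 1 - 8 * x ^ 6)" using card_U_pos by simp
    also note exps
    finally have A: "prob (\<lambda>R. real (card {r \<in> R. a r = s}) \<ge> 8 * x ^ 6) \<le> exp (- 5 * x ^ 6)" .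
    have "prob (\<lambda>R. real (card {r \<in> R. b r = s}) \<ge> 8 * x ^ 6)
        \<le> exp (x ^ 6 / card U * (real (card U) * real (card {s})) * exp 1 - 1 * (8 * x ^ 6))"
      by (rule prob_many) (use s a_in in auto)
    also have "\<dots> = exp (x ^ 6 * exp 1 - 8 * x ^ 6)" using card_U_pos by simp
    also note exps
    finally have B: "prob (\<lambda>R. real (card {r \<in> R. b r = s}) \<ge> 8 * x ^ 6) \<le> exp (- 5 * x ^ 6)" .
    show "prob (\<lambda>R. real (card {r \<in> R. a r = s}) \<ge> 8 * x ^ 6 \<or> real (card {r \<in> R. b r = s}) \<ge> 8 * x ^ 6)
        \<le> exp (- 5 * x ^ 6) + exp (- 5 * x ^ 6)"
      using prob_disj A B by (rule order_trans[OF _ add_mono])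
  qed
  then show ?thesis by (simp add: large_degree_def)
qed

definition dense_subset :: "'r set \<Rightarrow> 'v set \<Rightarrow> bool"
  where "dense_subset R Y \<longleftrightarrow> real (card {r \<in> R. a r \<in> Y \<and> b r \<in> Y}) \<ge> 9 * x ^ 4 * card Y"

text \<open>The limit on the size is the one required in \<open>heavy_edges_le\<close> for \<beta> =
  x^5 / |U| and M = x.\<close>

definition small_dense_subset :: "'r set \<Rightarrow> bool"
  where "small_dense_subset R \<longleftrightarrow> (\<exists>Y. Y \<subseteq> U \<and> Y \<noteq> {} \<and> real (card Y) * x ^ 4 \<le> card U \<and> dense_subset R Y)"

text \<open>The parameter is chosen so that exp \<theta> = sqrt (|U| / |Y|), which is at least x^2
  for small \<open>Y\<close>. The first term of the exponent is then |Y| x^6 / exp \<theta> \<le>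
  |Y| x^4, while the negative term still grows with ln (|U| / |Y|) and can pay for the choice of
  \<open>Y\<close> in the union bound.\<close>

lemma prob_dense_subset:
  assumes Y: "Y \<subseteq> U" "Y \<noteq> {}" and small: "real (card Y) * x ^ 4 \<le> card U"
  defines "\<theta> \<equiv> ln (real (card U) / card Y) / 2"
  shows "prob (\<lambda>R. dense_subset R Y) \<le> exp (real (card Y) * (x ^ 4 - 9 * x ^ 4 * \<theta>))"
proof -
  define v y where "v = real (card U)" and "y = real (card Y)"
  have v: "v > 0" using card_U_pos by (simp add: v_def)
  have y: "y > 0" using Y finite_U by (simp add: y_def card_gt_0_iff finite_subset)
  have small': "x ^ 4 \<le> v / y" using small y by (simp add: v_def y_def field_simps)
  have x0: "x > 0" using x_ge by simp
  have x4: "x ^ 4 \<ge> 1" using x_ge by simp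
  have \<theta>: "\<theta> \<ge> 0" using small' x4 by (simp add: \<theta>_def v_def[symmetric] y_def[symmetric])
  define s where "s = sqrt (v / y)"
  have "exp \<theta> * exp \<theta> = v / y" using v y by (simp add: \<theta>_def v_def[symmetric] y_def[symmetric] exp_add[symmetric])
  then have exp\<theta>: "exp \<theta> = s" unfolding s_def by (simp add: real_sqrt_unique power2_eq_square)
  have s2: "s\<^sup>2 = v / y" using v y by (simp add: s_def)
  have s: "x\<^sup>2 \<le> s"
    unfolding s_def using small' by (intro real_le_rsqrt) (simp add: power_mult[symmetric])
  have s_pos: "s > 0" using s x0 by (meson less_le_trans zero_less_power)
  have "prob (\<lambda>R. dense_subset R Y) \<le> exp (x ^ 6 / card U * (real (card Y) * real (card Y)) * exp \<theta> - \<theta> * (9 * x ^ 4 * card Y))"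
    unfolding dense_subset_def by (rule prob_many) (use \<theta> Y in auto)
  also have "x ^ 6 / card U * (real (card Y) * real (card Y)) * exp \<theta> = y * (x ^ 6 * (y / v * s))"
    by (simp add: v_def y_def exp\<theta>)
  also have "y / v = 1 / s\<^sup>2" using s2 by simp
  also have "1 / s\<^sup>2 * s = 1 / s" using s_pos by (simp add: power2_eq_square)
  also have "y * (x ^ 6 * (1 / s)) - \<theta> * (9 * x ^ 4 * card Y) \<le> y * x ^ 4 - \<theta> * (9 * x ^ 4 * card Y)"
  proof -
    have "x ^ 6 = x ^ 4 * x\<^sup>2" by (simp flip: power_add)
    also have "\<dots> \<le> x ^ 4 * s" using s by (intro mult_left_mono) auto
    finally have "x ^ 6 * (1 / s) \<le> x ^ 4" using s_pos by (simp add: divide_le_eq)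
    then show ?thesis using mult_left_mono[of "x ^ 6 * (1 / s)" "x ^ 4" y] y by simp
  qed
  finally show ?thesis by (simp add: y_def algebra_simps)
qed

text \<open>Union bound over \<open>Y\<close>, grouped by size. Per vertex of \<open>Y\<close>, the
  number of sets costs 1 + 2 \<theta> in the exponent; 9 x^4 \<theta> outweighs this and the term
  x^4 because \<theta> \<ge> 2/5 and x^4 \<ge> 2, both consequences of x \<ge> 5/4.\<close>

lemma prob_small_dense_subset: "prob small_dense_subset \<le> 3 * exp (- (x ^ 4) / 3)"
proof -
  define v where "v = card U"
  define L where "L = x ^ 4"
  have L: "L \<ge> 2"
  proof -
    have "(5 / 4) ^ 4 \<le> x ^ 4" using x_ge by (intro power_mono) auto
    then show ?thesis by (simp add: L_def power4_eq_xxxx)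
  qed
  have theta: "ln (real v / real b) \<ge> 4 / 5" if "0 < b" "real b * L \<le> real v" for b
  proof -
    have "1 / 5 \<le> 1 - inverse x" using x_ge by (simp add: field_simps)
    also have "\<dots> \<le> ln x" using ln_le_minus_one[of "inverse x"] x_ge by (simp add: ln_inverse)
    finally have "4 / 5 \<le> 4 * ln x" by simp
    also have "\<dots> = ln L" using x_ge by (simp add: L_def ln_realpow)
    also have "\<dots> \<le> ln (real v / real b)" using that L by (intro ln_mono) (auto simp: field_simps)
    finally show ?thesis .
  qed
  define \<Y> where "\<Y> b = {Y. Y \<subseteq> U \<and> card Y = b}" for b
  define I where "I = {b \<in> {1..v}. real b * L \<le> real v}"
  have "prob small_dense_subset \<le> prob (\<lambda>R. \<exists>b\<in>I. \<exists>Y\<in>\<Y> b. dense_subset R Y)"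
  proof (rule prob_mono)
    fix R assume "small_dense_subset R"
    then obtain Y where Y: "Y \<subseteq> U" "Y \<noteq> {}" "real (card Y) * x ^ 4 \<le> card U" "dense_subset R Y"
      unfolding small_dense_subset_def by blast
    moreover have "finite Y" using Y finite_U finite_subset by blast
    moreover from this have "card Y \<le> v" "1 \<le> card Y"
      using Y finite_U by (simp_all add: v_def card_mono Suc_le_eq card_gt_0_iff)
    ultimately show "\<exists>b\<in>I. \<exists>Y\<in>\<Y> b. dense_subset R Y"
      by (intro bexI[of _ "card Y"] bexI[of _ Y]) (auto simp: I_def \<Y>_def v_def L_def)
  qed
  also have "\<dots> \<le> (\<Sum>b\<in>I. exp (- real b * (L / 3)))"
  proof (rule prob_Bex)
    show "finite I" by (simp add: I_def)
    fix b assume b: "b \<in> I"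
    then have b': "0 < b" "b \<le> v" "real b * L \<le> real v" by (auto simp: I_def)
    define \<theta> where "\<theta> = ln (real v / real b) / 2"
    have \<theta>: "\<theta> \<ge> 2 / 5" using theta[OF b'(1,3)] by (simp add: \<theta>_def)
    have "prob (\<lambda>R. \<exists>Y\<in>\<Y> b. dense_subset R Y) \<le> (\<Sum>Y\<in>\<Y> b. exp (real b * (L - 9 * L * \<theta>)))"
    proof (rule prob_Bex)
      show "finite (\<Y> b)" unfolding \<Y>_def using finite_U by simp
      fix Y assume "Y \<in> \<Y> b"
      moreover from this b' have "Y \<noteq> {}" by (auto simp: \<Y>_def)
      ultimately show "prob (\<lambda>R. dense_subset R Y) \<le> exp (real b * (L - 9 * L * \<theta>))"
        using prob_dense_subset[of Y] b' by (auto simp: \<Y>_def L_def \<theta>_def v_def)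
    qed
    also have "\<dots> = real (v choose b) * exp (real b * (L - 9 * L * \<theta>))"
      using n_subsets[OF finite_U, of b] by (simp add: \<Y>_def v_def)
    also have "\<dots> \<le> exp (real b * (1 + 2 * \<theta>)) * exp (real b * (L - 9 * L * \<theta>))"
      using binomial_le_exp[OF b'(1,2)] by (intro mult_right_mono) (auto simp: \<theta>_def)
    also have "\<dots> = exp (real b * (1 + 2 * \<theta> + L - 9 * L * \<theta>))"
      by (simp add: algebra_simps flip: exp_add)
    also have "\<dots> \<le> exp (real b * - (L / 3))"
    proof -
      define P where "P = L * \<theta>"
      have "2 / 5 * L \<le> P" unfolding P_def mult.commute[of L] using \<theta> L by (intro mult_right_mono) auto
      moreover have "2 * \<theta> \<le> P" unfolding P_def using \<theta> L by (intro mult_right_mono) auto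
      moreover have "9 * L * \<theta> = 9 * P" by (simp add: P_def)
      ultimately have "1 + 2 * \<theta> + L - 9 * L * \<theta> \<le> - (L / 3)" using L by linarith
      then have "real b * (1 + 2 * \<theta> + L - 9 * L * \<theta>) \<le> real b * - (L / 3)" by (rule mult_left_mono) simp
      then show ?thesis by (simp only: exp_le_cancel_iff)
    qed
    finally show "prob (\<lambda>R. \<exists>Y\<in>\<Y> b. dense_subset R Y) \<le> exp (- real b * (L / 3))" by simp
  qed
  also have "\<dots> \<le> (\<Sum>b\<in>{1..v}. exp (- real b * (L / 3)))"
    by (rule sum_mono2) (auto simp: I_def)
  also have "\<dots> \<le> 3 * exp (- (L / 3))"
    by (rule geometric_exp_sum_le) (use L in simp)
  finally show ?thesis by (simp add: L_def)
qed

definition light :: "('v \<Rightarrow> real) \<Rightarrow> 'r \<Rightarrow> real"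
  where "light z r = (if \<bar>z (a r) * z (b r)\<bar> \<le> x ^ 5 / card U then z (a r) * z (b r) else 0)"

definition light_deviation :: "'r set \<Rightarrow> ('v \<Rightarrow> real) \<Rightarrow> bool"
  where "light_deviation R z \<longleftrightarrow> \<bar>(\<Sum>r\<in>R. light z r) - p * (\<Sum>r\<in>T. light z r)\<bar> \<ge> 138 * x ^ 5"

lemma sum_products_le:
  assumes "(\<Sum>s\<in>U. (z s)\<^sup>2) \<le> (1 :: real)"
  shows "(\<Sum>s\<in>U. \<Sum>t\<in>U. (z s * z t)\<^sup>2) \<le> 1"
proof -
  have "(\<Sum>s\<in>U. \<Sum>t\<in>U. (z s * z t)\<^sup>2) = (\<Sum>s\<in>U. (z s)\<^sup>2) * (\<Sum>s\<in>U. (z s)\<^sup>2)"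
    by (simp add: sum_product power_mult_distrib)
  also have "\<dots> \<le> 1 * 1" using assms by (intro mult_mono sum_nonneg) auto
  finally show ?thesis by simp
qed

text \<open>In units of \<beta> = x^5 / |U| the weights are at most 1 and their expected square sum
  is at most x^6 / (|U| \<beta>^2) \<le> |U|. The deviation 138 x^5 equals 2 * 69 |U| units; the
  exponent 69 - 1 = 68 leaves room for a union bound over the grid, which has at most exp (66 |U|)
  points.\<close>

lemma prob_light_deviation:
  assumes z: "(\<Sum>s\<in>U. (z s)\<^sup>2) \<le> 1"
  shows "prob (\<lambda>R. light_deviation R z) \<le> 4 * exp (- 68 * real (card U))"
proof -
  define v where "v = real (card U)"
  define \<beta> where "\<beta> = x ^ 5 / v"
  have v: "v > 0" using card_U_pos by (simp add: v_def)
  have x0: "x > 0" using x_ge by simp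
  have \<beta>: "\<beta> > 0" using v x0 by (simp add: \<beta>_def)
  define w where "w r = light z r / \<beta>" for r
  have w1: "\<bar>w r\<bar> \<le> 1" for r
  proof -
    have "\<bar>light z r\<bar> \<le> \<beta>" using \<beta> by (simp add: light_def \<beta>_def v_def less_imp_le)
    then show ?thesis using \<beta> by (simp add: w_def abs_divide divide_le_eq)
  qed
  have "p * (\<Sum>r\<in>T. (w r)\<^sup>2) \<le> p * (\<Sum>r\<in>T. (z (a r) * z (b r))\<^sup>2 / \<beta>\<^sup>2)"
    using p_nonneg by (intro mult_left_mono sum_mono) (auto simp: w_def light_def power_divide)
  also have "\<dots> \<le> x ^ 6 / v * (\<Sum>s\<in>U. \<Sum>t\<in>U. (z s * z t)\<^sup>2 / \<beta>\<^sup>2)"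
    unfolding v_def by (rule expected_sum_le) simp
  also have "\<dots> = x ^ 6 / (v * \<beta>\<^sup>2) * (\<Sum>s\<in>U. \<Sum>t\<in>U. (z s * z t)\<^sup>2)"
    by (simp flip: sum_divide_distrib)
  also have "\<dots> \<le> x ^ 6 / (v * \<beta>\<^sup>2) * 1"
    using v x0 by (intro mult_left_mono sum_products_le z) auto
  also have "\<dots> = v / x ^ 4"
    using v x0 by (simp add: \<beta>_def power2_eq_square field_simps flip: power_add)
  also have "\<dots> \<le> v / 1"
    using v x_ge x0 by (intro divide_left_mono) auto
  finally have mean_sq: "p * (\<Sum>r\<in>T. (w r)\<^sup>2) \<le> v" by simp
  have "prob (\<lambda>R. light_deviation R z) \<le> prob (\<lambda>R. \<bar>(\<Sum>r\<in>R. w r) - p * (\<Sum>r\<in>T. w r)\<bar> \<ge> 2 * (69 * v))"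
  proof (rule prob_mono)
    fix R assume "light_deviation R z"
    then have "138 * x ^ 5 / \<beta> \<le> \<bar>(\<Sum>r\<in>R. light z r) - p * (\<Sum>r\<in>T. light z r)\<bar> / \<beta>"
      unfolding light_deviation_def using \<beta> by (intro divide_right_mono) auto
    also have "\<dots> = \<bar>(\<Sum>r\<in>R. w r) - p * (\<Sum>r\<in>T. w r)\<bar>"
      using \<beta> by (simp add: w_def sum_divide_distrib[symmetric] diff_divide_distrib[symmetric] abs_divide)
    also have "138 * x ^ 5 / \<beta> = 2 * (69 * v)" using v x0 by (simp add: \<beta>_def)
    finally show "2 * (69 * v) \<le> \<bar>(\<Sum>r\<in>R. w r) - p * (\<Sum>r\<in>T. w r)\<bar>" .
  qed
  also have "\<dots> \<le> 4 * exp (p * (\<Sum>r\<in>T. (w r)\<^sup>2) - 69 * v)"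
    by (rule prob_abs_deviation_ge) (rule w1)
  also have "\<dots> \<le> 4 * exp (- 68 * v)" using mean_sq by simp
  finally show ?thesis by (simp add: v_def)
qed

abbreviation grid_vector :: "('v \<Rightarrow> int) \<Rightarrow> 'v \<Rightarrow> real"
  where "grid_vector k \<equiv> \<lambda>s. of_int (k s) / (8 * sqrt (card U))"

definition light_grid_deviation :: "'r set \<Rightarrow> bool"
  where "light_grid_deviation R \<longleftrightarrow>
    (\<exists>k\<in>{k \<in> grid U. (\<Sum>s\<in>U. (grid_vector k s)\<^sup>2) \<le> 1}. light_deviation R (grid_vector k))"

lemma prob_light_grid_deviation: "prob light_grid_deviation \<le> 4 * exp (- 2 * real (card U))"
proof -
  define v where "v = card U"
  define K where "K = {k \<in> grid U. (\<Sum>s\<in>U. (grid_vector k s)\<^sup>2) \<le> 1}"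
  have fK: "finite K" using finite_grid[OF finite_U] by (simp add: K_def)
  have "prob light_grid_deviation \<le> (\<Sum>k\<in>K. 4 * exp (- 68 * real v))"
    unfolding light_grid_deviation_def K_def[symmetric] v_def
    by (rule prob_Bex[OF fK]) (rule prob_light_deviation, simp add: K_def)
  also have "\<dots> = real (card K) * (4 * exp (- 68 * real v))" by simp
  also have "real (card K) \<le> real (card (grid U))"
    using finite_grid[OF finite_U] by (auto simp: K_def intro: card_mono)
  also have "\<dots> \<le> 2 ^ (66 * v)" unfolding v_def by (rule card_grid_le[OF finite_U])
  also have "\<dots> \<le> exp 1 ^ (66 * v)"
    using exp_ge_add_one_self[of 1] by (intro power_mono) auto
  also have "\<dots> = exp (66 * real v)" by (simp flip: exp_of_nat_mult)
  also have "exp (66 * real v) * (4 * exp (- 68 * real v)) = 4 * exp (- 2 * real v)"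
    by (simp flip: exp_add)
  finally show ?thesis by (simp add: v_def)
qed

definition concentrated :: "'r set \<Rightarrow> bool"
  where "concentrated R \<longleftrightarrow> (\<forall>z. \<bar>(\<Sum>r\<in>R. z (a r) * z (b r)) - p * (\<Sum>r\<in>T. z (a r) * z (b r))\<bar>
    \<le> 344 * x ^ 5 * (\<Sum>s\<in>U. (z s)\<^sup>2))"

text \<open>On a grid vector the deviation is at most (138 + 33 + 1) x^5, coming from light pairs,
  heavy edges of \<open>R\<close>, and the expected contribution of heavy edges; the passage from
  the grid to all vectors doubles 172 to 344.\<close>

lemma concentratedI:
  assumes R: "R \<in> subsets_of_card T m" and good: "\<not> large_degree R" "\<not> small_dense_subset R" "\<not> light_grid_deviation R"
  shows "concentrated R"
  unfolding concentrated_def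
proof
  fix z :: "'v \<Rightarrow> real"
  have RT: "R \<subseteq> T" using R by (simp add: subsets_of_card_def)
  have fR: "finite R" using R by (rule finite_member)
  define v where "v = real (card U)"
  define \<beta> where "\<beta> = x ^ 5 / v"
  have v: "v > 0" using card_U_pos by (simp add: v_def)
  have x0: "x > 0" using x_ge by simp
  have \<beta>: "\<beta> > 0" using v x0 by (simp add: \<beta>_def)
  \<comment> \<open>Centered indicator: the deviation becomes a single quadratic form, to which the
    grid lemma applies.\<close>
  define c where "c r = (if r \<in> R then 1 else 0) - p" for r
  have form: "(\<Sum>r\<in>R. z (a r) * z (b r)) - p * (\<Sum>r\<in>T. z (a r) * z (b r)) = (\<Sum>r\<in>T. c r * z (a r) * z (b r))" for z
  proof -
    have "T \<inter> R = R" using RT by blast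
    then have "(\<Sum>r\<in>R. z (a r) * z (b r)) = (\<Sum>r\<in>T. if r \<in> R then z (a r) * z (b r) else 0)"
      using sum.inter_restrict[OF finite_T, of "\<lambda>r. z (a r) * z (b r)" R] by simp
    also have "\<dots> = (\<Sum>r\<in>T. c r * z (a r) * z (b r) + p * (z (a r) * z (b r)))"
      by (rule sum.cong) (simp_all add: c_def left_diff_distrib)
    also have "\<dots> = (\<Sum>r\<in>T. c r * z (a r) * z (b r)) + p * (\<Sum>r\<in>T. z (a r) * z (b r))"
      by (simp only: sum.distrib sum_distrib_left)
    finally show ?thesis by simp
  qed
  have "\<bar>\<Sum>r\<in>T. c r * z (a r) * z (b r)\<bar> \<le> 2 * (172 * x ^ 5) * (\<Sum>s\<in>U. (z s)\<^sup>2)"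
  proof (rule quadratic_form_le_of_grid[OF finite_U finite_T U_nonempty a_in b_in, where c = c and z = z])
    fix k assume k: "k \<in> grid U" "(\<Sum>s\<in>U. (grid_vector k s)\<^sup>2) \<le> 1"
    define y where "y = grid_vector k"
    have y: "(\<Sum>s\<in>U. (y s)\<^sup>2) \<le> 1" using k by (simp add: y_def)
    define heavy where "heavy r \<longleftrightarrow> \<bar>y (a r) * y (b r)\<bar> > \<beta>" for r
    have split: "(\<Sum>r\<in>A. y (a r) * y (b r)) = (\<Sum>r\<in>A. light y r) + (\<Sum>r | r \<in> A \<and> heavy r. y (a r) * y (b r))"
      if "finite A" for A
    proof -
      have "(\<Sum>r | r \<in> A \<and> heavy r. y (a r) * y (b r)) = (\<Sum>r\<in>A. if heavy r then y (a r) * y (b r) else 0)"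
        using that by (simp add: sum.If_cases Int_def)
      then show ?thesis
        by (simp only: sum.distrib[symmetric]) (rule sum.cong; simp add: light_def heavy_def \<beta>_def v_def)
    qed
    have 1: "\<bar>(\<Sum>r\<in>R. light y r) - p * (\<Sum>r\<in>T. light y r)\<bar> \<le> 138 * x ^ 5"
    proof -
      have "\<not> light_deviation R y" using good(3) k unfolding light_grid_deviation_def y_def by blast
      then show ?thesis by (simp add: light_deviation_def)
    qed
    have "\<bar>\<Sum>r | r \<in> R \<and> heavy r. y (a r) * y (b r)\<bar> \<le> (\<Sum>r | r \<in> R \<and> heavy r. \<bar>y (a r) * y (b r)\<bar>)"
      by (rule sum_abs)
    \<comment> \<open>The choice M = x gives both terms the order x^5, for degrees of order x^6 and
      sparsity of order x^4.\<close>
    also have "\<dots> \<le> 3 * (8 * x ^ 6) / x + 9 * x ^ 4 * x"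
      unfolding heavy_def
    proof (rule heavy_edges_le[where U = U and R = R and z = y and a = a and b = b and \<beta> = \<beta> and M = x and \<Delta> = "8 * x ^ 6" and k = "9 * x ^ 4"])
      fix s assume "s \<in> U"
      then have "\<not> real (card {r \<in> R. a r = s}) \<ge> 8 * x ^ 6" "\<not> real (card {r \<in> R. b r = s}) \<ge> 8 * x ^ 6"
        using good(1) unfolding large_degree_def by blast+
      then show "real (card {r \<in> R. a r = s}) \<le> 8 * x ^ 6" "real (card {r \<in> R. b r = s}) \<le> 8 * x ^ 6"
        by linarith+
    next
      fix Y assume Y: "Y \<subseteq> U" "Y \<noteq> {}" "real (card Y) * \<beta> \<le> x"
      have "x ^ 5 = x ^ 4 * x" by (simp add: eval_nat_numeral)
      then have "real (card Y) * x ^ 4 * x \<le> v * x"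
        using Y(3) v by (simp add: \<beta>_def pos_divide_le_eq mult_ac)
      then have "real (card Y) * x ^ 4 \<le> card U" using x0 by (simp add: v_def)
      then show "real (card {r \<in> R. a r \<in> Y \<and> b r \<in> Y}) \<le> 9 * x ^ 4 * real (card Y)"
        using good(2) Y unfolding small_dense_subset_def dense_subset_def by fastforce
    next
      show "a ` R \<subseteq> U" "b ` R \<subseteq> U" using RT a_in b_in by blast+
    qed (simp_all add: finite_U fR x0 \<beta> y less_imp_le)
    also have "\<dots> = 33 * x ^ 5" using x0 by (simp add: eval_nat_numeral)
    finally have 2: "\<bar>\<Sum>r | r \<in> R \<and> heavy r. y (a r) * y (b r)\<bar> \<le> 33 * x ^ 5" .
    have "\<bar>p * (\<Sum>r | r \<in> T \<and> heavy r. y (a r) * y (b r))\<bar> = p * \<bar>\<Sum>r | r \<in> T \<and> heavy r. y (a r) * y (b r)\<bar>"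
      using p_nonneg by (simp add: abs_mult)
    also have "\<dots> \<le> p * (\<Sum>r | r \<in> T \<and> heavy r. \<bar>y (a r) * y (b r)\<bar>)"
      by (intro mult_left_mono sum_abs p_nonneg)
    also have "\<dots> = p * (\<Sum>r\<in>T. if heavy r then \<bar>y (a r) * y (b r)\<bar> else 0)"
      using finite_T by (simp add: sum.If_cases Int_def)
    \<comment> \<open>A heavy product t satisfies |t| \<le> t^2 / \<beta>, so its expectation is
      controlled by the second moment.\<close>
    also have "\<dots> \<le> p * (\<Sum>r\<in>T. (y (a r) * y (b r))\<^sup>2 / \<beta>)"
    proof (intro mult_left_mono sum_mono p_nonneg)
      fix r
      have "\<bar>y (a r) * y (b r)\<bar> * \<beta> \<le> \<bar>y (a r) * y (b r)\<bar> * \<bar>y (a r) * y (b r)\<bar>" if "heavy r"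
        using that by (intro mult_left_mono) (auto simp: heavy_def)
      then show "(if heavy r then \<bar>y (a r) * y (b r)\<bar> else 0) \<le> (y (a r) * y (b r))\<^sup>2 / \<beta>"
        using \<beta> by (auto simp: le_divide_eq power2_eq_square)
    qed
    also have "\<dots> \<le> x ^ 6 / v * (\<Sum>s\<in>U. \<Sum>t\<in>U. (y s * y t)\<^sup>2 / \<beta>)"
      unfolding v_def by (rule expected_sum_le) (use \<beta> in simp)
    also have "\<dots> = x ^ 6 / (v * \<beta>) * (\<Sum>s\<in>U. \<Sum>t\<in>U. (y s * y t)\<^sup>2)"
      by (simp flip: sum_divide_distrib)
    also have "\<dots> \<le> x ^ 6 / (v * \<beta>) * 1"
      using v x0 \<beta> by (intro mult_left_mono sum_products_le y) auto
    also have "\<dots> = x" using v x0 by (simp add: \<beta>_def eval_nat_numeral)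
    also have "\<dots> \<le> x ^ 5" using power_increasing[of 1 5 x] x_ge by simp
    finally have 3: "\<bar>p * (\<Sum>r | r \<in> T \<and> heavy r. y (a r) * y (b r))\<bar> \<le> x ^ 5" .
    have "\<bar>(\<Sum>r\<in>R. y (a r) * y (b r)) - p * (\<Sum>r\<in>T. y (a r) * y (b r))\<bar> \<le> 172 * x ^ 5"
      unfolding split[OF fR] split[OF finite_T] distrib_left using 1 2 3 by linarith
    then show "\<bar>\<Sum>r\<in>T. c r * grid_vector k (a r) * grid_vector k (b r)\<bar> \<le> 172 * x ^ 5"
      using form[of y] by (simp add: y_def)
  qed
  then show "\<bar>(\<Sum>r\<in>R. z (a r) * z (b r)) - p * (\<Sum>r\<in>T. z (a r) * z (b r))\<bar> \<le> 344 * x ^ 5 * (\<Sum>s\<in>U. (z s)\<^sup>2)"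
    using form[of z] by simp
qed

lemma prob_not_concentrated:
  "prob (\<lambda>R. \<not> concentrated R)
    \<le> 2 * card U * exp (- 5 * x ^ 6) + 3 * exp (- (x ^ 4) / 3) + 4 * exp (- 2 * real (card U))"
proof -
  have "prob (\<lambda>R. \<not> concentrated R) \<le> prob (\<lambda>R. (large_degree R \<or> small_dense_subset R) \<or> light_grid_deviation R)"
    by (rule prob_mono) (use concentratedI in blast)
  also have "\<dots> \<le> prob (\<lambda>R. large_degree R \<or> small_dense_subset R) + prob light_grid_deviation"
    by (rule prob_disj)
  also have "\<dots> \<le> (prob large_degree + prob small_dense_subset) + prob light_grid_deviation"
    by (intro add_right_mono prob_disj)
  finally show ?thesis
    using prob_large_degree prob_small_dense_subset prob_light_grid_deviation by linarith
qed

end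

section \<open>Spectral contraction\<close>

text \<open>Cholesky factorization, by eliminating one index after the other.\<close>

lemma gram_factorization:
  fixes g :: "'i \<Rightarrow> 'i \<Rightarrow> real"
  assumes "finite I" and "\<And>s t. s \<in> I \<Longrightarrow> t \<in> I \<Longrightarrow> g s t = g t s"
    and "\<And>x. (\<Sum>s\<in>I. \<Sum>t\<in>I. x s * x t * g s t) \<ge> 0"
  shows "\<exists>c :: 'i \<Rightarrow> 'i \<Rightarrow> real. \<forall>s\<in>I. \<forall>t\<in>I. g s t = (\<Sum>k\<in>I. c k s * c k t)"
  using assms
proof (induction I arbitrary: g rule: finite_induct)
  case empty
  then show ?case by simp
next
  case (insert i I)
  note sym = insert.prems(1) and psd = insert.prems(2)
  define G where "G = g i i"
  define l where "l x = (\<Sum>s\<in>I. x s * g i s)" for x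
  define q where "q x = (\<Sum>s\<in>I. \<Sum>t\<in>I. x s * x t * g s t)" for x
  have form: "\<xi>\<^sup>2 * G + 2 * \<xi> * l x + q x \<ge> 0" for \<xi> x
  proof -
    define y where "y s = (if s = i then \<xi> else x s)" for s
    have y: "y i = \<xi>" "\<And>s. s \<in> I \<Longrightarrow> y s = x s" using insert.hyps by (auto simp: y_def)
    have 1: "(\<Sum>t\<in>I. \<xi> * x t * g i t) = \<xi> * l x"
      by (simp add: l_def sum_distrib_left mult_ac)
    have 2: "(\<Sum>s\<in>I. x s * \<xi> * g s i) = \<xi> * l x"
      unfolding l_def sum_distrib_left using sym by (intro sum.cong HOL.refl) (simp add: mult_ac)
    have "0 \<le> (\<Sum>s\<in>insert i I. \<Sum>t\<in>insert i I. y s * y t * g s t)" by (rule psd)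
    also have "\<dots> = \<xi> * \<xi> * G + (\<Sum>t\<in>I. \<xi> * x t * g i t) + ((\<Sum>s\<in>I. x s * \<xi> * g s i) + q x)"
      using insert.hyps y by (simp add: G_def q_def sum.distrib)
    finally show ?thesis unfolding 1 2 by (simp add: power2_eq_square)
  qed
  have G0: "G \<ge> 0" using form[of 1 "\<lambda>_. 0"] by (simp add: l_def q_def)
  \<comment> \<open>For a zero pivot the quotient is 0 and nothing is eliminated; this is right
    because the whole row then vanishes, as \<open>gi0\<close> shows.\<close>
  define g' where "g' s t = g s t - g i s * g i t / G" for s t
  have q': "(\<Sum>s\<in>I. \<Sum>t\<in>I. x s * x t * g' s t) = q x - (l x)\<^sup>2 / G" for x
  proof -
    have "(l x)\<^sup>2 / G = (\<Sum>s\<in>I. \<Sum>t\<in>I. x s * x t * (g i s * g i t / G))"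
      by (simp add: l_def power2_eq_square sum_product sum_divide_distrib mult_ac)
    then show ?thesis by (simp add: g'_def q_def right_diff_distrib sum_subtractf)
  qed
  have "\<exists>c :: 'i \<Rightarrow> 'i \<Rightarrow> real. \<forall>s\<in>I. \<forall>t\<in>I. g' s t = (\<Sum>k\<in>I. c k s * c k t)"
  proof (rule insert.IH)
    show "g' s t = g' t s" if "s \<in> I" "t \<in> I" for s t
      using that sym[of s t] by (simp add: g'_def)
    show "(\<Sum>s\<in>I. \<Sum>t\<in>I. x s * x t * g' s t) \<ge> 0" for x
    proof (cases "G = 0")
      case True
      then show ?thesis unfolding q' using form[of 0 x] by simp
    next
      case False
      then show ?thesis unfolding q' using form[of "- l x / G" x] by (simp add: field_simps power2_eq_square)
    qed
  qed
  then obtain c where c: "\<And>s t. s \<in> I \<Longrightarrow> t \<in> I \<Longrightarrow> g' s t = (\<Sum>k\<in>I. c k s * c k t)" by blast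
  \<comment> \<open>With a zero pivot the form is affine in \<xi>; a nonzero slope would make it
    negative somewhere, and the value of \<xi> used below makes it -1.\<close>
  have gi0: "g i s = 0" if G: "G = 0" and s: "s \<in> I" for s
  proof (rule ccontr)
    assume ne: "g i s \<noteq> 0"
    define x where "x t = (if t = s then 1 else 0 :: real)" for t
    have "l x = (\<Sum>t\<in>I. if t = s then g i t else 0)" unfolding l_def by (rule sum.cong) (auto simp: x_def)
    then have "l x = g i s" using s insert.hyps by simp
    then have "2 * (- (q x + 1) / (2 * g i s)) * g i s + q x \<ge> 0"
      using form[of "- (q x + 1) / (2 * g i s)" x] G by simp
    then show False using ne by (simp add: field_simps)
  qed
  define c' where "c' k s = (if k = i then g i s / sqrt G else if s = i then 0 else c k s)" for k s
  have "g s t = (\<Sum>k\<in>insert i I. c' k s * c' k t)" if "s \<in> insert i I" "t \<in> insert i I" for s t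
  proof -
    have rest: "(\<Sum>k\<in>I. c' k s * c' k t) = (if s = i \<or> t = i then 0 else g' s t)"
    proof (cases "s = i \<or> t = i")
      case True
      then show ?thesis using insert.hyps by (auto simp: c'_def intro!: sum.neutral)
    next
      case False
      have "(\<Sum>k\<in>I. c' k s * c' k t) = (\<Sum>k\<in>I. c k s * c k t)"
        using insert.hyps False by (intro sum.cong) (auto simp: c'_def)
      then show ?thesis using False that c by auto
    qed
    have first: "c' i s * c' i t = g i s * g i t / G"
      using G0 by (simp add: c'_def)
    have "(\<Sum>k\<in>insert i I. c' k s * c' k t) = g i s * g i t / G + (if s = i \<or> t = i then 0 else g' s t)"
      using insert.hyps rest first by simp
    also have "\<dots> = g s t"
    proof (cases "s = i \<or> t = i")
      case True
      have "g i s * g i t / G = g s t"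
      proof (cases "G = 0")
        case True
        then have "g i u = 0" if "u \<in> insert i I" for u using that gi0 G_def by auto
        then show ?thesis using \<open>s = i \<or> t = i\<close> that sym[of s t] True by auto
      next
        case False
        then show ?thesis using True that sym[of s t] by (auto simp: G_def)
      qed
      then show ?thesis using True by simp
    next
      case False
      then show ?thesis by (simp add: g'_def)
    qed
    finally show ?thesis by simp
  qed
  then show ?case by blast
qed

text \<open>The index \<open>j\<close> stands for an edge from \<open>src j\<close> to \<open>tgt j\<close>, and \<open>\<kappa>\<close> reverses edges.\<close>

locale edge_family =
  fixes J :: "'j set" and V :: "'v set" and src tgt :: "'j \<Rightarrow> 'v" and \<kappa> :: "'j \<Rightarrow> 'j"
  assumes finite_J: "finite J" and J_nonempty: "J \<noteq> {}" and finite_V: "finite V"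
    and src_onto: "src ` J = V" and \<kappa>: "bij_betw \<kappa> J J"
    and src_\<kappa>: "j \<in> J \<Longrightarrow> src (\<kappa> j) = tgt j" and tgt_\<kappa>: "j \<in> J \<Longrightarrow> tgt (\<kappa> j) = src j"
begin

definition deg :: "'v \<Rightarrow> real" where "deg s = real (card {j \<in> J. src j = s})"

definition avg :: "('v \<Rightarrow> real) \<Rightarrow> 'v \<Rightarrow> real"
  where "avg x s = (\<Sum>j | j \<in> J \<and> src j = s. x (tgt j)) / deg s"

text \<open>Averaging over edges weights each vertex by its degree: this is the stationary mean,
  which \<open>avg\<close> preserves.\<close>

definition mean :: "('v \<Rightarrow> real) \<Rightarrow> real"
  where "mean x = (\<Sum>j\<in>J. x (tgt j)) / real (card J)"

lemma src_in: "j \<in> J \<Longrightarrow> src j \<in> V"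
  using src_onto by blast

lemma tgt_in: "j \<in> J \<Longrightarrow> tgt j \<in> V"
  using src_\<kappa>[of j] src_in[of "\<kappa> j"] bij_betwE[OF \<kappa>] by auto

lemma card_J_pos: "real (card J) > 0"
  using finite_J J_nonempty by (simp add: card_gt_0_iff)

lemma deg_pos: "s \<in> V \<Longrightarrow> deg s > 0"
  using src_onto finite_J by (auto simp: deg_def card_gt_0_iff)

lemma sum_swap_ends: "(\<Sum>j\<in>J. \<phi> (src j) (tgt j)) = (\<Sum>j\<in>J. \<phi> (tgt j) (src j))"
proof -
  have "(\<Sum>j\<in>J. \<phi> (src j) (tgt j)) = (\<Sum>j\<in>J. \<phi> (src (\<kappa> j)) (tgt (\<kappa> j)))"
    by (rule sum.reindex_bij_betw[OF \<kappa>, symmetric])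
  also have "\<dots> = (\<Sum>j\<in>J. \<phi> (tgt j) (src j))" by (simp add: src_\<kappa> tgt_\<kappa>)
  finally show ?thesis .
qed

lemma sum_src_eq_tgt: "(\<Sum>j\<in>J. \<phi> (src j)) = (\<Sum>j\<in>J. \<phi> (tgt j))"
  using sum_swap_ends[of "\<lambda>s t. \<phi> s"] .

lemma sum_over_src:
  fixes \<phi> :: "'v \<Rightarrow> real"
  shows "(\<Sum>j\<in>J. \<phi> (src j)) = (\<Sum>s\<in>V. deg s * \<phi> s)"
proof -
  have "(\<Sum>j\<in>J. \<phi> (src j)) = (\<Sum>s\<in>V. \<Sum>j | j \<in> J \<and> src j = s. \<phi> (src j))"
    by (rule sum.group[symmetric]) (use finite_J finite_V src_in in auto)
  also have "\<dots> = (\<Sum>s\<in>V. deg s * \<phi> s)" by (rule sum.cong) (simp_all add: deg_def)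
  finally show ?thesis .
qed

lemma sum_edges:
  fixes \<psi> :: "'j \<Rightarrow> 'v \<Rightarrow> real"
  shows "(\<Sum>s\<in>V. \<Sum>j | j \<in> J \<and> src j = s. \<psi> j s) = (\<Sum>j\<in>J. \<psi> j (src j))"
proof -
  have "(\<Sum>s\<in>V. \<Sum>j | j \<in> J \<and> src j = s. \<psi> j s) = (\<Sum>s\<in>V. \<Sum>j | j \<in> J \<and> src j = s. \<psi> j (src j))"
    by (intro sum.cong) auto
  also have "\<dots> = (\<Sum>j\<in>J. \<psi> j (src j))"
    by (rule sum.group) (use finite_J finite_V src_in in auto)
  finally show ?thesis .
qed

text \<open>A spectral gap of the random walk in the degree-weighted l2 norm, for which
  \<open>avg\<close> is self-adjoint.\<close>

definition contracts :: "real \<Rightarrow> bool"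
  where "contracts \<epsilon> \<longleftrightarrow>
    (\<forall>x. (\<Sum>j\<in>J. (avg x (src j) - mean x)\<^sup>2) \<le> \<epsilon>\<^sup>2 * (\<Sum>j\<in>J. (x (src j) - mean x)\<^sup>2))"

section \<open>Spectral gap from comparison with a form of rank one\<close>

context
  fixes \<rho> N \<delta> :: real
  assumes \<rho>: "\<rho> > 0" and \<delta>: "\<delta> > 0" and deg_ge: "\<And>s. s \<in> V \<Longrightarrow> deg s \<ge> \<delta>"
    and form: "\<And>z. \<bar>(\<Sum>j\<in>J. z (src j) * z (tgt j)) - \<rho> * (\<Sum>s\<in>V. z s)\<^sup>2\<bar> \<le> N * (\<Sum>s\<in>V. (z s)\<^sup>2)"
begin

definition bil :: "('v \<Rightarrow> real) \<Rightarrow> ('v \<Rightarrow> real) \<Rightarrow> real"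
  where "bil x y = (\<Sum>j\<in>J. x (src j) * y (tgt j)) - \<rho> * ((\<Sum>s\<in>V. x s) * (\<Sum>s\<in>V. y s))"

lemma V_nonempty: "V \<noteq> {}"
  using src_onto J_nonempty by auto

lemma bound_nonneg: "N \<ge> 0"
proof -
  have "0 \<le> N * real (card V)" using form[of "\<lambda>_. 1"] by (auto intro: order_trans)
  then show ?thesis using finite_V V_nonempty by (simp add: zero_le_mult_iff card_gt_0_iff)
qed

text \<open>Polarization, available because \<open>\<kappa>\<close> makes the form
  symmetric.\<close>

lemma bil_le: "\<bar>bil x y\<bar> \<le> N / 2 * ((\<Sum>s\<in>V. (x s)\<^sup>2) + (\<Sum>s\<in>V. (y s)\<^sup>2))"
proof -
  define q where "q z = (\<Sum>j\<in>J. z (src j) * z (tgt j)) - \<rho> * (\<Sum>s\<in>V. z s)\<^sup>2" for z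
  have sw: "(\<Sum>j\<in>J. y (src j) * x (tgt j)) = (\<Sum>j\<in>J. x (src j) * y (tgt j))"
    using sum_swap_ends[of "\<lambda>s t. y s * x t"] by (simp add: mult.commute)
  have "q (\<lambda>s. x s + y s) - q (\<lambda>s. x s - y s) = 4 * bil x y"
    unfolding q_def bil_def using sw
    by (simp add: sum.distrib sum_subtractf algebra_simps power2_eq_square)
  moreover have "\<bar>q (\<lambda>s. x s + y s)\<bar> \<le> N * (\<Sum>s\<in>V. (x s + y s)\<^sup>2)" "\<bar>q (\<lambda>s. x s - y s)\<bar> \<le> N * (\<Sum>s\<in>V. (x s - y s)\<^sup>2)"
    unfolding q_def by (rule form)+
  moreover have "N * (\<Sum>s\<in>V. (x s + y s)\<^sup>2) + N * (\<Sum>s\<in>V. (x s - y s)\<^sup>2)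
      = 2 * N * ((\<Sum>s\<in>V. (x s)\<^sup>2) + (\<Sum>s\<in>V. (y s)\<^sup>2))"
    unfolding distrib_left[symmetric] sum.distrib[symmetric] sum_distrib_left
    by (intro sum.cong HOL.refl) (simp add: power2_eq_square algebra_simps)
  ultimately show ?thesis by (simp add: abs_le_iff) linarith
qed

lemma bil_le_mult:
  "\<bar>bil x y\<bar> \<le> N * sqrt (\<Sum>s\<in>V. (x s)\<^sup>2) * sqrt (\<Sum>s\<in>V. (y s)\<^sup>2)"
proof -
  define A B where "A = (\<Sum>s\<in>V. (x s)\<^sup>2)" and "B = (\<Sum>s\<in>V. (y s)\<^sup>2)"
  have AB: "A \<ge> 0" "B \<ge> 0" by (simp_all add: A_def B_def sum_nonneg)
  have zero: "z s = 0" if "(\<Sum>s\<in>V. (z s)\<^sup>2) = 0" "s \<in> V" for z :: "'v \<Rightarrow> real" and s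
    using that finite_V by (simp add: sum_nonneg_eq_0_iff)
  show ?thesis
  proof (cases "A = 0 \<or> B = 0")
    case True
    then have "bil x y = 0"
    proof
      assume "A = 0"
      then have "x s = 0" if "s \<in> V" for s using zero[of x] that by (simp add: A_def)
      then show ?thesis by (simp add: bil_def src_in)
    next
      assume "B = 0"
      then have "y s = 0" if "s \<in> V" for s using zero[of y] that by (simp add: B_def)
      then show ?thesis by (simp add: bil_def tgt_in)
    qed
    then show ?thesis using bound_nonneg AB unfolding A_def[symmetric] B_def[symmetric] by simp
  next
    case False
    then have pos: "A > 0" "B > 0" using AB by auto
    have scale: "bil (\<lambda>s. \<alpha> * x s) (\<lambda>s. \<beta> * y s) = \<alpha> * \<beta> * bil x y" for \<alpha> \<beta>
      by (simp add: bil_def sum_distrib_left[symmetric] right_diff_distrib mult_ac)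
    have "\<bar>bil (\<lambda>s. 1 / sqrt A * x s) (\<lambda>s. 1 / sqrt B * y s)\<bar> \<le> N / 2 * ((\<Sum>s\<in>V. (1 / sqrt A * x s)\<^sup>2) + (\<Sum>s\<in>V. (1 / sqrt B * y s)\<^sup>2))"
      by (rule bil_le)
    also have "(\<Sum>s\<in>V. (1 / sqrt A * x s)\<^sup>2) = 1"
      using pos by (simp add: power_mult_distrib power_divide A_def[symmetric] flip: sum_divide_distrib)
    also have "(\<Sum>s\<in>V. (1 / sqrt B * y s)\<^sup>2) = 1"
      using pos by (simp add: power_mult_distrib power_divide B_def[symmetric] flip: sum_divide_distrib)
    finally have "\<bar>bil x y\<bar> / (sqrt A * sqrt B) \<le> N"
      unfolding scale using pos by (simp add: abs_mult)
    then show ?thesis using pos unfolding A_def[symmetric] B_def[symmetric]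
      by (simp add: pos_divide_le_eq mult.assoc)
  qed
qed

text \<open>\<open>x\<close> is centered for the degree weights, so its plain sum \<sigma> may
  differ from 0. Pairing \<open>x\<close> with the constant 1 shows that it is small: \<rho> sqrt
  |V| |\<sigma>| is at most N |x|. The unnormalized averages \<open>u\<close> satisfy |u|^2 = bil u
  x + \<rho> (sum of u) \<sigma>, and each of the two terms is at most N |u| |x|; this is the origin
  of the factor 2.\<close>

lemma centered_contraction:
  assumes x: "(\<Sum>j\<in>J. x (src j)) = 0"
  shows "(\<Sum>j\<in>J. (avg x (src j))\<^sup>2) \<le> (2 * N / \<delta>)\<^sup>2 * (\<Sum>j\<in>J. (x (src j))\<^sup>2)"
proof -
  define nx where "nx = sqrt (\<Sum>s\<in>V. (x s)\<^sup>2)"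
  define v where "v = real (card V)"
  define \<sigma> where "\<sigma> = (\<Sum>s\<in>V. x s)"
  have v: "v > 0" using finite_V V_nonempty by (simp add: v_def card_gt_0_iff)
  have nx: "nx \<ge> 0" by (simp add: nx_def sum_nonneg)
  have "(\<Sum>j\<in>J. x (tgt j)) = 0" using x sum_src_eq_tgt[of x] by simp
  then have "\<bar>bil (\<lambda>_. 1) x\<bar> = \<rho> * (v * \<bar>\<sigma>\<bar>)"
    using \<rho> v by (simp add: bil_def \<sigma>_def v_def abs_mult)
  then have "\<rho> * (v * \<bar>\<sigma>\<bar>) \<le> N * sqrt v * nx"
    using bil_le_mult[of "\<lambda>_. 1" x] by (simp add: v_def nx_def)
  moreover have "\<rho> * (v * \<bar>\<sigma>\<bar>) = sqrt v * (\<rho> * sqrt v * \<bar>\<sigma>\<bar>)"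
    using v by (metis (no_types, opaque_lifting) less_imp_le mult.assoc mult.left_commute real_sqrt_mult_self abs_of_pos)
  ultimately have \<sigma>: "\<rho> * sqrt v * \<bar>\<sigma>\<bar> \<le> N * nx"
    using v by (simp add: mult.assoc mult.left_commute[of N])
  define u where "u s = (\<Sum>j | j \<in> J \<and> src j = s. x (tgt j))" for s
  define nu where "nu = sqrt (\<Sum>s\<in>V. (u s)\<^sup>2)"
  have nu: "nu \<ge> 0" "nu\<^sup>2 = (\<Sum>s\<in>V. (u s)\<^sup>2)" by (simp_all add: nu_def sum_nonneg)
  have "(\<Sum>s\<in>V. (u s)\<^sup>2) = (\<Sum>s\<in>V. \<Sum>j | j \<in> J \<and> src j = s. u s * x (tgt j))"
    by (simp add: power2_eq_square u_def sum_distrib_left)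
  also have "\<dots> = (\<Sum>j\<in>J. u (src j) * x (tgt j))" by (rule sum_edges)
  also have "\<dots> = bil u x + \<rho> * ((\<Sum>s\<in>V. u s) * \<sigma>)" by (simp add: bil_def \<sigma>_def)
  also have "\<dots> \<le> N * nu * nx + \<rho> * (sqrt v * nu * \<bar>\<sigma>\<bar>)"
  proof (rule add_mono)
    show "bil u x \<le> N * nu * nx" using bil_le_mult[of u x] by (simp add: nu_def nx_def)
    have "\<bar>\<Sum>s\<in>V. 1 * u s\<bar> \<le> L2_set (\<lambda>_. 1) V * L2_set u V"
      by (rule order_trans[OF sum_abs]) (rule order_trans[OF _ L2_set_mult_ineq], simp)
    then have "\<bar>\<Sum>s\<in>V. u s\<bar> \<le> sqrt v * nu" by (simp add: L2_set_def v_def nu_def)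
    then have "\<bar>\<Sum>s\<in>V. u s\<bar> * \<bar>\<sigma>\<bar> \<le> sqrt v * nu * \<bar>\<sigma>\<bar>" by (intro mult_right_mono) auto
    then have "(\<Sum>s\<in>V. u s) * \<sigma> \<le> sqrt v * nu * \<bar>\<sigma>\<bar>"
      by (metis abs_ge_self abs_mult order_trans)
    then show "\<rho> * ((\<Sum>s\<in>V. u s) * \<sigma>) \<le> \<rho> * (sqrt v * nu * \<bar>\<sigma>\<bar>)" using \<rho> by (intro mult_left_mono) auto
  qed
  also have "\<rho> * (sqrt v * nu * \<bar>\<sigma>\<bar>) = nu * (\<rho> * sqrt v * \<bar>\<sigma>\<bar>)" by simp
  also have "\<dots> \<le> nu * (N * nx)" using \<sigma> nu by (intro mult_left_mono) auto
  finally have "nu * nu \<le> (2 * N * nx) * nu" using nu(2) by (simp add: power2_eq_square algebra_simps)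
  then have nu_le: "nu \<le> 2 * N * nx"
    using nu(1) bound_nonneg nx by (cases "nu = 0") (auto simp: mult_le_cancel_right)
  have "(\<Sum>j\<in>J. (avg x (src j))\<^sup>2) = (\<Sum>s\<in>V. deg s * (avg x s)\<^sup>2)"
    by (rule sum_over_src)
  also have "\<dots> \<le> (\<Sum>s\<in>V. (u s)\<^sup>2 / \<delta>)"
  proof (rule sum_mono)
    fix s assume s: "s \<in> V"
    have "deg s * (avg x s)\<^sup>2 = (u s)\<^sup>2 / deg s"
      using deg_pos[OF s] by (simp add: avg_def u_def power2_eq_square)
    also have "\<dots> \<le> (u s)\<^sup>2 / \<delta>"
      using deg_ge[OF s] \<delta> deg_pos[OF s] by (intro divide_left_mono) auto
    finally show "deg s * (avg x s)\<^sup>2 \<le> (u s)\<^sup>2 / \<delta>" .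
  qed
  also have "\<dots> = nu\<^sup>2 / \<delta>" by (simp add: nu sum_divide_distrib)
  also have "\<dots> \<le> (2 * N * nx)\<^sup>2 / \<delta>"
    using nu_le nu(1) \<delta> by (intro divide_right_mono power_mono) auto
  \<comment> \<open>The lower bound \<delta> on the degrees is used twice: above to normalize
    \<open>u\<close>, and below to pass from the plain norm of \<open>x\<close> to the weighted
    one.\<close>
  also have "\<dots> = (2 * N / \<delta>)\<^sup>2 * (\<delta> * nx\<^sup>2)"
    using \<delta> by (simp add: power2_eq_square)
  also have "\<delta> * nx\<^sup>2 = (\<Sum>s\<in>V. \<delta> * (x s)\<^sup>2)" by (simp add: nx_def sum_nonneg sum_distrib_left)
  also have "\<dots> \<le> (\<Sum>s\<in>V. deg s * (x s)\<^sup>2)" by (intro sum_mono mult_right_mono deg_ge) auto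
  also have "\<dots> = (\<Sum>j\<in>J. (x (src j))\<^sup>2)" by (rule sum_over_src[symmetric])
  finally show ?thesis by (simp add: mult_left_mono)
qed

lemma contractsI: "contracts (2 * N / \<delta>)"
  unfolding contracts_def
proof
  fix x :: "'v \<Rightarrow> real"
  define y where "y s = x s - mean x" for s
  have "(\<Sum>j\<in>J. y (src j)) = 0"
    using card_J_pos by (simp add: y_def sum_subtractf mean_def sum_src_eq_tgt)
  moreover have "avg y (src j) = avg x (src j) - mean x" if "j \<in> J" for j
    using deg_pos[OF src_in[OF that]]
    by (simp add: avg_def y_def sum_subtractf diff_divide_distrib) (simp add: deg_def)
  ultimately show "(\<Sum>j\<in>J. (avg x (src j) - mean x)\<^sup>2) \<le> (2 * N / \<delta>)\<^sup>2 * (\<Sum>j\<in>J. (x (src j) - mean x)\<^sup>2)"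
    using centered_contraction[of y] by (simp add: y_def)
qed

end

end

section \<open>Uniformly bounded representations\<close>

locale bounded_representation = G: group G + complex_hilbert_space H
  for G :: "'g monoid" and H :: "'v inner_space" (structure) +
  fixes c :: real and \<pi> :: "'g \<Rightarrow> 'v \<Rightarrow> 'v"
  assumes rep: "uniformly_bounded_rep c G H \<pi>"
begin

lemma hom: "\<pi> \<in> hom G (units_of (operator_monoid H))"
  using rep by (simp add: uniformly_bounded_rep_def)

lemma bounded: "s \<in> carrier G \<Longrightarrow> bounded_operator H (\<pi> s)"
  using hom_in_carrier[OF hom] by (rule operator_unit_bounded)

lemma pi_in [simp]: "s \<in> carrier G \<Longrightarrow> x \<in> carrier H \<Longrightarrow> \<pi> s x \<in> carrier H"
  using bounded[of s] by (auto simp: bounded_operator_def)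

lemma pi_add: "s \<in> carrier G \<Longrightarrow> x \<in> carrier H \<Longrightarrow> y \<in> carrier H
    \<Longrightarrow> \<pi> s (x \<oplus> y) = \<pi> s x \<oplus> \<pi> s y"
  using bounded[of s] by (auto simp: bounded_operator_def)

lemma pi_smult: "s \<in> carrier G \<Longrightarrow> x \<in> carrier H \<Longrightarrow> \<pi> s (a \<odot> x) = a \<odot> \<pi> s x"
  using bounded[of s] by (auto simp: bounded_operator_def)

lemma pi_diff: "s \<in> carrier G \<Longrightarrow> x \<in> carrier H \<Longrightarrow> y \<in> carrier H
    \<Longrightarrow> \<pi> s (x \<ominus> y) = \<pi> s x \<ominus> \<pi> s y"
  by (simp add: M.minus_eq pi_add uminus_eq_smult pi_smult)

lemma pi_mult: "s \<in> carrier G \<Longrightarrow> t \<in> carrier G \<Longrightarrow> x \<in> carrier H \<Longrightarrow> \<pi> (s \<otimes>\<^bsub>G\<^esub> t) x = \<pi> s (\<pi> t x)"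
  using hom_mult[OF hom] by (simp add: units_of_def operator_monoid_def compose_eq)

lemma pi_one: "x \<in> carrier H \<Longrightarrow> \<pi> \<one>\<^bsub>G\<^esub> x = x"
proof -
  assume x: "x \<in> carrier H"
  have "\<pi> \<one>\<^bsub>G\<^esub> \<in> Units (operator_monoid H)"
    using hom_in_carrier[OF hom G.one_closed] by (simp add: units_of_def)
  then obtain S where "compose (carrier H) S (\<pi> \<one>\<^bsub>G\<^esub>) = (\<lambda>x\<in>carrier H. x)"
    by (auto simp: Units_def operator_monoid_def)
  then have S: "S (\<pi> \<one>\<^bsub>G\<^esub> y) = y" if "y \<in> carrier H" for y
    using that by (metis compose_eq restrict_apply')
  have "\<pi> \<one>\<^bsub>G\<^esub> (\<pi> \<one>\<^bsub>G\<^esub> x) = \<pi> \<one>\<^bsub>G\<^esub> x" using pi_mult[of "\<one>\<^bsub>G\<^esub>" "\<one>\<^bsub>G\<^esub>" x] x by simp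
  then show ?thesis using S[of "\<pi> \<one>\<^bsub>G\<^esub> x"] S[of x] x by simp
qed

lemma vnorm_minus_commute: "x \<in> carrier H \<Longrightarrow> y \<in> carrier H \<Longrightarrow> vnorm H (x \<ominus> y) = vnorm H (y \<ominus> x)"
  using vdist_commute[of x y] by (simp add: vdist_def)

lemma vnorm_pi_le:
  assumes s: "s \<in> carrier G" and x: "x \<in> carrier H"
  shows "vnorm H (\<pi> s x) \<le> c * vnorm H x"
proof (cases "vnorm H x = 0")
  case True
  obtain C where "vnorm H (\<pi> s x) \<le> C * vnorm H x"
    using bounded[OF s] x by (auto simp: bounded_operator_def)
  then show ?thesis using True by simp
next
  case False
  then have pos: "vnorm H x > 0" using vnorm_ge_zero[OF x] by simp
  define y where "y = of_real (1 / vnorm H x) \<odot> x"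
  have y: "y \<in> carrier H" "vnorm H y = 1" using x pos by (simp_all add: y_def vnorm_smult norm_divide)
  have "vnorm H (\<pi> s y) \<le> operator_norm H (\<pi> s)"
    unfolding operator_norm_def
    by (rule cSUP_upper[OF _ operator_norm_bdd[OF bounded[OF s]]]) (use y in simp)
  also have "\<dots> \<le> c" using rep s by (simp add: uniformly_bounded_rep_def)
  finally have "vnorm H (\<pi> s x) / vnorm H x \<le> c"
    using s x pos by (simp add: y_def pi_smult vnorm_smult norm_divide)
  then show ?thesis using pos by (simp add: divide_le_eq)
qed

text \<open>The equivalent norm for which \<open>\<pi>\<close> is isometric.\<close>

definition N :: "'v \<Rightarrow> real" where "N x = (SUP s\<in>carrier G. vnorm H (\<pi> s x))"

lemma N_upper: "s \<in> carrier G \<Longrightarrow> x \<in> carrier H \<Longrightarrow> vnorm H (\<pi> s x) \<le> N x"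
  unfolding N_def by (rule cSUP_upper) (auto intro!: bdd_aboveI2[where M = "c * vnorm H x"] vnorm_pi_le)

lemma N_least: "(\<And>s. s \<in> carrier G \<Longrightarrow> vnorm H (\<pi> s x) \<le> C) \<Longrightarrow> N x \<le> C"
  unfolding N_def by (rule cSUP_least) auto

lemma vnorm_le_N: "x \<in> carrier H \<Longrightarrow> vnorm H x \<le> N x"
  using N_upper[of "\<one>\<^bsub>G\<^esub>" x] by (simp add: pi_one)

lemma N_le: "x \<in> carrier H \<Longrightarrow> N x \<le> c * vnorm H x"
  by (rule N_least) (rule vnorm_pi_le)

lemma N_nonneg: "x \<in> carrier H \<Longrightarrow> 0 \<le> N x"
  using vnorm_le_N[of x] vnorm_ge_zero[of x] by linarith

lemma N_pi_le: "t \<in> carrier G \<Longrightarrow> x \<in> carrier H \<Longrightarrow> N (\<pi> t x) \<le> N x"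
  by (rule N_least) (simp flip: pi_mult add: N_upper)

lemma N_triangle: "x \<in> carrier H \<Longrightarrow> y \<in> carrier H \<Longrightarrow> N (x \<oplus> y) \<le> N x + N y"
proof (rule N_least)
  fix s assume *: "x \<in> carrier H" "y \<in> carrier H" "s \<in> carrier G"
  have "vnorm H (\<pi> s (x \<oplus> y)) \<le> vnorm H (\<pi> s x) + vnorm H (\<pi> s y)"
    using * by (simp add: pi_add vnorm_triangle)
  also have "\<dots> \<le> N x + N y" using * by (intro add_mono N_upper)
  finally show "vnorm H (\<pi> s (x \<oplus> y)) \<le> N x + N y" .
qed

lemma N_smult_le: "x \<in> carrier H \<Longrightarrow> N (a \<odot> x) \<le> cmod a * N x"
  by (rule N_least) (simp add: pi_smult vnorm_smult mult_left_mono N_upper)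

lemma N_minus_commute: "x \<in> carrier H \<Longrightarrow> y \<in> carrier H \<Longrightarrow> N (x \<ominus> y) = N (y \<ominus> x)"
  unfolding N_def by (rule SUP_cong) (simp_all add: pi_diff vnorm_minus_commute)

lemma N_diff_triangle:
  "x \<in> carrier H \<Longrightarrow> y \<in> carrier H \<Longrightarrow> z \<in> carrier H \<Longrightarrow> N (x \<ominus> z) \<le> N (x \<ominus> y) + N (y \<ominus> z)"
  using N_triangle[of "x \<ominus> y" "y \<ominus> z"] minus_add_minus[of x y z] by simp

section \<open>Real linear combinations and real coordinates\<close>

definition lincomb :: "('i \<Rightarrow> real) \<Rightarrow> ('i \<Rightarrow> 'v) \<Rightarrow> 'i set \<Rightarrow> 'v"
  where "lincomb \<alpha> h I = finsum H (\<lambda>i. of_real (\<alpha> i) \<odot> h i) I"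

lemma lincomb_empty [simp]: "lincomb \<alpha> h {} = \<zero>"
  by (simp add: lincomb_def)

lemma lincomb_insert:
  assumes "finite I" "i \<notin> I" "h \<in> insert i I \<rightarrow> carrier H"
  shows "lincomb \<alpha> h (insert i I) = of_real (\<alpha> i) \<odot> h i \<oplus> lincomb \<alpha> h I"
  unfolding lincomb_def using assms by (subst M.finsum_insert) auto

lemma lincomb_closed [simp]: "h \<in> I \<rightarrow> carrier H \<Longrightarrow> lincomb \<alpha> h I \<in> carrier H"
  unfolding lincomb_def by (rule M.finsum_closed) auto

text \<open>The vectors have to agree only where the coefficient is nonzero; in \<open>pi_W\<close>
  the coefficients vanish away from the edges at one letter.\<close>

lemma lincomb_cong:
  assumes "h' \<in> I \<rightarrow> carrier H" and "\<And>i. i \<in> I \<Longrightarrow> \<alpha> i = \<alpha>' i" and "\<And>i. i \<in> I \<Longrightarrow> \<alpha>' i \<noteq> 0 \<Longrightarrow> h i = h' i"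
    and "h \<in> I \<rightarrow> carrier H"
  shows "lincomb \<alpha> h I = lincomb \<alpha>' h' I"
  unfolding lincomb_def
proof (rule M.finsum_cong')
  fix i assume i: "i \<in> I"
  show "of_real (\<alpha> i) \<odot> h i = of_real (\<alpha>' i) \<odot> h' i"
  proof (cases "\<alpha>' i = 0")
    case True
    have "h i \<in> carrier H" "h' i \<in> carrier H" using i assms(1,4) by auto
    then show ?thesis using True i assms(2) smult_l_null[of "h i"] smult_l_null[of "h' i"] by simp
  next
    case False
    then show ?thesis using i assms by simp
  qed
qed (use assms in auto)

lemma lincomb_reindex:
  assumes "bij_betw \<tau> I I" "h \<in> I \<rightarrow> carrier H"
  shows "lincomb (\<lambda>i. \<alpha> (\<tau> i)) (\<lambda>i. h (\<tau> i)) I = lincomb \<alpha> h I"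
proof -
  have "finsum H (\<lambda>i. of_real (\<alpha> i) \<odot> h i) (\<tau> ` I) = finsum H (\<lambda>i. of_real (\<alpha> (\<tau> i)) \<odot> h (\<tau> i)) I"
    by (rule M.finsum_reindex) (use assms in \<open>auto simp: bij_betw_def\<close>)
  then show ?thesis using assms(1) by (simp add: lincomb_def bij_betw_def)
qed

lemma lincomb_add:
  assumes "finite I" "h \<in> I \<rightarrow> carrier H" "h' \<in> I \<rightarrow> carrier H"
  shows "lincomb \<alpha> (\<lambda>i. h i \<oplus> h' i) I = lincomb \<alpha> h I \<oplus> lincomb \<alpha> h' I"
proof -
  have "lincomb \<alpha> h I \<oplus> lincomb \<alpha> h' I
      = finsum H (\<lambda>i. of_real (\<alpha> i) \<odot> h i \<oplus> of_real (\<alpha> i) \<odot> h' i) I"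
    unfolding lincomb_def using assms by (intro M.finsum_addf[symmetric]) (auto simp: Pi_iff)
  also have "\<dots> = lincomb \<alpha> (\<lambda>i. h i \<oplus> h' i) I"
    unfolding lincomb_def using assms by (intro M.finsum_cong') (auto simp: Pi_iff smult_r_distr)
  finally show ?thesis by simp
qed

lemma lincomb_uminus:
  assumes "finite I" "h \<in> I \<rightarrow> carrier H"
  shows "lincomb \<alpha> (\<lambda>i. \<ominus> h i) I = \<ominus> lincomb \<alpha> h I"
proof (rule M.minus_equality[symmetric])
  have "lincomb \<alpha> (\<lambda>i. \<ominus> h i) I \<oplus> lincomb \<alpha> h I = lincomb \<alpha> (\<lambda>i. \<ominus> h i \<oplus> h i) I"
    using assms by (intro lincomb_add[symmetric]) auto
  also have "\<dots> = lincomb (\<lambda>_. 0) h I"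
    unfolding lincomb_def using assms smult_l_null by (intro M.finsum_cong') (auto simp: M.l_neg Pi_iff)
  also have "\<dots> = \<zero>"
    unfolding lincomb_def using assms smult_l_null by (intro M.add.finprod_one_eqI) auto
  finally show "lincomb \<alpha> (\<lambda>i. \<ominus> h i) I \<oplus> lincomb \<alpha> h I = \<zero>" .
qed (use assms in \<open>auto simp: Pi_iff\<close>)

lemma lincomb_diff:
  assumes "finite I" "h \<in> I \<rightarrow> carrier H" "h' \<in> I \<rightarrow> carrier H"
  shows "lincomb \<alpha> (\<lambda>i. h i \<ominus> h' i) I = lincomb \<alpha> h I \<ominus> lincomb \<alpha> h' I"
  unfolding M.minus_eq using assms by (subst lincomb_add) (auto simp: lincomb_uminus)

lemma lincomb_const:
  assumes "finite I" "x \<in> carrier H"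
  shows "lincomb \<alpha> (\<lambda>_. x) I = of_real (\<Sum>i\<in>I. \<alpha> i) \<odot> x"
  using assms(1)
proof (induction I rule: finite_induct)
  case empty
  then show ?case using assms smult_l_null by simp
next
  case (insert i I)
  then show ?case
    using assms(2) smult_l_distr[of "of_real (\<alpha> i)" "of_real (\<Sum>i\<in>I. \<alpha> i)" x] by (simp add: lincomb_insert)
qed

lemma lincomb_diff_coeff:
  assumes "finite I" "h \<in> I \<rightarrow> carrier H"
  shows "lincomb \<alpha> h I \<ominus> lincomb \<beta> h I = lincomb (\<lambda>i. \<alpha> i - \<beta> i) h I"
proof -
  have "lincomb (\<lambda>i. \<alpha> i - \<beta> i) h I \<oplus> lincomb \<beta> h I = lincomb \<alpha> h I"
  proof -
    have "lincomb (\<lambda>i. \<alpha> i - \<beta> i) h I \<oplus> lincomb \<beta> h I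
        = finsum H (\<lambda>i. of_real (\<alpha> i - \<beta> i) \<odot> h i \<oplus> of_real (\<beta> i) \<odot> h i) I"
      unfolding lincomb_def using assms by (intro M.finsum_addf[symmetric]) (auto simp: Pi_iff)
    also have "\<dots> = lincomb \<alpha> h I"
      unfolding lincomb_def
    proof (rule M.finsum_cong')
      fix i assume "i \<in> I"
      then have "h i \<in> carrier H" using assms by auto
      then show "of_real (\<alpha> i - \<beta> i) \<odot> h i \<oplus> of_real (\<beta> i) \<odot> h i = of_real (\<alpha> i) \<odot> h i"
        using smult_l_distr[of "of_real (\<alpha> i - \<beta> i)" "of_real (\<beta> i)" "h i"] by simp
    qed (use assms in \<open>auto simp: Pi_iff\<close>)
    finally show ?thesis .
  qed
  then show ?thesis
    using assms M.add.inv_solve_right'[of "lincomb (\<lambda>i. \<alpha> i - \<beta> i) h I" "lincomb \<alpha> h I" "lincomb \<beta> h I"]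
    by (simp add: M.minus_eq)
qed

lemma lincomb_delta:
  assumes "finite I" "h \<in> I \<rightarrow> carrier H" "k \<in> I"
  shows "lincomb (\<lambda>i. if i = k then 1 else 0) h I = h k"
proof -
  have "lincomb (\<lambda>i. if i = k then 1 else 0) h I = lincomb (\<lambda>i. if i = k then 1 else 0) (\<lambda>_. h k) I"
    by (rule lincomb_cong) (use assms in \<open>auto split: if_splits\<close>)
  also have "\<dots> = h k" using assms smult_one[of "h k"] by (subst lincomb_const) auto
  finally show ?thesis .
qed

lemma pi_lincomb:
  assumes "finite I" "h \<in> I \<rightarrow> carrier H" "s \<in> carrier G"
  shows "\<pi> s (lincomb \<alpha> h I) = lincomb \<alpha> (\<lambda>i. \<pi> s (h i)) I"
  using assms(1,2)
proof (induction I rule: finite_induct)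
  case empty
  have "\<pi> s (0 \<odot> \<zero>) = 0 \<odot> \<pi> s \<zero>" using assms(3) by (intro pi_smult) auto
  then show ?case using smult_l_null[of "\<zero>"] smult_l_null[of "\<pi> s \<zero>"] assms(3) by simp
next
  case (insert i I)
  then show ?case using assms(3) by (simp add: lincomb_insert pi_add pi_smult Pi_iff)
qed

lemma N_lincomb_le:
  assumes "finite I" "h \<in> I \<rightarrow> carrier H"
  shows "N (lincomb \<alpha> h I) \<le> (\<Sum>i\<in>I. \<bar>\<alpha> i\<bar> * N (h i))"
  using assms
proof (induction I rule: finite_induct)
  case empty
  then show ?case using N_le[of "\<zero>"] vnorm_eq_zero[of "\<zero>"] by simp
next
  case (insert i I)
  have "N (lincomb \<alpha> h (insert i I)) \<le> N (of_real (\<alpha> i) \<odot> h i) + N (lincomb \<alpha> h I)"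
    using insert by (simp add: lincomb_insert N_triangle Pi_iff)
  also have "N (of_real (\<alpha> i) \<odot> h i) \<le> \<bar>\<alpha> i\<bar> * N (h i)"
    using N_smult_le[of "h i" "of_real (\<alpha> i)"] insert.prems by simp
  finally show ?case using insert by (simp add: Pi_iff)
qed

lemma Re_cinner_lincomb_left:
  assumes "finite I" "h \<in> I \<rightarrow> carrier H" "y \<in> carrier H"
  shows "Re (cinner H (lincomb \<alpha> h I) y) = (\<Sum>i\<in>I. \<alpha> i * Re (cinner H (h i) y))"
  using assms(1,2)
  by (induction I rule: finite_induct)
    (auto simp: lincomb_insert cinner_add_left cinner_smult_left assms(3) Pi_iff)

lemma Re_cinner_commute: "x \<in> carrier H \<Longrightarrow> y \<in> carrier H \<Longrightarrow> Re (cinner H x y) = Re (cinner H y x)"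
  using cinner_commute[of x y] by simp

lemma vnorm_lincomb_square:
  assumes "finite I" "h \<in> I \<rightarrow> carrier H"
  shows "(vnorm H (lincomb \<alpha> h I))\<^sup>2 = (\<Sum>i\<in>I. \<Sum>j\<in>I. \<alpha> i * \<alpha> j * Re (cinner H (h i) (h j)))"
proof -
  have "(vnorm H (lincomb \<alpha> h I))\<^sup>2 = (\<Sum>i\<in>I. \<alpha> i * Re (cinner H (h i) (lincomb \<alpha> h I)))"
    using assms by (simp add: vnorm_square Re_cinner_lincomb_left)
  also have "\<dots> = (\<Sum>i\<in>I. \<alpha> i * (\<Sum>j\<in>I. \<alpha> j * Re (cinner H (h i) (h j))))"
  proof (intro sum.cong HOL.refl arg_cong2[where f = "(*)"])
    fix i assume i: "i \<in> I"
    then have "Re (cinner H (h i) (lincomb \<alpha> h I)) = (\<Sum>j\<in>I. \<alpha> j * Re (cinner H (h j) (h i)))"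
      using assms by (subst Re_cinner_commute) (auto simp: Re_cinner_lincomb_left Pi_iff)
    also have "\<dots> = (\<Sum>j\<in>I. \<alpha> j * Re (cinner H (h i) (h j)))"
      using assms i by (intro sum.cong HOL.refl) (auto simp: Re_cinner_commute Pi_iff)
    finally show "Re (cinner H (h i) (lincomb \<alpha> h I)) = (\<Sum>j\<in>I. \<alpha> j * Re (cinner H (h i) (h j)))" .
  qed
  finally show ?thesis by (simp add: sum_distrib_left mult.assoc)
qed

text \<open>Factoring the real Gram matrix of the vectors f s yields real coordinates that compute
  the norms of all their real combinations. Inequalities between sums of squares thus pass from real
  functions to functions with values in the Hilbert space, without choosing an orthonormal
  basis.\<close>

lemma coordinates:
  fixes f :: "'i \<Rightarrow> 'v"
  assumes "finite V" "f \<in> V \<rightarrow> carrier H"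
  obtains x :: "'i \<Rightarrow> 'i \<Rightarrow> real" where
    "\<And>(I :: 'j set) \<phi> \<alpha>. finite I \<Longrightarrow> \<phi> \<in> I \<rightarrow> V
      \<Longrightarrow> (vnorm H (lincomb \<alpha> (\<lambda>i. f (\<phi> i)) I))\<^sup>2 = (\<Sum>k\<in>V. (\<Sum>i\<in>I. \<alpha> i * x k (\<phi> i))\<^sup>2)"
proof -
  have "\<exists>x :: 'i \<Rightarrow> 'i \<Rightarrow> real. \<forall>s\<in>V. \<forall>t\<in>V. Re (cinner H (f s) (f t)) = (\<Sum>k\<in>V. x k s * x k t)"
  proof (rule gram_factorization[OF assms(1)])
    show "Re (cinner H (f s) (f t)) = Re (cinner H (f t) (f s))" if "s \<in> V" "t \<in> V" for s t
      using that assms by (intro Re_cinner_commute) auto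
    show "(\<Sum>s\<in>V. \<Sum>t\<in>V. \<alpha> s * \<alpha> t * Re (cinner H (f s) (f t))) \<ge> 0" for \<alpha>
      unfolding vnorm_lincomb_square[OF assms, symmetric] by simp
  qed
  then obtain x :: "'i \<Rightarrow> 'i \<Rightarrow> real" where
    x: "\<And>s t. s \<in> V \<Longrightarrow> t \<in> V \<Longrightarrow> Re (cinner H (f s) (f t)) = (\<Sum>k\<in>V. x k s * x k t)" by blast
  show thesis
  proof (rule that)
    fix I :: "'j set" and \<phi> \<alpha> assume I: "finite I" "\<phi> \<in> I \<rightarrow> V"
    have "(vnorm H (lincomb \<alpha> (\<lambda>i. f (\<phi> i)) I))\<^sup>2
        = (\<Sum>i\<in>I. \<Sum>j\<in>I. \<alpha> i * \<alpha> j * Re (cinner H (f (\<phi> i)) (f (\<phi> j))))"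
      using I assms(2) by (intro vnorm_lincomb_square) auto
    also have "\<dots> = (\<Sum>i\<in>I. \<Sum>j\<in>I. \<Sum>k\<in>V. (\<alpha> i * x k (\<phi> i)) * (\<alpha> j * x k (\<phi> j)))"
      using I by (intro sum.cong HOL.refl) (auto simp: x Pi_iff sum_distrib_left mult_ac)
    also have "\<dots> = (\<Sum>i\<in>I. \<Sum>k\<in>V. \<Sum>j\<in>I. (\<alpha> i * x k (\<phi> i)) * (\<alpha> j * x k (\<phi> j)))"
      by (intro sum.cong HOL.refl sum.swap)
    also have "\<dots> = (\<Sum>k\<in>V. \<Sum>i\<in>I. \<Sum>j\<in>I. (\<alpha> i * x k (\<phi> i)) * (\<alpha> j * x k (\<phi> j)))"
      by (rule sum.swap)
    also have "\<dots> = (\<Sum>k\<in>V. (\<Sum>i\<in>I. \<alpha> i * x k (\<phi> i))\<^sup>2)"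
      by (simp add: power2_eq_square sum_product)
    finally show "(vnorm H (lincomb \<alpha> (\<lambda>i. f (\<phi> i)) I))\<^sup>2 = (\<Sum>k\<in>V. (\<Sum>i\<in>I. \<alpha> i * x k (\<phi> i))\<^sup>2)" .
  qed
qed

end

text \<open>The index \<open>j\<close> stands for a relation \<open>src j \<cdot> lbl j = tgt j\<close>, and \<open>\<tau>\<close> rewrites it as
  \<open>(src j)\<^sup>-\<^sup>1 \<cdot> tgt j = lbl j\<close>.\<close>

locale triangle_family = edge_family J V src tgt \<kappa>
  for J :: "'j set" and V :: "'l set" and src tgt :: "'j \<Rightarrow> 'l" and \<kappa> :: "'j \<Rightarrow> 'j" +
  fixes lbl :: "'j \<Rightarrow> 'l" and \<tau> :: "'j \<Rightarrow> 'j" and \<iota> :: "'l \<Rightarrow> 'l"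
  assumes \<tau>: "bij_betw \<tau> J J" and \<iota>: "s \<in> V \<Longrightarrow> \<iota> (\<iota> s) = s"
    and src_\<tau>: "j \<in> J \<Longrightarrow> src (\<tau> j) = \<iota> (src j)"
    and lbl_\<tau>: "j \<in> J \<Longrightarrow> lbl (\<tau> j) = tgt j"
    and tgt_\<tau>: "j \<in> J \<Longrightarrow> tgt (\<tau> j) = lbl j"
begin

definition coef :: "'l \<Rightarrow> 'j \<Rightarrow> real"
  where "coef s j = (if src j = s then 1 / deg s else 0)"

lemma sum_coef: "(\<Sum>j\<in>J. coef s j * \<phi> j) = (\<Sum>j | j \<in> J \<and> src j = s. \<phi> j) / deg s"
proof -
  have "(\<Sum>j\<in>J. coef s j * \<phi> j) = (\<Sum>j\<in>J. if src j = s then \<phi> j / deg s else 0)"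
    by (rule sum.cong) (auto simp: coef_def)
  then show ?thesis using finite_J by (simp add: sum.If_cases Int_def sum_divide_distrib)
qed

lemma sum_coef_1: "s \<in> V \<Longrightarrow> (\<Sum>j\<in>J. coef s j) = 1"
  using sum_coef[of s "\<lambda>_. 1"] deg_pos[of s] by (simp add: deg_def)

lemma \<tau>_in: "j \<in> J \<Longrightarrow> \<tau> j \<in> J"
  using \<tau> by (auto dest: bij_betwE)

lemma \<kappa>_in: "j \<in> J \<Longrightarrow> \<kappa> j \<in> J"
  using \<kappa> by (auto dest: bij_betwE)

lemma lbl_in: "j \<in> J \<Longrightarrow> lbl j \<in> V"
  using tgt_\<tau>[of j] tgt_in[of "\<tau> j"] \<tau>_in by simp

lemma src_\<tau>_eq_iff: "j \<in> J \<Longrightarrow> s \<in> V \<Longrightarrow> src (\<tau> j) = \<iota> s \<longleftrightarrow> src j = s"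
  using \<iota> src_\<tau> src_in by metis

lemma deg_\<iota>:
  assumes s: "s \<in> V"
  shows "deg (\<iota> s) = deg s"
proof -
  have "bij_betw \<tau> {j \<in> J. src j = s} {j \<in> J. src j = \<iota> s}"
    unfolding bij_betw_def
  proof
    show "inj_on \<tau> {j \<in> J. src j = s}"
      using bij_betw_imp_inj_on[OF \<tau>] by (rule inj_on_subset) blast
    show "\<tau> ` {j \<in> J. src j = s} = {j \<in> J. src j = \<iota> s}"
    proof (intro subset_antisym subsetI)
      fix i assume "i \<in> \<tau> ` {j \<in> J. src j = s}"
      then obtain j where j: "j \<in> J" "src j = s" "i = \<tau> j" by blast
      then show "i \<in> {j \<in> J. src j = \<iota> s}" by (simp add: \<tau>_in src_\<tau>)
    next
      fix i assume i: "i \<in> {j \<in> J. src j = \<iota> s}"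
      then obtain j where j: "j \<in> J" "i = \<tau> j" using bij_betw_imp_surj_on[OF \<tau>] by blast
      then have "src j = s" using i src_\<tau>_eq_iff[OF j(1) s] by simp
      then show "i \<in> \<tau> ` {j \<in> J. src j = s}" using j by blast
    qed
  qed
  then show ?thesis unfolding deg_def by (simp add: bij_betw_same_card)
qed

lemma coef_\<tau>: "j \<in> J \<Longrightarrow> s \<in> V \<Longrightarrow> coef (\<iota> s) (\<tau> j) = coef s j"
  by (simp add: coef_def src_\<tau>_eq_iff deg_\<iota>)

text \<open>\<open>\<tau>\<close> exchanges labels with targets and \<open>\<kappa>\<close>
  exchanges targets with sources, so every letter occurs equally often in the three roles.\<close>

lemma sum_lbl_eq_src: "(\<Sum>j\<in>J. \<phi> (lbl j)) = (\<Sum>j\<in>J. \<phi> (src j))"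
proof -
  have "(\<Sum>j\<in>J. \<phi> (tgt j)) = (\<Sum>j\<in>J. \<phi> (tgt (\<tau> j)))"
    by (rule sum.reindex_bij_betw[OF \<tau>, symmetric])
  then show ?thesis using sum_src_eq_tgt[of \<phi>] by (simp add: tgt_\<tau>)
qed

lemma lbl_onto: "s \<in> V \<Longrightarrow> \<exists>j\<in>J. lbl j = s"
proof -
  assume "s \<in> V"
  then obtain j where j: "j \<in> J" "src j = s" using src_onto by auto
  then have "\<tau> (\<kappa> j) \<in> J" "lbl (\<tau> (\<kappa> j)) = s" by (simp_all add: \<tau>_in \<kappa>_in lbl_\<tau> tgt_\<kappa>)
  then show ?thesis by blast
qed

end

section \<open>Displacement and contraction in a representation\<close>

text \<open>\<open>generates\<close> is induction over words that prefixes one letter at a time; by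
  \<open>g_\<iota>\<close> the inverses of generators are among the letters.\<close>

locale triangle_representation = bounded_representation G H c \<pi> + triangle_family J V src tgt \<kappa> lbl \<tau> \<iota>
  for G :: "'g monoid" and H :: "'v inner_space" (structure) and c :: real and \<pi> :: "'g \<Rightarrow> 'v \<Rightarrow> 'v"
    and J :: "'j set" and V :: "'l set" and src tgt lbl :: "'j \<Rightarrow> 'l" and \<kappa> \<tau> :: "'j \<Rightarrow> 'j" and \<iota> :: "'l \<Rightarrow> 'l" +
  fixes g :: "'l \<Rightarrow> 'g" and \<epsilon> :: real
  assumes g_in: "s \<in> V \<Longrightarrow> g s \<in> carrier G"
    and g_\<iota>: "s \<in> V \<Longrightarrow> g (\<iota> s) = inv\<^bsub>G\<^esub> (g s)"
    and g_mult: "j \<in> J \<Longrightarrow> g (src j) \<otimes>\<^bsub>G\<^esub> g (lbl j) = g (tgt j)"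
    and generates: "\<And>A. \<one>\<^bsub>G\<^esub> \<in> A \<Longrightarrow> (\<And>s x. s \<in> V \<Longrightarrow> x \<in> A \<Longrightarrow> x \<in> carrier G \<Longrightarrow> g s \<otimes>\<^bsub>G\<^esub> x \<in> A) \<Longrightarrow> carrier G \<subseteq> A"
    and contracts: "contracts \<epsilon>" and \<epsilon>: "\<epsilon> \<ge> 0" and c: "c \<ge> 1" and c\<epsilon>: "c * \<epsilon> \<le> 1 / 5"
begin

definition f :: "'v \<Rightarrow> 'l \<Rightarrow> 'v" where "f \<xi> s = \<pi> (g s) \<xi>"

definition W :: "'v \<Rightarrow> 'l \<Rightarrow> 'v" where "W \<xi> s = lincomb (coef s) (\<lambda>j. f \<xi> (tgt j)) J"

definition barycenter :: "'v \<Rightarrow> 'v" where "barycenter \<xi> = lincomb (\<lambda>_. 1 / real (card J)) (\<lambda>j. f \<xi> (tgt j)) J"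

text \<open>Indexed by labels because the summand at \<open>j\<close> dominates the variation of
  \<open>f \<xi>\<close> along the edge \<open>j\<close>, by \<open>N_f_diff_le\<close>.\<close>

definition energy :: "'v \<Rightarrow> real" where "energy \<xi> = L2_set (\<lambda>j. N (f \<xi> (lbl j) \<ominus> \<xi>)) J"

lemma L2_set_lbl_eq_src: "L2_set (\<lambda>j. \<phi> (lbl j)) J = L2_set (\<lambda>j. \<phi> (src j)) J"
  unfolding L2_set_def using sum_lbl_eq_src[of "\<lambda>s. (\<phi> s)\<^sup>2"] by simp

context
  fixes \<xi> assumes \<xi>: "\<xi> \<in> carrier H"
begin

lemma f_in [simp]: "s \<in> V \<Longrightarrow> f \<xi> s \<in> carrier H"
  by (simp add: f_def g_in \<xi>)

lemma f_tgt_in: "(\<lambda>j. f \<xi> (tgt j)) \<in> J \<rightarrow> carrier H"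
  by (simp add: tgt_in)

lemma W_in [simp]: "W \<xi> s \<in> carrier H"
  unfolding W_def by (rule lincomb_closed[OF f_tgt_in])

lemma barycenter_in [simp]: "barycenter \<xi> \<in> carrier H"
  unfolding barycenter_def by (rule lincomb_closed[OF f_tgt_in])

lemma energy_nonneg: "energy \<xi> \<ge> 0"
  by (simp add: energy_def)

text \<open>In the group the source times the label is the target, so moving \<xi> - f \<xi> (lbl j)
  by g (src j) produces the difference along the edge, and \<open>N\<close> does not increase under
  the action.\<close>

lemma N_f_diff_le: "j \<in> J \<Longrightarrow> N (f \<xi> (src j) \<ominus> f \<xi> (tgt j)) \<le> N (f \<xi> (lbl j) \<ominus> \<xi>)"
proof -
  assume j: "j \<in> J"
  then have in_G: "g (src j) \<in> carrier G" "g (lbl j) \<in> carrier G" by (simp_all add: g_in src_in lbl_in)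
  have "f \<xi> (src j) \<ominus> f \<xi> (tgt j) = \<pi> (g (src j)) (\<xi> \<ominus> f \<xi> (lbl j))"
    using in_G j \<xi> by (simp add: f_def g_mult[symmetric] pi_mult pi_diff)
  then have "N (f \<xi> (src j) \<ominus> f \<xi> (tgt j)) \<le> N (\<xi> \<ominus> f \<xi> (lbl j))"
    using in_G j \<xi> by (simp add: N_pi_le lbl_in)
  then show ?thesis using \<xi> j by (simp add: N_minus_commute lbl_in)
qed

text \<open>Convexity: W is an average of \<open>f\<close> over the neighbors, so its squared
  distance from f at the vertex is at most the average of the squared distances. This uses only the
  triangle inequality and Cauchy-Schwarz for real sums, hence applies to \<open>N\<close>.\<close>

lemma f_minus_W_le: "L2_set (\<lambda>j. N (f \<xi> (src j) \<ominus> W \<xi> (src j))) J \<le> energy \<xi>"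
proof -
  have N_le: "deg s * (N (f \<xi> s \<ominus> W \<xi> s))\<^sup>2 \<le> (\<Sum>j | j \<in> J \<and> src j = s. (N (f \<xi> s \<ominus> f \<xi> (tgt j)))\<^sup>2)"
    if s: "s \<in> V" for s
  proof -
    define h where "h j = f \<xi> s \<ominus> f \<xi> (tgt j)" for j
    have h: "h \<in> J \<rightarrow> carrier H" using s by (simp add: h_def tgt_in)
    have "f \<xi> s \<ominus> W \<xi> s = lincomb (coef s) (\<lambda>_. f \<xi> s) J \<ominus> W \<xi> s"
      using s finite_J smult_one[of "f \<xi> s"] by (simp add: lincomb_const sum_coef_1)
    also have "\<dots> = lincomb (coef s) h J"
      unfolding W_def h_def using s finite_J f_tgt_in by (intro lincomb_diff[symmetric]) auto
    finally have "N (f \<xi> s \<ominus> W \<xi> s) \<le> (\<Sum>j\<in>J. \<bar>coef s j\<bar> * N (h j))"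
      using N_lincomb_le[OF finite_J h] by simp
    also have "\<dots> = (\<Sum>j\<in>J. coef s j * N (h j))"
      using deg_pos[OF s] by (intro sum.cong HOL.refl) (simp add: coef_def)
    also have "\<dots> = (\<Sum>j | j \<in> J \<and> src j = s. N (h j)) / deg s" by (rule sum_coef)
    finally have "(N (f \<xi> s \<ominus> W \<xi> s))\<^sup>2 \<le> ((\<Sum>j | j \<in> J \<and> src j = s. N (h j)) / deg s)\<^sup>2"
      using s by (intro power_mono N_nonneg) simp_all
    also have "\<dots> = (\<Sum>j | j \<in> J \<and> src j = s. N (h j))\<^sup>2 / (deg s)\<^sup>2" by (rule power_divide)
    also have "\<dots> \<le> ((\<Sum>j | j \<in> J \<and> src j = s. (N (h j))\<^sup>2) * deg s) / (deg s)\<^sup>2"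
      unfolding deg_def by (intro divide_right_mono sum_squared_le_sum_of_squares) (use finite_J in auto)
    also have "\<dots> = (\<Sum>j | j \<in> J \<and> src j = s. (N (h j))\<^sup>2) / deg s"
      using deg_pos[OF s] by (simp add: power2_eq_square)
    finally show ?thesis using deg_pos[OF s] by (simp add: pos_le_divide_eq mult.commute h_def)
  qed
  have "(\<Sum>j\<in>J. (N (f \<xi> (src j) \<ominus> W \<xi> (src j)))\<^sup>2) = (\<Sum>s\<in>V. deg s * (N (f \<xi> s \<ominus> W \<xi> s))\<^sup>2)"
    by (rule sum_over_src)
  also have "\<dots> \<le> (\<Sum>s\<in>V. \<Sum>j | j \<in> J \<and> src j = s. (N (f \<xi> s \<ominus> f \<xi> (tgt j)))\<^sup>2)"
    by (rule sum_mono) (rule N_le)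
  also have "\<dots> = (\<Sum>j\<in>J. (N (f \<xi> (src j) \<ominus> f \<xi> (tgt j)))\<^sup>2)"
    by (rule sum_edges)
  also have "\<dots> \<le> (\<Sum>j\<in>J. (N (f \<xi> (lbl j) \<ominus> \<xi>))\<^sup>2)"
    by (intro sum_mono power_mono N_f_diff_le N_nonneg) (auto simp: src_in tgt_in)
  finally show ?thesis by (simp add: energy_def L2_set_def)
qed

text \<open>Translation by g s carries the neighbors of \<iota> s to those of s: after reindexing by
  \<open>\<tau>\<close> the neighbor of \<iota> s is the label of an edge at s, and g s times this
  label is the target of the edge.\<close>

lemma pi_W: "s \<in> V \<Longrightarrow> \<pi> (g s) (W \<xi> (\<iota> s)) = W \<xi> s"
proof -
  assume s: "s \<in> V"
  have "\<pi> (g s) (W \<xi> (\<iota> s)) = lincomb (coef (\<iota> s)) (\<lambda>j. \<pi> (g s) (f \<xi> (tgt j))) J"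
    unfolding W_def using s by (intro pi_lincomb finite_J f_tgt_in g_in)
  also have "\<dots> = lincomb (\<lambda>j. coef (\<iota> s) (\<tau> j)) (\<lambda>j. \<pi> (g s) (f \<xi> (tgt (\<tau> j)))) J"
    using s by (intro lincomb_reindex[OF \<tau>, symmetric]) (auto simp: g_in tgt_in)
  also have "\<dots> = W \<xi> s"
    unfolding W_def
  proof (rule lincomb_cong)
    fix j assume j: "j \<in> J"
    show "coef (\<iota> s) (\<tau> j) = coef s j" using j s by (rule coef_\<tau>)
    assume "coef s j \<noteq> 0"
    then have sj: "src j = s" by (auto simp: coef_def split: if_splits)
    have "f \<xi> (tgt j) = \<pi> (g (src j) \<otimes>\<^bsub>G\<^esub> g (lbl j)) \<xi>" using j by (simp add: f_def g_mult)
    also have "\<dots> = \<pi> (g s) (f \<xi> (tgt (\<tau> j)))"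
      using j \<xi> by (simp add: sj[symmetric] tgt_\<tau> f_def pi_mult g_in src_in lbl_in)
    finally show "\<pi> (g s) (f \<xi> (tgt (\<tau> j))) = f \<xi> (tgt j)" by simp
  qed (use s in \<open>auto simp: tgt_in \<tau>_in g_in\<close>)
  finally show ?thesis .
qed

text \<open>The gap for real functions is applied to each coordinate of the family
  \<open>f \<xi>\<close> and summed up.\<close>

lemma W_contraction:
  "L2_set (\<lambda>j. vnorm H (W \<xi> (src j) \<ominus> barycenter \<xi>)) J
    \<le> \<epsilon> * L2_set (\<lambda>j. vnorm H (f \<xi> (src j) \<ominus> barycenter \<xi>)) J"
proof -
  have f_V: "f \<xi> \<in> V \<rightarrow> carrier H" by simp
  obtain x :: "'l \<Rightarrow> 'l \<Rightarrow> real" where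
    x: "\<And>(I :: 'j set) \<phi> \<alpha>. finite I \<Longrightarrow> \<phi> \<in> I \<rightarrow> V
      \<Longrightarrow> (vnorm H (lincomb \<alpha> (\<lambda>i. f \<xi> (\<phi> i)) I))\<^sup>2 = (\<Sum>k\<in>V. (\<Sum>i\<in>I. \<alpha> i * x k (\<phi> i))\<^sup>2)"
    by (rule coordinates[OF finite_V f_V]) (rule that, assumption)
  have tgt: "tgt \<in> J \<rightarrow> V" by (simp add: tgt_in)
  define n where "n = real (card J)"
  have mean_eq: "(\<Sum>j\<in>J. 1 / n * x k (tgt j)) = mean (x k)" for k
    by (simp add: mean_def n_def sum_divide_distrib)
  have 1: "(vnorm H (W \<xi> (src i) \<ominus> barycenter \<xi>))\<^sup>2 = (\<Sum>k\<in>V. (avg (x k) (src i) - mean (x k))\<^sup>2)" for i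
  proof -
    have "W \<xi> (src i) \<ominus> barycenter \<xi> = lincomb (\<lambda>j. coef (src i) j - 1 / n) (\<lambda>j. f \<xi> (tgt j)) J"
      unfolding W_def barycenter_def n_def by (rule lincomb_diff_coeff[OF finite_J f_tgt_in])
    moreover have "(\<Sum>j\<in>J. (coef (src i) j - 1 / n) * x k (tgt j)) = avg (x k) (src i) - mean (x k)" for k
      unfolding left_diff_distrib sum_subtractf mean_eq sum_coef avg_def ..
    ultimately show ?thesis using x[OF finite_J tgt] by simp
  qed
  have 2: "(vnorm H (f \<xi> (src i) \<ominus> barycenter \<xi>))\<^sup>2 = (\<Sum>k\<in>V. (x k (src i) - mean (x k))\<^sup>2)" if i: "i \<in> J" for i
  proof -
    \<comment> \<open>All vectors have to be combinations of the same family f \<xi> (tgt j); the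
      reversed edge \<kappa> i has target src i.\<close>
    have "f \<xi> (src i) = lincomb (\<lambda>j. if j = \<kappa> i then 1 else 0) (\<lambda>j. f \<xi> (tgt j)) J"
      using lincomb_delta[OF finite_J f_tgt_in \<kappa>_in[OF i]] tgt_\<kappa>[OF i] by simp
    then have "f \<xi> (src i) \<ominus> barycenter \<xi> = lincomb (\<lambda>j. (if j = \<kappa> i then 1 else 0) - 1 / n) (\<lambda>j. f \<xi> (tgt j)) J"
      unfolding barycenter_def n_def by (simp only: lincomb_diff_coeff[OF finite_J f_tgt_in])
    moreover have "(\<Sum>j\<in>J. ((if j = \<kappa> i then 1 else 0) - 1 / n) * x k (tgt j)) = x k (src i) - mean (x k)" for k
    proof -
      have "(\<Sum>j\<in>J. (if j = \<kappa> i then 1 else 0) * x k (tgt j)) = (\<Sum>j\<in>J. if j = \<kappa> i then x k (tgt j) else 0)"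
        by (rule sum.cong) auto
      also have "\<dots> = x k (src i)" using finite_J \<kappa>_in[OF i] tgt_\<kappa>[OF i] by simp
      finally show ?thesis unfolding left_diff_distrib sum_subtractf mean_eq by simp
    qed
    ultimately show ?thesis using x[OF finite_J tgt] by simp
  qed
  have "(\<Sum>j\<in>J. (vnorm H (W \<xi> (src j) \<ominus> barycenter \<xi>))\<^sup>2)
      = (\<Sum>k\<in>V. \<Sum>j\<in>J. (avg (x k) (src j) - mean (x k))\<^sup>2)"
    unfolding 1 by (rule sum.swap)
  also have "\<dots> \<le> (\<Sum>k\<in>V. \<epsilon>\<^sup>2 * (\<Sum>j\<in>J. (x k (src j) - mean (x k))\<^sup>2))"
    using contracts unfolding contracts_def by (intro sum_mono) blast
  also have "\<dots> = \<epsilon>\<^sup>2 * (\<Sum>j\<in>J. \<Sum>k\<in>V. (x k (src j) - mean (x k))\<^sup>2)"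
    unfolding sum_distrib_left[symmetric] by (subst sum.swap) simp
  also have "\<dots> = \<epsilon>\<^sup>2 * (\<Sum>j\<in>J. (vnorm H (f \<xi> (src j) \<ominus> barycenter \<xi>))\<^sup>2)"
    by (simp add: 2)
  finally have "L2_set (\<lambda>j. vnorm H (W \<xi> (src j) \<ominus> barycenter \<xi>)) J
    \<le> sqrt (\<epsilon>\<^sup>2 * (\<Sum>j\<in>J. (vnorm H (f \<xi> (src j) \<ominus> barycenter \<xi>))\<^sup>2))"
    unfolding L2_set_def by simp
  then show ?thesis using \<epsilon> by (simp add: L2_set_def real_sqrt_mult)
qed

text \<open>The left side S bounds itself: S \<le> c \<epsilon> (energy + S), so c \<epsilon> \<le>
  1/5 yields S \<le> energy / 4. The factor \<open>c\<close> is paid when \<open>N\<close> is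
  replaced by the Hilbert norm; the way back is free.\<close>

lemma W_minus_barycenter_le:
  "L2_set (\<lambda>j. N (W \<xi> (src j) \<ominus> barycenter \<xi>)) J \<le> energy \<xi> / 4" (is "?S \<le> _")
proof -
  have "?S \<le> L2_set (\<lambda>j. c * vnorm H (W \<xi> (src j) \<ominus> barycenter \<xi>)) J"
    by (intro L2_set_mono N_le N_nonneg) auto
  also have "\<dots> = c * L2_set (\<lambda>j. vnorm H (W \<xi> (src j) \<ominus> barycenter \<xi>)) J"
    using c by (intro L2_set_right_distrib[symmetric]) simp
  also have "\<dots> \<le> c * (\<epsilon> * L2_set (\<lambda>j. vnorm H (f \<xi> (src j) \<ominus> barycenter \<xi>)) J)"
    using c by (intro mult_left_mono W_contraction) simp
  also have "\<dots> = (c * \<epsilon>) * L2_set (\<lambda>j. vnorm H (f \<xi> (src j) \<ominus> barycenter \<xi>)) J" by simp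
  also have "\<dots> \<le> 1 / 5 * L2_set (\<lambda>j. vnorm H (f \<xi> (src j) \<ominus> barycenter \<xi>)) J"
    by (intro mult_right_mono c\<epsilon>) simp
  also have "\<dots> \<le> 1 / 5 * L2_set (\<lambda>j. N (f \<xi> (src j) \<ominus> W \<xi> (src j)) + N (W \<xi> (src j) \<ominus> barycenter \<xi>)) J"
  proof (intro mult_left_mono L2_set_mono)
    fix j assume j: "j \<in> J"
    have "vnorm H (f \<xi> (src j) \<ominus> barycenter \<xi>) \<le> N (f \<xi> (src j) \<ominus> barycenter \<xi>)"
      using j by (intro vnorm_le_N) (auto simp: src_in)
    also have "\<dots> \<le> N (f \<xi> (src j) \<ominus> W \<xi> (src j)) + N (W \<xi> (src j) \<ominus> barycenter \<xi>)"
      using j by (intro N_diff_triangle) (auto simp: src_in)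
    finally show "vnorm H (f \<xi> (src j) \<ominus> barycenter \<xi>)
      \<le> N (f \<xi> (src j) \<ominus> W \<xi> (src j)) + N (W \<xi> (src j) \<ominus> barycenter \<xi>)" .
    show "0 \<le> vnorm H (f \<xi> (src j) \<ominus> barycenter \<xi>)" using j by (intro vnorm_ge_zero) (auto simp: src_in)
  qed simp
  also have "\<dots> \<le> 1 / 5 * (L2_set (\<lambda>j. N (f \<xi> (src j) \<ominus> W \<xi> (src j))) J + ?S)"
    by (intro mult_left_mono L2_set_triangle_ineq) simp
  also have "\<dots> \<le> 1 / 5 * (energy \<xi> + ?S)"
    by (intro mult_left_mono add_right_mono f_minus_W_le) simp
  finally show ?thesis by simp
qed

text \<open>By \<open>pi_W\<close> the displacement of the barycenter b by s is the sum of \<pi> s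
  (b - W (s^-1)) and W s - b. In \<open>N\<close> the first is at most the deviation at the inverse
  letter, and each part contributes at most a quarter of the energy.\<close>

lemma energy_barycenter_le: "energy (barycenter \<xi>) \<le> energy \<xi> / 2"
proof -
  let ?b = "barycenter \<xi>"
  have "energy ?b = L2_set (\<lambda>j. N (\<pi> (g (src j)) ?b \<ominus> ?b)) J"
    unfolding energy_def f_def by (rule L2_set_lbl_eq_src)
  also have "\<dots> \<le> L2_set (\<lambda>j. N (W \<xi> (src (\<tau> j)) \<ominus> ?b) + N (W \<xi> (src j) \<ominus> ?b)) J"
  proof (intro L2_set_mono)
    fix j assume j: "j \<in> J"
    then have s: "src j \<in> V" and gs: "g (src j) \<in> carrier G" by (simp_all add: src_in g_in)
    have "N (\<pi> (g (src j)) ?b \<ominus> ?b)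
        \<le> N (\<pi> (g (src j)) ?b \<ominus> W \<xi> (src j)) + N (W \<xi> (src j) \<ominus> ?b)"
      using gs by (intro N_diff_triangle) auto
    also have "\<pi> (g (src j)) ?b \<ominus> W \<xi> (src j) = \<pi> (g (src j)) (?b \<ominus> W \<xi> (\<iota> (src j)))"
      using gs s by (simp add: pi_diff pi_W)
    also have "N \<dots> \<le> N (?b \<ominus> W \<xi> (\<iota> (src j)))"
      using gs by (intro N_pi_le) auto
    also have "\<dots> = N (W \<xi> (src (\<tau> j)) \<ominus> ?b)"
      using j by (simp add: src_\<tau> N_minus_commute)
    finally show "N (\<pi> (g (src j)) ?b \<ominus> ?b) \<le> N (W \<xi> (src (\<tau> j)) \<ominus> ?b) + N (W \<xi> (src j) \<ominus> ?b)" by simp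
    show "0 \<le> N (\<pi> (g (src j)) ?b \<ominus> ?b)" using gs by (intro N_nonneg) auto
  qed
  also have "\<dots> \<le> L2_set (\<lambda>j. N (W \<xi> (src (\<tau> j)) \<ominus> ?b)) J + L2_set (\<lambda>j. N (W \<xi> (src j) \<ominus> ?b)) J"
    by (rule L2_set_triangle_ineq)
  also have "L2_set (\<lambda>j. N (W \<xi> (src (\<tau> j)) \<ominus> ?b)) J = L2_set (\<lambda>j. N (W \<xi> (src j) \<ominus> ?b)) J"
    unfolding L2_set_def
    using sum.reindex_bij_betw[OF \<tau>, of "\<lambda>j. (N (W \<xi> (src j) \<ominus> ?b))\<^sup>2"] by simp
  finally show ?thesis using W_minus_barycenter_le by linarith
qed

lemma N_f_le_energy: "s \<in> V \<Longrightarrow> N (f \<xi> s \<ominus> \<xi>) \<le> energy \<xi>"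
proof -
  assume "s \<in> V"
  then obtain j where j: "j \<in> J" "lbl j = s" using lbl_onto by blast
  then have "N (f \<xi> (lbl j) \<ominus> \<xi>) \<le> energy \<xi>"
    unfolding energy_def
    by (intro member_le_L2_set[OF finite_J j(1), of "\<lambda>j. N (f \<xi> (lbl j) \<ominus> \<xi>)"]) 
  then show ?thesis using j by simp
qed

lemma N_barycenter_minus_le: "N (barycenter \<xi> \<ominus> \<xi>) \<le> energy \<xi>"
proof -
  define n where "n = real (card J)"
  have n: "n > 0" using card_J_pos by (simp add: n_def)
  have "\<xi> = lincomb (\<lambda>_. 1 / n) (\<lambda>_. \<xi>) J"
    using \<xi> finite_J J_nonempty n smult_one[OF \<xi>] by (simp add: lincomb_const n_def)
  then have "barycenter \<xi> \<ominus> \<xi> = barycenter \<xi> \<ominus> lincomb (\<lambda>_. 1 / n) (\<lambda>_. \<xi>) J" by simp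
  also have "\<dots> = lincomb (\<lambda>_. 1 / n) (\<lambda>j. f \<xi> (tgt j) \<ominus> \<xi>) J"
    unfolding barycenter_def n_def using finite_J f_tgt_in \<xi> by (intro lincomb_diff[symmetric]) auto
  finally have "N (barycenter \<xi> \<ominus> \<xi>) \<le> (\<Sum>j\<in>J. \<bar>1 / n\<bar> * N (f \<xi> (tgt j) \<ominus> \<xi>))"
    using N_lincomb_le[OF finite_J, of "\<lambda>j. f \<xi> (tgt j) \<ominus> \<xi>" "\<lambda>_. 1 / n"] \<xi> by (simp add: Pi_iff tgt_in)
  also have "\<dots> \<le> (\<Sum>j\<in>J. 1 / n * energy \<xi>)"
    using n by (intro sum_mono mult_mono N_f_le_energy) (auto simp: tgt_in intro!: N_nonneg \<xi>)
  also have "\<dots> = energy \<xi>" using n by (simp add: n_def)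
  finally show ?thesis .
qed

end

section \<open>Iteration and the invariant vector\<close>

lemma iterate_in: "\<xi> \<in> carrier H \<Longrightarrow> (barycenter ^^ k) \<xi> \<in> carrier H"
  by (induction k) simp_all

lemma energy_iterate_le: "\<xi> \<in> carrier H \<Longrightarrow> energy ((barycenter ^^ k) \<xi>) \<le> energy \<xi> * (1 / 2) ^ k"
proof (induction k)
  case (Suc k)
  then show ?case using energy_barycenter_le[OF iterate_in[OF Suc.prems], of k] by simp
qed simp

lemma N_iterate_diff_le:
  assumes \<xi>: "\<xi> \<in> carrier H"
  shows "N ((barycenter ^^ (k + i)) \<xi> \<ominus> (barycenter ^^ k) \<xi>) \<le> 2 * energy \<xi> * (1 / 2) ^ k"
proof -
  let ?x = "\<lambda>k. (barycenter ^^ k) \<xi>"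
  \<comment> \<open>Keeping the subtracted tail of the geometric series makes the induction
    close.\<close>
  have "N (?x (k + i) \<ominus> ?x k) \<le> 2 * energy \<xi> * ((1 / 2) ^ k - (1 / 2) ^ (k + i))"
  proof (induction i)
    case 0
    have "?x k \<ominus> ?x k = \<zero>" using iterate_in[OF \<xi>] by (simp add: minus_eq_zero)
    then show ?case using N_le[of "\<zero>"] vnorm_eq_zero[of "\<zero>"] by simp
  next
    case (Suc i)
    have "N (?x (k + Suc i) \<ominus> ?x k) \<le> N (?x (k + Suc i) \<ominus> ?x (k + i)) + N (?x (k + i) \<ominus> ?x k)"
      by (intro N_diff_triangle iterate_in \<xi>)
    also have "N (?x (k + Suc i) \<ominus> ?x (k + i)) \<le> energy \<xi> * (1 / 2) ^ (k + i)"
      using order_trans[OF N_barycenter_minus_le energy_iterate_le[OF \<xi>], OF iterate_in[OF \<xi>]] by simp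
    finally show ?case using Suc by (simp add: algebra_simps)
  qed
  also have "\<dots> \<le> 2 * energy \<xi> * (1 / 2) ^ k"
    using energy_nonneg[OF \<xi>] by (intro mult_left_mono) auto
  finally show ?thesis .
qed

lemma has_limit:
  assumes \<xi>: "\<xi> \<in> carrier H"
  obtains l where "l \<in> carrier H" "(\<lambda>k. vnorm H ((barycenter ^^ k) \<xi> \<ominus> l)) \<longlonglongrightarrow> 0"
proof -
  let ?x = "\<lambda>k. (barycenter ^^ k) \<xi>"
  have dist: "vdist H (?x m) (?x n) \<le> 2 * energy \<xi> * (1 / 2) ^ k" if "k \<le> m" "k \<le> n" for k m n
  proof -
    have *: "vdist H (?x n) (?x m) \<le> 2 * energy \<xi> * (1 / 2) ^ k" if "m \<le> n" "k \<le> m" for m n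
    proof -
      have "vdist H (?x n) (?x m) \<le> N (?x (m + (n - m)) \<ominus> ?x m)"
        using that iterate_in[OF \<xi>] by (simp add: vdist_def vnorm_le_N)
      also have "\<dots> \<le> 2 * energy \<xi> * (1 / 2) ^ m" by (rule N_iterate_diff_le[OF \<xi>])
      also have "\<dots> \<le> 2 * energy \<xi> * (1 / 2) ^ k"
        using that energy_nonneg[OF \<xi>] by (intro mult_left_mono power_decreasing) auto
      finally show ?thesis .
    qed
    show ?thesis using *[of m n] *[of n m] that Met.commute[of "?x m" "?x n"] by (cases "m \<le> n") auto
  qed
  have lim: "(\<lambda>k. 2 * energy \<xi> * (1 / 2) ^ k) \<longlonglongrightarrow> 2 * energy \<xi> * 0"
    by (intro tendsto_intros LIMSEQ_realpow_zero) auto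
  have "Met.MCauchy ?x"
    unfolding Met.MCauchy_def
  proof (intro conjI allI impI)
    show "range ?x \<subseteq> carrier H" using iterate_in[OF \<xi>] by auto
    fix e :: real assume "e > 0"
    then have "\<forall>\<^sub>F k in sequentially. 2 * energy \<xi> * (1 / 2) ^ k < e"
      using order_tendstoD(2)[OF lim] by simp
    then obtain k where "2 * energy \<xi> * (1 / 2) ^ k < e" by (auto simp: eventually_sequentially)
    then show "\<exists>N. \<forall>n n'. N \<le> n \<longrightarrow> N \<le> n' \<longrightarrow> vdist H (?x n) (?x n') < e"
      using dist by (meson le_less_trans)
  qed
  then obtain l where l: "limitin Met.mtopology ?x l sequentially"
    using complete unfolding Met.mcomplete_def by blast
  have l_in: "l \<in> carrier H" using l by (simp add: Met.limitin_metric)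
  moreover have "(\<lambda>k. vnorm H (?x k \<ominus> l)) \<longlonglongrightarrow> 0"
  proof (rule LIMSEQ_I)
    fix e :: real assume "e > 0"
    then have "\<forall>\<^sub>F k in sequentially. ?x k \<in> carrier H \<and> vdist H (?x k) l < e"
      using l by (simp add: Met.limitin_metric)
    then show "\<exists>k0. \<forall>k\<ge>k0. norm (vnorm H (?x k \<ominus> l) - 0) < e"
      using l_in iterate_in[OF \<xi>] by (auto simp: eventually_sequentially vdist_def vnorm_ge_zero)
  qed
  ultimately show thesis by (rule that)
qed

lemma invariant_if_generators:
  assumes l: "l \<in> carrier H" and inv: "\<And>s. s \<in> V \<Longrightarrow> \<pi> (g s) l = l" and x: "x \<in> carrier G"
  shows "\<pi> x l = l"
proof -
  have "carrier G \<subseteq> {x. x \<in> carrier G \<longrightarrow> \<pi> x l = l}"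
    by (rule generates) (auto simp: pi_one l pi_mult g_in inv)
  then show ?thesis using x by auto
qed

text \<open>The iterates of the barycenter converge while their displacements tend to 0, so the
  limit is fixed by the generators; its distance from \<xi> is bounded by a geometric series of
  energies.\<close>

lemma invariant_vector_near:
  assumes \<xi>: "\<xi> \<in> carrier H"
  obtains l where "l \<in> carrier H" "\<And>x. x \<in> carrier G \<Longrightarrow> \<pi> x l = l" "vnorm H (\<xi> \<ominus> l) \<le> 2 * energy \<xi>"
proof -
  let ?x = "\<lambda>k. (barycenter ^^ k) \<xi>"
  obtain l where l: "l \<in> carrier H" and lim: "(\<lambda>k. vnorm H (?x k \<ominus> l)) \<longlonglongrightarrow> 0"
    using has_limit[OF \<xi>] .
  have x: "?x k \<in> carrier H" for k by (rule iterate_in[OF \<xi>])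
  have half: "(\<lambda>k. energy \<xi> * (1 / 2) ^ k) \<longlonglongrightarrow> energy \<xi> * 0"
    by (intro tendsto_intros LIMSEQ_realpow_zero) auto
  have "\<pi> (g s) l = l" if s: "s \<in> V" for s
  proof -
    have gs: "g s \<in> carrier G" using s by (rule g_in)
    have "vnorm H (\<pi> (g s) l \<ominus> l) \<le> c * vnorm H (?x k \<ominus> l) + energy \<xi> * (1 / 2) ^ k + vnorm H (?x k \<ominus> l)" for k
    proof -
      have "vnorm H (\<pi> (g s) l \<ominus> l) \<le> vnorm H (\<pi> (g s) l \<ominus> \<pi> (g s) (?x k)) + vnorm H (\<pi> (g s) (?x k) \<ominus> l)"
        using vnorm_triangle minus_add_minus[of "\<pi> (g s) l" "\<pi> (g s) (?x k)" l] l x gs by simp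
      also have "\<pi> (g s) l \<ominus> \<pi> (g s) (?x k) = \<pi> (g s) (l \<ominus> ?x k)" using l x gs by (simp add: pi_diff)
      also have "vnorm H \<dots> \<le> c * vnorm H (l \<ominus> ?x k)" using l x gs by (intro vnorm_pi_le) auto
      also have "vnorm H (l \<ominus> ?x k) = vnorm H (?x k \<ominus> l)" using l x by (rule vnorm_minus_commute)
      also have "vnorm H (\<pi> (g s) (?x k) \<ominus> l)
          \<le> vnorm H (\<pi> (g s) (?x k) \<ominus> ?x k) + vnorm H (?x k \<ominus> l)"
        using vnorm_triangle minus_add_minus[of "\<pi> (g s) (?x k)" "?x k" l] l x gs by simp
      also have "vnorm H (\<pi> (g s) (?x k) \<ominus> ?x k) \<le> N (f (?x k) s \<ominus> ?x k)"
        using x gs by (simp add: f_def vnorm_le_N)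
      also have "\<dots> \<le> energy \<xi> * (1 / 2) ^ k"
        using N_f_le_energy[OF x s] energy_iterate_le[OF \<xi>] by (rule order_trans)
      finally show ?thesis by simp
    qed
    moreover have "(\<lambda>k. c * vnorm H (?x k \<ominus> l) + energy \<xi> * (1 / 2) ^ k + vnorm H (?x k \<ominus> l)) \<longlonglongrightarrow> c * 0 + energy \<xi> * 0 + 0"
      by (intro tendsto_add tendsto_mult tendsto_const lim half[unfolded tendsto_mult] LIMSEQ_realpow_zero) auto
    ultimately have "vnorm H (\<pi> (g s) l \<ominus> l) \<le> c * 0 + energy \<xi> * 0 + 0"
      by (intro LIMSEQ_le_const) auto
    then have "vnorm H (\<pi> (g s) l \<ominus> l) = 0"
      using vnorm_ge_zero[of "\<pi> (g s) l \<ominus> l"] l gs by simp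
    then show ?thesis using l gs by (simp add: vnorm_eq_zero minus_eq_zero)
  qed
  then have inv: "\<pi> y l = l" if "y \<in> carrier G" for y using invariant_if_generators[OF l _ that] by blast
  have "vnorm H (\<xi> \<ominus> l) \<le> 2 * energy \<xi> + vnorm H (?x k \<ominus> l)" for k
  proof -
    have "vnorm H (\<xi> \<ominus> l) \<le> vnorm H (\<xi> \<ominus> ?x k) + vnorm H (?x k \<ominus> l)"
      using vnorm_triangle[of "\<xi> \<ominus> ?x k" "?x k \<ominus> l"] minus_add_minus[of \<xi> "?x k" l] l x \<xi> by simp
    also have "vnorm H (\<xi> \<ominus> ?x k) = vnorm H (?x k \<ominus> \<xi>)" using \<xi> x by (rule vnorm_minus_commute)
    also have "\<dots> \<le> N (?x k \<ominus> \<xi>)" using \<xi> x by (intro vnorm_le_N) auto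
    also have "\<dots> \<le> 2 * energy \<xi>" using N_iterate_diff_le[OF \<xi>, of 0 k] by simp
    finally show ?thesis by simp
  qed
  moreover have "(\<lambda>k. 2 * energy \<xi> + vnorm H (?x k \<ominus> l)) \<longlonglongrightarrow> 2 * energy \<xi> + 0"
    by (intro tendsto_add tendsto_const lim)
  ultimately have "vnorm H (\<xi> \<ominus> l) \<le> 2 * energy \<xi> + 0" by (intro LIMSEQ_le_const) auto
  then show thesis using that[OF l inv] by simp
qed

lemma nonzero_invariant_vector:
  assumes ai: "almost_has_invariant_vectors G H \<pi>"
  shows "has_nonzero_invariant_vector G H \<pi>"
proof -
  \<comment> \<open>Chosen so that the energy of a \<delta>-invariant vector is at most a quarter of
    its norm; an invariant vector within twice the energy is then nonzero.\<close>
  define \<delta> where "\<delta> = 1 / (4 * c * (real (card J) + 1))"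
  have \<delta>: "\<delta> > 0" using c by (simp add: \<delta>_def)
  have "g ` V \<subseteq> carrier G \<and> finite (g ` V) \<and> \<delta> > 0" using g_in finite_V \<delta> by auto
  then have "\<exists>\<xi>\<in>carrier H. \<forall>s\<in>g ` V. vnorm H (\<pi> s \<xi> \<ominus> \<xi>) < \<delta> * vnorm H \<xi>"
    using ai unfolding almost_has_invariant_vectors_def by (elim allE[of _ "g ` V"] allE[of _ \<delta>] impE) auto
  then obtain \<xi> where \<xi>: "\<xi> \<in> carrier H"
    and small: "\<And>s. s \<in> V \<Longrightarrow> vnorm H (\<pi> (g s) \<xi> \<ominus> \<xi>) < \<delta> * vnorm H \<xi>"
    by auto
  \<comment> \<open>The strict inequality at a single letter already excludes \<xi> = 0.\<close>
  obtain s where s: "s \<in> V" using J_nonempty src_in by blast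
  have "0 \<le> vnorm H (\<pi> (g s) \<xi> \<ominus> \<xi>)" using \<xi> s g_in by (intro vnorm_ge_zero) auto
  then have "0 < \<delta> * vnorm H \<xi>" using small[OF s] by linarith
  then have pos: "vnorm H \<xi> > 0" using \<delta> by (simp add: zero_less_mult_iff)
  have "energy \<xi> \<le> (\<Sum>j\<in>J. N (f \<xi> (lbl j) \<ominus> \<xi>))"
    unfolding energy_def by (rule L2_set_le_sum) (auto intro!: N_nonneg simp: \<xi> lbl_in)
  also have "\<dots> \<le> (\<Sum>j\<in>J. c * (\<delta> * vnorm H \<xi>))"
  proof (rule sum_mono)
    fix j assume j: "j \<in> J"
    have "N (f \<xi> (lbl j) \<ominus> \<xi>) \<le> c * vnorm H (f \<xi> (lbl j) \<ominus> \<xi>)"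
      using j \<xi> by (intro N_le) (simp add: lbl_in)
    also have "\<dots> \<le> c * (\<delta> * vnorm H \<xi>)"
      using small[OF lbl_in[OF j]] c by (intro mult_left_mono) (simp_all add: f_def)
    finally show "N (f \<xi> (lbl j) \<ominus> \<xi>) \<le> c * (\<delta> * vnorm H \<xi>)" .
  qed
  also have "\<dots> = real (card J) * (c * (\<delta> * vnorm H \<xi>))" by simp
  also have "\<dots> \<le> (real (card J) + 1) * (c * (\<delta> * vnorm H \<xi>))"
    using pos c \<delta> by (intro mult_right_mono mult_nonneg_nonneg) auto
  also have "\<dots> = (c * (real (card J) + 1) * \<delta>) * vnorm H \<xi>" by (simp only: mult_ac)
  also have "c * (real (card J) + 1) * \<delta> = 1 / 4"
  proof -
    have "c * (real (card J) + 1) \<noteq> 0" using c by (simp add: add_nonneg_eq_0_iff)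
    then show ?thesis unfolding \<delta>_def by (simp add: mult.assoc)
  qed
  finally have energy: "2 * energy \<xi> < vnorm H \<xi>" using pos by simp
  obtain l where l: "l \<in> carrier H" "\<And>x. x \<in> carrier G \<Longrightarrow> \<pi> x l = l" "vnorm H (\<xi> \<ominus> l) \<le> 2 * energy \<xi>"
    by (rule invariant_vector_near[OF \<xi>]) blast
  have "l \<noteq> \<zero>"
  proof
    assume l0: "l = \<zero>"
    have inv0: "\<ominus> \<zero> = \<zero>" by (rule M.minus_equality) simp_all
    have "\<xi> \<ominus> l = \<xi>" unfolding l0 M.minus_eq inv0 using \<xi> by (rule M.r_zero)
    then have "vnorm H (\<xi> \<ominus> l) = vnorm H \<xi>" by simp
    then show False using l(3) energy by simp
  qed
  then show ?thesis unfolding has_nonzero_invariant_vector_def using l by blast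
qed

end

lemma property_T_criterion:
  assumes "group G" and "triangle_family J V src tgt \<kappa> lbl \<tau> \<iota>"
    and g_in: "\<And>s. s \<in> V \<Longrightarrow> g s \<in> carrier G"
    and g_\<iota>: "\<And>s. s \<in> V \<Longrightarrow> g (\<iota> s) = inv\<^bsub>G\<^esub> (g s)"
    and g_mult: "\<And>j. j \<in> J \<Longrightarrow> g (src j) \<otimes>\<^bsub>G\<^esub> g (lbl j) = g (tgt j)"
    and generates: "\<And>A. \<one>\<^bsub>G\<^esub> \<in> A \<Longrightarrow> (\<And>s x. s \<in> V \<Longrightarrow> x \<in> A \<Longrightarrow> x \<in> carrier G \<Longrightarrow> g s \<otimes>\<^bsub>G\<^esub> x \<in> A)
      \<Longrightarrow> carrier G \<subseteq> A"
    and contracts: "edge_family.contracts J src tgt \<epsilon>" and "\<epsilon> \<ge> 0" "c \<ge> 1" "c * \<epsilon> \<le> 1 / 5"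
  shows "property_T TYPE('v) c G"
  unfolding property_T_def
proof (intro allI impI)
  fix H :: "'v inner_space" and \<pi>
  assume rep: "uniformly_bounded_rep c G H \<pi>" and ai: "almost_has_invariant_vectors G H \<pi>"
  interpret G: group G by fact
  interpret complex_hilbert_space H using rep by (simp add: uniformly_bounded_rep_def)
  interpret triangle_family J V src tgt \<kappa> lbl \<tau> \<iota> by fact
  interpret triangle_representation G H c \<pi> J V src tgt lbl \<kappa> \<tau> \<iota> g \<epsilon>
    by unfold_locales (fact rep g_in g_\<iota> g_mult generates contracts \<open>\<epsilon> \<ge> 0\<close> \<open>c \<ge> 1\<close> \<open>c * \<epsilon> \<le> 1 / 5\<close>)+
  show "has_nonzero_invariant_vector G H \<pi>" by (rule nonzero_invariant_vector[OF ai])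
qed

section \<open>Relators of length three\<close>

definition letters :: "nat \<Rightarrow> (nat \<times> bool) set"
  where "letters n = {..<n} \<times> UNIV"

lemma finite_letters: "finite (letters n)"
  by (simp add: letters_def)

lemma card_letters: "card (letters n) = 2 * n"
  by (simp add: letters_def card_cartesian_product)

lemma inv_letter_inv_letter [simp]: "inv_letter (inv_letter x) = x"
  by (simp add: inv_letter_def)

lemma inv_letter_in_letters [simp]: "inv_letter x \<in> letters n \<longleftrightarrow> x \<in> letters n"
  by (auto simp: inv_letter_def letters_def mem_Times_iff)

lemma inv_letter_neq [simp]: "inv_letter x \<noteq> x" "x \<noteq> inv_letter x"
  by (auto simp: inv_letter_def prod_eq_iff)

lemma inv_letter_eq_iff: "inv_letter x = y \<longleftrightarrow> x = inv_letter y"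
  by auto

lemma triple_in_triangular_words:
  "[x, y, z] \<in> triangular_words n \<longleftrightarrow> x \<in> letters n \<and> y \<in> letters n \<and> z \<in> letters n
    \<and> y \<noteq> inv_letter x \<and> z \<noteq> inv_letter y \<and> x \<noteq> inv_letter z"
  by (auto simp: triangular_words_def words_def letters_def cyclically_reduced_triple)

lemma triangular_word_cases:
  assumes "r \<in> triangular_words n"
  obtains x y z where "r = [x, y, z]"
proof -
  have "length r = 3" using assms by (simp add: triangular_words_def)
  then show ?thesis using that unfolding numeral_3_eq_3 length_Suc_conv length_0_conv by blast
qed

lemma nth_in_letters: "r \<in> triangular_words n \<Longrightarrow> i < 3 \<Longrightarrow> r ! i \<in> letters n"
  by (auto simp: triangular_words_def words_def letters_def in_lists_conv_set dest!: nth_mem)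

text \<open>In a relator with cyclic permutation \<open>a b c\<close>, where \<open>a\<close> is the letter at position \<open>i\<close>, the
  index \<open>(r, i, e)\<close> stands for the relation \<open>a \<cdot> b = c\<^sup>-\<^sup>1\<close> if \<open>e\<close> is false and for
  \<open>a\<^sup>-\<^sup>1 \<cdot> c\<^sup>-\<^sup>1 = b\<close> if \<open>e\<close> is true.\<close>

type_synonym relation_index = "(nat \<times> bool) list \<times> nat \<times> bool"

definition relation_indices :: "(nat \<times> bool) list set \<Rightarrow> relation_index set"
  where "relation_indices R = R \<times> {..<3} \<times> UNIV"

definition rel_src :: "relation_index \<Rightarrow> nat \<times> bool"
  where "rel_src = (\<lambda>(r, i, e). if e then inv_letter (r ! i) else r ! i)"

definition rel_lbl :: "relation_index \<Rightarrow> nat \<times> bool"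
  where "rel_lbl = (\<lambda>(r, i, e). if e then inv_letter (r ! ((i + 2) mod 3)) else r ! ((i + 1) mod 3))"

definition rel_tgt :: "relation_index \<Rightarrow> nat \<times> bool"
  where "rel_tgt = (\<lambda>(r, i, e). if e then r ! ((i + 1) mod 3) else inv_letter (r ! ((i + 2) mod 3)))"

definition rel_flip :: "relation_index \<Rightarrow> relation_index"
  where "rel_flip = (\<lambda>(r, i, e). (r, i, \<not> e))"

text \<open>The role of \<open>\<kappa>\<close>: a b = c^-1 is turned into c^-1 b^-1 = a, the second
  relation at the position of c; this is the source of the cyclic shift.\<close>

definition rel_reverse :: "relation_index \<Rightarrow> relation_index"
  where "rel_reverse = (\<lambda>(r, i, e). if e then (r, (i + 1) mod 3, False) else (r, (i + 2) mod 3, True))"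

lemma less_3_cases: "(i :: nat) < 3 \<Longrightarrow> i = 0 \<or> i = 1 \<or> i = 2"
  by auto

lemma lessThan_3: "{..<3 :: nat} = {0, 1, 2}"
  by auto

lemma triangle_family_relations:
  assumes R: "R \<subseteq> triangular_words n" "R \<noteq> {}" and onto: "rel_src ` relation_indices R = letters n"
  shows "triangle_family (relation_indices R) (letters n) rel_src rel_tgt rel_reverse rel_lbl rel_flip inv_letter"
proof unfold_locales
  have "finite R" using R finite_triangular_words finite_subset by blast
  then show "finite (relation_indices R)" by (simp add: relation_indices_def)
  show "relation_indices R \<noteq> {}" using R by (auto simp: relation_indices_def lessThan_3)
  show "finite (letters n)" by (rule finite_letters)
  show "rel_src ` relation_indices R = letters n" by fact
  have "rel_reverse j \<in> relation_indices R \<and> rel_reverse (rel_reverse j) = j" if j: "j \<in> relation_indices R" for j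
  proof -
    obtain r i e where rie: "j = (r, i, e)" "r \<in> R" "i < 3"
      using j by (cases j rule: prod_cases3) (simp add: relation_indices_def)
    from less_3_cases[OF rie(3)] show ?thesis
      using rie(2) unfolding rie(1) by (cases e) (auto simp: relation_indices_def rel_reverse_def)
  qed
  then show "bij_betw rel_reverse (relation_indices R) (relation_indices R)"
    by (intro bij_betw_byWitness[where f' = rel_reverse]) auto
  show "bij_betw rel_flip (relation_indices R) (relation_indices R)"
    by (rule bij_betw_byWitness[where f' = rel_flip]) (auto simp: relation_indices_def rel_flip_def)
  fix j assume j: "j \<in> relation_indices R"
  then obtain r i e where rie: "j = (r, i, e)" "i < 3" by (auto simp: relation_indices_def)
  have "i = 0 \<or> i = 1 \<or> i = 2" using rie(2) by (rule less_3_cases)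
  then show "rel_src (rel_reverse j) = rel_tgt j" "rel_tgt (rel_reverse j) = rel_src j"
    unfolding rie(1) by (auto simp: rel_reverse_def rel_src_def rel_tgt_def numeral_2_eq_2)
  show "rel_src (rel_flip j) = inv_letter (rel_src j)" "rel_lbl (rel_flip j) = rel_tgt j"
    "rel_tgt (rel_flip j) = rel_lbl j"
    unfolding rie(1) by (auto simp: rel_flip_def rel_src_def rel_tgt_def rel_lbl_def)
qed auto

abbreviation edge_end :: "nat \<Rightarrow> (nat \<times> bool) list \<Rightarrow> nat \<times> bool"
  where "edge_end i r \<equiv> inv_letter (r ! ((i + 2) mod 3))"

text \<open>The second relation at a position is the reverse of the first one at the next position,
  so each of the three graphs with edges from \<open>r ! i\<close> to \<open>edge_end i r\<close> is
  counted twice.\<close>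

lemma sum_relations:
  fixes z :: "nat \<times> bool \<Rightarrow> real"
  assumes "finite R"
  shows "(\<Sum>j\<in>relation_indices R. z (rel_src j) * z (rel_tgt j))
    = 2 * (\<Sum>i<3. \<Sum>r\<in>R. z (r ! i) * z (edge_end i r))"
proof -
  have "(\<Sum>j\<in>relation_indices R. z (rel_src j) * z (rel_tgt j))
      = (\<Sum>r\<in>R. \<Sum>i<3. \<Sum>e\<in>UNIV. z (rel_src (r, i, e)) * z (rel_tgt (r, i, e)))"
    by (simp add: relation_indices_def sum.cartesian_product split_def)
  also have "\<dots> = (\<Sum>r\<in>R. 2 * (\<Sum>i<3. z (r ! i) * z (edge_end i r)))"
    by (simp add: lessThan_3 UNIV_bool rel_src_def rel_tgt_def numeral_2_eq_2 algebra_simps)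
  also have "\<dots> = 2 * (\<Sum>i<3. \<Sum>r\<in>R. z (r ! i) * z (edge_end i r))"
    by (subst sum.swap) (simp add: sum_distrib_left)
  finally show ?thesis .
qed

section \<open>Counting cyclically reduced words\<close>

text \<open>The letters y that complete s y t^-1 to a cyclically reduced word; that s and t differ
  says that t^-1 and s do not cancel around the end.\<close>

definition middle_letters :: "nat \<Rightarrow> nat \<times> bool \<Rightarrow> nat \<times> bool \<Rightarrow> (nat \<times> bool) set"
  where "middle_letters n s t = {y \<in> letters n. s \<noteq> t \<and> y \<noteq> inv_letter s \<and> y \<noteq> t}"

lemma card_fibre:
  assumes i: "i < 3" and st: "s \<in> letters n" "t \<in> letters n"
  shows "card {r \<in> triangular_words n. r ! i = s \<and> edge_end i r = t}
    = card (middle_letters n s t)"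
proof -
  have eq: "{r \<in> triangular_words n. r ! i = s \<and> edge_end i r = t} = h ` middle_letters n s t"
    if h: "\<And>y. h y \<in> triangular_words n \<longleftrightarrow> y \<in> middle_letters n s t"
      "\<And>y. h y ! i = s \<and> edge_end i (h y) = t"
      "\<And>r. r \<in> triangular_words n \<Longrightarrow> r ! i = s \<Longrightarrow> edge_end i r = t \<Longrightarrow> r = h (r ! ((i + 1) mod 3))" for h
  proof (intro subset_antisym subsetI)
    fix r assume r: "r \<in> {r \<in> triangular_words n. r ! i = s \<and> edge_end i r = t}"
    then have "r = h (r ! ((i + 1) mod 3))" using h(3) by blast
    then show "r \<in> h ` middle_letters n s t" using r h(1) by (metis (mono_tags, lifting) image_eqI mem_Collect_eq)
  next
    fix r assume "r \<in> h ` middle_letters n s t"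
    then obtain y where "y \<in> middle_letters n s t" "r = h y" by blast
    then show "r \<in> {r \<in> triangular_words n. r ! i = s \<and> edge_end i r = t}"
      using h(1)[of y] h(2)[of y] by blast
  qed
  consider "i = 0" | "i = 1" | "i = 2" using less_3_cases[OF i] by blast
  then show ?thesis
  proof cases
    case 1
    have "{r \<in> triangular_words n. r ! i = s \<and> edge_end i r = t} = (\<lambda>y. [s, y, inv_letter t]) ` middle_letters n s t"
    proof (rule eq)
      fix r assume "r \<in> triangular_words n" "r ! i = s" "edge_end i r = t"
      then show "r = [s, r ! ((i + 1) mod 3), inv_letter t]" by (elim triangular_word_cases) (auto simp: 1)
    qed (use 1 st in \<open>auto simp: triple_in_triangular_words middle_letters_def inv_letter_eq_iff\<close>)
    then show ?thesis by (simp add: card_image inj_on_def)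
  next
    case 2
    have "{r \<in> triangular_words n. r ! i = s \<and> edge_end i r = t} = (\<lambda>y. [inv_letter t, s, y]) ` middle_letters n s t"
    proof (rule eq)
      fix r assume "r \<in> triangular_words n" "r ! i = s" "edge_end i r = t"
      then show "r = [inv_letter t, s, r ! ((i + 1) mod 3)]" by (elim triangular_word_cases) (auto simp: 2)
    qed (use 2 st in \<open>auto simp: triple_in_triangular_words middle_letters_def inv_letter_eq_iff\<close>)
    then show ?thesis by (simp add: card_image inj_on_def)
  next
    case 3
    have "{r \<in> triangular_words n. r ! i = s \<and> edge_end i r = t} = (\<lambda>y. [y, inv_letter t, s]) ` middle_letters n s t"
    proof (rule eq)
      fix r assume "r \<in> triangular_words n" "r ! i = s" "edge_end i r = t"
      then show "r = [r ! ((i + 1) mod 3), inv_letter t, s]" by (elim triangular_word_cases) (auto simp: 3)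
    qed (use 3 st in \<open>auto simp: triple_in_triangular_words middle_letters_def inv_letter_eq_iff\<close>)
    then show ?thesis by (simp add: card_image inj_on_def)
  qed
qed

lemma card_middle_letters:
  assumes "s \<in> letters n" "t \<in> letters n"
  shows "real (card (middle_letters n s t)) = (if s = t then 0 else 2 * real n - 2 + (if t = inv_letter s then 1 else 0))"
proof (cases "s = t")
  case True
  then show ?thesis by (simp add: middle_letters_def)
next
  case False
  have "middle_letters n s t = letters n - {inv_letter s, t}" using False by (auto simp: middle_letters_def)
  then have "card (middle_letters n s t) = 2 * n - card {inv_letter s, t}"
    using assms by (simp add: card_Diff_subset card_letters)
  moreover have "n \<ge> 1" using assms by (auto simp: letters_def)
  ultimately show ?thesis using False by (cases "t = inv_letter s") (auto simp: of_nat_diff)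
qed

text \<open>The fibres have 2 n - 2 elements, except that they are empty on the diagonal and have
  one more element at t = s^-1. Both corrections are bounded by multiples of the sum of
  squares.\<close>

lemma sum_triangular_words:
  fixes z :: "nat \<times> bool \<Rightarrow> real"
  assumes i: "i < 3" and n: "n \<ge> 1"
  shows "\<bar>(\<Sum>r\<in>triangular_words n. z (r ! i) * z (edge_end i r)) - (2 * real n - 2) * (\<Sum>s\<in>letters n. z s)\<^sup>2\<bar>
    \<le> 2 * real n * (\<Sum>s\<in>letters n. (z s)\<^sup>2)"
proof -
  let ?V = "letters n"
  have "(\<Sum>r\<in>triangular_words n. z (r ! i) * z (edge_end i r))
      = (\<Sum>st\<in>?V \<times> ?V. \<Sum>r | r \<in> triangular_words n \<and> (r ! i, edge_end i r) = st. z (r ! i) * z (edge_end i r))"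
    by (rule sum.group[symmetric])
      (use i in \<open>auto simp: finite_triangular_words finite_letters nth_in_letters\<close>)
  also have "\<dots> = (\<Sum>st\<in>?V \<times> ?V. real (card (middle_letters n (fst st) (snd st))) * (z (fst st) * z (snd st)))"
  proof (rule sum.cong[OF HOL.refl])
    fix st assume "st \<in> ?V \<times> ?V"
    then have "card {r \<in> triangular_words n. r ! i = fst st \<and> edge_end i r = snd st} = card (middle_letters n (fst st) (snd st))"
      using i by (intro card_fibre) auto
    moreover have "(\<Sum>r | r \<in> triangular_words n \<and> (r ! i, edge_end i r) = st. z (r ! i) * z (edge_end i r))
        = (\<Sum>r | r \<in> triangular_words n \<and> r ! i = fst st \<and> edge_end i r = snd st. z (fst st) * z (snd st))"
      by (rule sum.cong) auto
    ultimately show "(\<Sum>r | r \<in> triangular_words n \<and> (r ! i, edge_end i r) = st. z (r ! i) * z (edge_end i r))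
        = real (card (middle_letters n (fst st) (snd st))) * (z (fst st) * z (snd st))" by simp
  qed
  also have "\<dots> = (\<Sum>s\<in>?V. \<Sum>t\<in>?V. real (card (middle_letters n s t)) * (z s * z t))"
    by (simp add: sum.cartesian_product split_def)
  also have "\<dots> = (\<Sum>s\<in>?V. \<Sum>t\<in>?V. (2 * real n - 2) * (z s * z t) - (if t = s then (2 * real n - 2) * (z s)\<^sup>2 else 0)
      + (if t = inv_letter s then z s * z (inv_letter s) else 0))"
    by (intro sum.cong HOL.refl) (auto simp: card_middle_letters power2_eq_square algebra_simps)
  also have "\<dots> = (2 * real n - 2) * (\<Sum>s\<in>?V. z s)\<^sup>2 - (2 * real n - 2) * (\<Sum>s\<in>?V. (z s)\<^sup>2) + (\<Sum>s\<in>?V. z s * z (inv_letter s))"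
  proof -
    have "(\<Sum>s\<in>?V. \<Sum>t\<in>?V. (2 * real n - 2) * (z s * z t)) = (2 * real n - 2) * (\<Sum>s\<in>?V. z s)\<^sup>2"
      unfolding power2_eq_square sum_product by (simp only: sum_distrib_left)
    then show ?thesis by (simp add: sum.distrib sum_subtractf finite_letters sum_distrib_left)
  qed
  finally have eq: "(\<Sum>r\<in>triangular_words n. z (r ! i) * z (edge_end i r)) - (2 * real n - 2) * (\<Sum>s\<in>?V. z s)\<^sup>2
      = (\<Sum>s\<in>?V. z s * z (inv_letter s)) - (2 * real n - 2) * (\<Sum>s\<in>?V. (z s)\<^sup>2)" by simp
  have "\<bar>\<Sum>s\<in>?V. z s * z (inv_letter s)\<bar> \<le> (\<Sum>s\<in>?V. ((z s)\<^sup>2 + (z (inv_letter s))\<^sup>2) / 2)"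
    using abs_mult_le_weighted[of 1] by (intro order_trans[OF sum_abs] sum_mono) simp
  also have "\<dots> = ((\<Sum>s\<in>?V. (z s)\<^sup>2) + (\<Sum>s\<in>?V. (z (inv_letter s))\<^sup>2)) / 2"
    by (simp add: sum.distrib flip: sum_divide_distrib)
  also have "(\<Sum>s\<in>?V. (z (inv_letter s))\<^sup>2) = (\<Sum>s\<in>?V. (z s)\<^sup>2)"
    by (rule sum.reindex_bij_witness[where i = inv_letter and j = inv_letter]) auto
  finally have "\<bar>\<Sum>s\<in>?V. z s * z (inv_letter s)\<bar> \<le> (\<Sum>s\<in>?V. (z s)\<^sup>2)" by simp
  moreover have "0 \<le> (2 * real n - 2) * (\<Sum>s\<in>?V. (z s)\<^sup>2)" using n by (intro mult_nonneg_nonneg sum_nonneg) auto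
  moreover have "(\<Sum>s\<in>?V. (z s)\<^sup>2) \<ge> 0" by (rule sum_nonneg) simp
  ultimately show ?thesis unfolding eq by (simp add: left_diff_distrib abs_le_iff)
qed

definition touching :: "nat \<Rightarrow> nat \<times> bool \<Rightarrow> (nat \<times> bool) list set"
  where "touching n s = {r \<in> triangular_words n. s \<in> set r \<or> inv_letter s \<in> set r}"

text \<open>Words avoiding s and its inverse are overcounted by keeping only the reducedness of the
  first two letters. The leading term becomes 16 n^2 instead of the true 24 n^2, which is still
  enough.\<close>

lemma card_touching_ge:
  assumes s: "s \<in> letters n"
  shows "real (card (touching n s)) \<ge> (2 * real n - 1) ^ 3 + 1 - (2 * real n - 2) * (2 * real n - 3) * (2 * real n - 2)"
proof -
  have n: "n \<ge> 1" using s by (auto simp: letters_def)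
  define Z where "Z = letters n - {s, inv_letter s}"
  have cZ: "card Z = 2 * n - 2" using s by (simp add: Z_def card_Diff_subset card_letters)
  have fZ: "finite Z" by (simp add: Z_def finite_letters)
  define P where "P = Sigma Z (\<lambda>x. (Z - {inv_letter x}) \<times> Z)"
  have fP: "finite P" using fZ by (simp add: P_def)
  have "triangular_words n - touching n s \<subseteq> (\<lambda>(x, y, z). [x, y, z]) ` P"
  proof
    fix r assume r: "r \<in> triangular_words n - touching n s"
    then obtain x y z where xyz: "r = [x, y, z]" by (auto elim: triangular_word_cases)
    have "(x, y, z) \<in> P"
      using r unfolding xyz by (auto simp: P_def Z_def touching_def triple_in_triangular_words)
    then show "r \<in> (\<lambda>(x, y, z). [x, y, z]) ` P" unfolding xyz by (rule rev_image_eqI) simp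
  qed
  then have "card (triangular_words n - touching n s) \<le> card P"
    using fP by (meson card_image_le card_mono finite_imageI order_trans)
  also have "card P = (\<Sum>x\<in>Z. card (Z - {inv_letter x}) * card Z)"
    unfolding P_def using fZ by (subst card_SigmaI) (auto simp: card_cartesian_product)
  also have "\<dots> = (\<Sum>x\<in>Z. (2 * n - 3) * (2 * n - 2))"
  proof (rule sum.cong[OF HOL.refl])
    fix x assume "x \<in> Z"
    then have "inv_letter x \<in> Z" by (auto simp: Z_def inv_letter_eq_iff)
    then show "card (Z - {inv_letter x}) * card Z = (2 * n - 3) * (2 * n - 2)" using fZ cZ by simp
  qed
  also have "\<dots> = (2 * n - 2) * ((2 * n - 3) * (2 * n - 2))" by (simp add: cZ)
  finally have "card (triangular_words n) - card (touching n s) \<le> (2 * n - 2) * ((2 * n - 3) * (2 * n - 2))"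
    using finite_triangular_words by (subst card_Diff_subset[symmetric]) (auto simp: touching_def)
  then have "real (card (triangular_words n)) \<le> real (card (touching n s)) + real ((2 * n - 2) * ((2 * n - 3) * (2 * n - 2)))"
    by linarith
  moreover have "real ((2 * n - 2) * ((2 * n - 3) * (2 * n - 2))) = (2 * real n - 2) * (2 * real n - 3) * (2 * real n - 2)"
  proof (cases "n = 1")
    case False
    then show ?thesis using n by (simp add: of_nat_diff)
  qed simp
  moreover have "real (card (triangular_words n)) = (2 * real n - 1) ^ 3 + 1"
    using n by (simp add: card_triangular_words of_nat_diff)
  ultimately show ?thesis by linarith
qed

lemma property_T_presented_group:
  fixes n :: nat and R :: "(nat \<times> bool) list set"
  assumes R: "R \<subseteq> triangular_words n" and n: "n \<ge> 1"
    and \<delta>: "\<delta> > 0" and degree: "\<And>s. s \<in> letters n \<Longrightarrow> real (card (R \<inter> touching n s)) \<ge> \<delta>"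
    and \<rho>: "\<rho> > 0"
    and form: "\<And>z. \<bar>(\<Sum>j\<in>relation_indices R. z (rel_src j) * z (rel_tgt j)) - \<rho> * (\<Sum>s\<in>letters n. z s)\<^sup>2\<bar>
      \<le> N * (\<Sum>s\<in>letters n. (z s)\<^sup>2)"
    and c: "c \<ge> 1" "c * (2 * N / \<delta>) \<le> 1 / 5"
  shows "property_T TYPE('v) c (presented_group {..<n} R)"
proof -
  have fR: "finite R" using R finite_triangular_words finite_subset by blast
  let ?J = "relation_indices R"
  have fJ: "finite ?J" using fR by (simp add: relation_indices_def)
  \<comment> \<open>A relator containing s or its inverse provides a relation with source s in
    either case, so counting relators bounds the degree from below.\<close>
  have degree': "\<delta> \<le> real (card {j \<in> ?J. rel_src j = s})" if s: "s \<in> letters n" for s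
  proof -
    have "R \<inter> touching n s \<subseteq> fst ` {j \<in> ?J. rel_src j = s}"
    proof
      fix r assume r: "r \<in> R \<inter> touching n s"
      then have "length r = 3" unfolding touching_def triangular_words_def by blast
      moreover have "s \<in> set r \<or> inv_letter s \<in> set r" using r unfolding touching_def by blast
      ultimately obtain i where i: "i < 3" "r ! i = s \<or> r ! i = inv_letter s"
        unfolding in_set_conv_nth by metis
      have "rel_src (r, i, r ! i \<noteq> s) = s" using i(2) by (auto simp: rel_src_def)
      then have "(r, i, r ! i \<noteq> s) \<in> {j \<in> ?J. rel_src j = s}"
        using r i(1) by (simp add: relation_indices_def)
      then show "r \<in> fst ` {j \<in> ?J. rel_src j = s}" by (rule rev_image_eqI) simp
    qed
    moreover have "finite {j \<in> ?J. rel_src j = s}" using fJ by simp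
    ultimately have "card (R \<inter> touching n s) \<le> card {j \<in> ?J. rel_src j = s}"
      using surj_card_le by blast
    then show ?thesis using degree[OF s] by linarith
  qed
  have onto: "rel_src ` ?J = letters n"
  proof (intro subset_antisym subsetI)
    fix s assume "s \<in> rel_src ` ?J"
    then obtain r i e where "r \<in> R" "i < 3" "s = rel_src (r, i, e)" by (auto simp: relation_indices_def)
    then show "s \<in> letters n" using R nth_in_letters[of r n i] by (auto simp: rel_src_def)
  next
    fix s assume s: "s \<in> letters n"
    have "{j \<in> ?J. rel_src j = s} \<noteq> {}"
    proof
      assume empty: "{j \<in> ?J. rel_src j = s} = {}"
      show False using degree'[OF s] \<delta> unfolding empty by simp
    qed
    then show "s \<in> rel_src ` ?J" by blast
  qed
  have "letters n \<noteq> {}" using n card_letters[of n] by (metis card.empty mult_is_0 not_one_le_zero zero_neq_numeral)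
  then have "R \<noteq> {}" using onto by (auto simp: relation_indices_def)
  note family = triangle_family_relations[OF R this onto]
  interpret triangle_family ?J "letters n" rel_src rel_tgt rel_reverse rel_lbl rel_flip inv_letter
    by (rule family)
  have contr: "contracts (2 * N / \<delta>)"
  proof (rule contractsI[OF \<rho> \<delta>])
    fix s assume "s \<in> letters n"
    then show "\<delta> \<le> deg s" using degree' by (simp add: deg_def)
  next
    fix z show "\<bar>(\<Sum>j\<in>?J. z (rel_src j) * z (rel_tgt j)) - \<rho> * (\<Sum>s\<in>letters n. z s)\<^sup>2\<bar> \<le> N * (\<Sum>s\<in>letters n. (z s)\<^sup>2)"
      by (rule form[of z])
  qed
  have N: "N \<ge> 0"
  proof -
    have "0 \<le> N * real (card (letters n))" using form[of "\<lambda>_. 1"] by (auto intro: order_trans)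
    then show ?thesis using n by (simp add: card_letters zero_le_mult_iff)
  qed
  define S where "S = {..<n}"
  interpret G: group "presented_group S R" by (rule group_presented_group)
  let ?G = "presented_group S R"
  define cl where "cl w = presentation_rel S R `` {w}" for w
  define g where "g s = cl [s]" for s
  have words: "[s] \<in> words S" if "s \<in> letters n" for s using that by (simp add: words_def letters_def S_def)
  have cl_in: "cl w \<in> carrier ?G" if "w \<in> words S" for w
    using that by (simp add: cl_def presented_group_def quotientI)
  have cl_mult: "cl u \<otimes>\<^bsub>?G\<^esub> cl v = cl (u @ v)" if "u \<in> words S" "v \<in> words S" for u v
    unfolding cl_def using that by (rule presented_group_mult)
  have cl_eq: "cl u = cl v" if "(u, v) \<in> presentation_rel S R" for u v
    unfolding cl_def by (rule equiv_class_eq[OF equiv_presentation_rel that])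
  have cl_one: "cl [] = \<one>\<^bsub>?G\<^esub>" by (simp add: cl_def presented_group_def)
  have g_in: "g s \<in> carrier ?G" if "s \<in> letters n" for s using words[OF that] by (simp add: g_def cl_in)
  have g_inv: "g (inv_letter s) = inv\<^bsub>?G\<^esub> (g s)" if s: "s \<in> letters n" for s
  proof (rule G.inv_equality[symmetric])
    have "g (inv_letter s) \<otimes>\<^bsub>?G\<^esub> g s = cl ([] @ [inv_letter s, inv_letter (inv_letter s)] @ [])"
      unfolding g_def using words s by (subst cl_mult) simp_all
    also have "\<dots> = cl ([] @ [])"
      by (rule cl_eq, rule presentation_rel.cancel) (use s in \<open>simp_all add: letters_def S_def mem_Times_iff inv_letter_def\<close>)
    finally show "g (inv_letter s) \<otimes>\<^bsub>?G\<^esub> g s = \<one>\<^bsub>?G\<^esub>" by (simp add: cl_one)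
  qed (use s g_in in auto)
  have relator: "g x \<otimes>\<^bsub>?G\<^esub> g y \<otimes>\<^bsub>?G\<^esub> g z = \<one>\<^bsub>?G\<^esub>" if r: "[x, y, z] \<in> R" for x y z
  proof -
    have xyz: "x \<in> letters n" "y \<in> letters n" "z \<in> letters n"
      using r R triple_in_triangular_words by blast+
    have "g x \<otimes>\<^bsub>?G\<^esub> g y \<otimes>\<^bsub>?G\<^esub> g z = cl ([x] @ [y]) \<otimes>\<^bsub>?G\<^esub> g z"
      unfolding g_def using words xyz by (simp only: cl_mult)
    also have "\<dots> = cl (([x] @ [y]) @ [z])"
    proof -
      have "[x] @ [y] \<in> words S" using words xyz by (simp only: words_append)
      then show ?thesis unfolding g_def using words[OF xyz(3)] by (rule cl_mult)
    qed
    also have "\<dots> = cl ([] @ [x, y, z] @ [])" by simp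
    also have "\<dots> = cl ([] @ [])"
      by (rule cl_eq, rule presentation_rel.relator)
        (use r xyz in \<open>simp_all add: words_def letters_def S_def\<close>)
    finally show ?thesis by (simp add: cl_one)
  qed
  have rotate: "B \<otimes>\<^bsub>?G\<^esub> C \<otimes>\<^bsub>?G\<^esub> A = \<one>\<^bsub>?G\<^esub>"
    if "A \<in> carrier ?G" "B \<in> carrier ?G" "C \<in> carrier ?G" "A \<otimes>\<^bsub>?G\<^esub> B \<otimes>\<^bsub>?G\<^esub> C = \<one>\<^bsub>?G\<^esub>" for A B C
    using that G.inv_comm[of A "B \<otimes>\<^bsub>?G\<^esub> C"] by (simp add: G.m_assoc)
  have solve: "A \<otimes>\<^bsub>?G\<^esub> B = inv\<^bsub>?G\<^esub> C" "inv\<^bsub>?G\<^esub> A \<otimes>\<^bsub>?G\<^esub> inv\<^bsub>?G\<^esub> C = B"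
    if "A \<in> carrier ?G" "B \<in> carrier ?G" "C \<in> carrier ?G" "A \<otimes>\<^bsub>?G\<^esub> B \<otimes>\<^bsub>?G\<^esub> C = \<one>\<^bsub>?G\<^esub>" for A B C
  proof -
    show AB: "A \<otimes>\<^bsub>?G\<^esub> B = inv\<^bsub>?G\<^esub> C" using that by (intro G.inv_equality[symmetric]) auto
    show "inv\<^bsub>?G\<^esub> A \<otimes>\<^bsub>?G\<^esub> inv\<^bsub>?G\<^esub> C = B"
      unfolding AB[symmetric] using that by (simp add: G.m_assoc[symmetric])
  qed
  have g_mult: "g (rel_src j) \<otimes>\<^bsub>?G\<^esub> g (rel_lbl j) = g (rel_tgt j)" if j: "j \<in> ?J" for j
  proof -
    obtain r i e where rie: "j = (r, i, e)" "r \<in> R" "i < 3"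
      using j by (cases j rule: prod_cases3) (simp add: relation_indices_def)
    obtain x y z where r: "r = [x, y, z]" using rie(2) R by (blast elim: triangular_word_cases)
    have xyz: "x \<in> letters n" "y \<in> letters n" "z \<in> letters n"
      using rie(2) r R triple_in_triangular_words by blast+
    note gxyz = g_in[OF xyz(1)] g_in[OF xyz(2)] g_in[OF xyz(3)]
    have rel1: "g x \<otimes>\<^bsub>?G\<^esub> g y \<otimes>\<^bsub>?G\<^esub> g z = \<one>\<^bsub>?G\<^esub>" using relator rie(2) r by simp
    have rel2: "g y \<otimes>\<^bsub>?G\<^esub> g z \<otimes>\<^bsub>?G\<^esub> g x = \<one>\<^bsub>?G\<^esub>" by (rule rotate[OF gxyz rel1])
    have rel3: "g z \<otimes>\<^bsub>?G\<^esub> g x \<otimes>\<^bsub>?G\<^esub> g y = \<one>\<^bsub>?G\<^esub>" by (rule rotate[OF gxyz(2,3,1) rel2])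
    from less_3_cases[OF rie(3)] show ?thesis
      unfolding rie(1) r
      using solve[OF gxyz rel1] solve[OF gxyz(2,3,1) rel2] solve[OF gxyz(3,1,2) rel3] xyz
      by (elim disjE; cases e; simp add: rel_src_def rel_lbl_def rel_tgt_def g_inv numeral_2_eq_2)
  qed
  have generates: "carrier ?G \<subseteq> A"
    if one: "\<one>\<^bsub>?G\<^esub> \<in> A" and step: "\<And>s x. s \<in> letters n \<Longrightarrow> x \<in> A \<Longrightarrow> x \<in> carrier ?G \<Longrightarrow> g s \<otimes>\<^bsub>?G\<^esub> x \<in> A" for A
  proof
    fix x assume "x \<in> carrier ?G"
    then obtain w where w: "w \<in> words S" "x = cl w" by (auto simp: presented_group_def quotient_def cl_def)
    have "cl w \<in> A" using w(1)
    proof (induction w)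
      case Nil
      then show ?case using one by (simp add: cl_one)
    next
      case (Cons s w)
      then have sw: "s \<in> letters n" "w \<in> words S" by (auto simp: words_def letters_def S_def)
      then have "g s \<otimes>\<^bsub>?G\<^esub> cl w \<in> A" using Cons.IH by (intro step) (auto simp: cl_in)
      then show ?case unfolding g_def using sw words by (simp add: cl_mult)
    qed
    then show "x \<in> A" using w by simp
  qed
  have "property_T TYPE('v) c ?G"
  proof (rule property_T_criterion[OF group_presented_group family g_in g_inv g_mult _ contr])
    show "2 * N / \<delta> \<ge> 0" using N \<delta> by simp
  qed (use c in simp_all, rule generates)
  then show ?thesis by (simp add: S_def)
qed

lemma c_ub_ge:
  assumes "\<And>c. c \<ge> 1 \<Longrightarrow> c < C \<Longrightarrow> property_T TYPE(nat \<Rightarrow> complex) c G"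
  shows "c_ub G \<ge> ereal C"
  unfolding c_ub_def
proof (rule INF_greatest)
  fix c assume "c \<in> {c. 1 \<le> c \<and> \<not> property_T TYPE(nat \<Rightarrow> complex) c G}"
  then have "\<not> c < C" using assms by blast
  then show "ereal C \<le> ereal c" by simp
qed

lemma card_triangular_words_real: "n \<ge> 1 \<Longrightarrow> real (card (triangular_words n)) = (2 * real n - 1) ^ 3 + 1"
  by (simp add: card_triangular_words of_nat_diff)

text \<open>The lower bound of \<open>card_touching_ge\<close> gives a ratio tending to 16/8 = 2;
  the slack down to 19/10 makes the estimate valid from n = 4 on.\<close>

lemma card_touching_ge_average:
  assumes s: "s \<in> letters n" and n: "n \<ge> 4"
  shows "19 / 10 * real (card (triangular_words n)) \<le> real n * real (card (touching n s))"
proof -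
  define k where "k = real n"
  have k: "k \<ge> 4" using n by (simp add: k_def)
  have "0 \<le> k * (8 / 10 * (k * (k - 4)) + 6 / 10)" using k by (intro mult_nonneg_nonneg add_nonneg_nonneg) auto
  also have "\<dots> = k * ((2 * k - 1) ^ 3 + 1 - (2 * k - 2) * (2 * k - 3) * (2 * k - 2)) - 19 / 10 * ((2 * k - 1) ^ 3 + 1)"
    by (simp add: power3_eq_cube algebra_simps)
  also have "\<dots> \<le> k * real (card (touching n s)) - 19 / 10 * ((2 * k - 1) ^ 3 + 1)"
    using card_touching_ge[OF s] k unfolding k_def by (intro diff_right_mono mult_left_mono) auto
  finally show ?thesis using n by (simp add: card_triangular_words_real k_def)
qed

section \<open>Random sets of relators\<close>

locale random_relators =
  fixes n m :: nat and x :: real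
  assumes n: "n \<ge> 4" and m_le_card: "m \<le> card (triangular_words n)"
    and x: "x \<ge> 5 / 4" and x6: "x ^ 6 = real m / real n"
begin

sublocale random_subset "triangular_words n" m
proof unfold_locales
  show "triangular_words n \<noteq> {}" using n card_triangular_words[of n] by auto
qed (use m_le_card finite_triangular_words in auto)

lemma m_eq: "real m = x ^ 6 * real n"
  using x6 n by (simp add: field_simps)

lemma p_eq: "p = x ^ 6 * real n / ((2 * real n - 1) ^ 3 + 1)"
  using n by (simp add: p_def m_eq card_triangular_words_real)

lemma card_bounds: "4 * real n ^ 3 \<le> (2 * real n - 1) ^ 3 + 1" "(2 * real n - 1) ^ 3 + 1 \<le> 8 * real n ^ 3"
proof -
  define k where "k = real n"
  have k: "k \<ge> 4" using n by (simp add: k_def)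
  have "0 \<le> k * (4 * (k * (k - 3)) + 6)" using k by (intro mult_nonneg_nonneg add_nonneg_nonneg) auto
  also have "\<dots> = (2 * k - 1) ^ 3 + 1 - 4 * k ^ 3" by (simp add: power3_eq_cube algebra_simps)
  finally show "4 * real n ^ 3 \<le> (2 * real n - 1) ^ 3 + 1" by (simp add: k_def)
  have "0 \<le> k * (12 * k - 6)" using k by (intro mult_nonneg_nonneg) auto
  also have "\<dots> = 8 * k ^ 3 - ((2 * k - 1) ^ 3 + 1)" by (simp add: power3_eq_cube algebra_simps)
  finally show "(2 * real n - 1) ^ 3 + 1 \<le> 8 * real n ^ 3" by (simp add: k_def)
qed

text \<open>The \<open>mean\<close> assumption of \<open>random_graph\<close>, with fibres of at
  most 2 n words and 2 n vertices; asymptotically it holds with a factor 2 to spare.\<close>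

lemma p_le: "p * (2 * real n) * (2 * real n) \<le> x ^ 6"
proof -
  have "p * (2 * real n) * (2 * real n) = x ^ 6 * (4 * real n ^ 3 / ((2 * real n - 1) ^ 3 + 1))"
    by (simp add: p_eq power3_eq_cube)
  also have "\<dots> \<le> x ^ 6 * 1"
  proof (rule mult_left_mono)
    have "0 < (2 * real n - 1) ^ 3 + 1" using n by (intro add_nonneg_pos zero_le_power) auto
    then show "4 * real n ^ 3 / ((2 * real n - 1) ^ 3 + 1) \<le> 1" using card_bounds(1) by simp
  qed (use x in simp)
  finally show ?thesis by simp
qed

lemma p_pos: "p > 0"
proof -
  have "real m > 0" using m_eq x n by simp
  then show ?thesis using card_T_pos by (simp add: p_def)
qed

text \<open>Serves to absorb the error p times 2 n of the full form, which is of order x^6 / n, into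
  x^5.\<close>

lemma x_le_n: "x \<le> real n"
proof -
  have "x ^ 6 * real n = real m" by (simp add: m_eq)
  also have "\<dots> \<le> 8 * real n ^ 3" using m_le_card card_bounds(2) n card_triangular_words_real[of n] by linarith
  also have "\<dots> = (8 * real n ^ 2) * real n" by (simp add: power2_eq_square power3_eq_cube)
  finally have "x ^ 6 \<le> 8 * real n ^ 2" using n by simp
  also have "8 \<le> real n ^ 4"
  proof -
    have "(2 :: real) ^ 4 \<le> real n ^ 4" using n by (intro power_mono) auto
    then show ?thesis by simp
  qed
  also have "real n ^ 4 * real n ^ 2 = real n ^ 6" by (simp flip: power_add)
  finally have "x ^ 6 \<le> real n ^ 6" by (simp add: mult_right_mono)
  then show ?thesis by (rule power_le_imp_le_base[of _ 5, simplified]) simp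
qed

text \<open>A lower tail calls for negative weights. With weight -3 the exponent per x^6 is 19/10 *
  14/15 - 3/20 > 8/5; the low threshold 1/20 costs little of the mean. For x^6 \<ge> 4/5 ln n this
  decay beats the union bound over the 2 n letters.\<close>

lemma prob_small_touching:
  assumes s: "s \<in> letters n"
  shows "prob (\<lambda>R. real (card (R \<inter> touching n s)) < x ^ 6 / 20) \<le> exp (- (8 / 5) * x ^ 6)"
proof -
  let ?B = "touching n s"
  define w where "w r = (if r \<in> ?B then - 3 else 0 :: real)" for r
  have "prob (\<lambda>R. real (card (R \<inter> ?B)) < x ^ 6 / 20) \<le> prob (\<lambda>R. (\<Sum>r\<in>R. w r) \<ge> - (3 / 20) * x ^ 6)"
  proof (rule prob_mono)
    fix R assume R: "R \<in> subsets_of_card (triangular_words n) m" "real (card (R \<inter> ?B)) < x ^ 6 / 20"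
    have "(\<Sum>r\<in>R. w r) = - 3 * real (card (R \<inter> ?B))"
      using finite_member[OF R(1)] by (simp add: w_def sum.If_cases)
    then show "- (3 / 20) * x ^ 6 \<le> (\<Sum>r\<in>R. w r)" using R(2) by simp
  qed
  also have "\<dots> \<le> exp (p * (\<Sum>r\<in>triangular_words n. exp (w r) - 1) - (- (3 / 20) * x ^ 6))"
    by (rule prob_sum_ge) (simp add: w_def)
  also have "(\<Sum>r\<in>triangular_words n. exp (w r) - 1) = (\<Sum>r\<in>triangular_words n. if r \<in> ?B then exp (- 3) - 1 else 0)"
    by (rule sum.cong) (simp_all add: w_def)
  also have "\<dots> = real (card ?B) * (exp (- 3) - 1)"
  proof -
    have "triangular_words n \<inter> {r. r \<in> ?B} = ?B" by (auto simp: touching_def)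
    then show ?thesis using finite_triangular_words by (simp add: sum.If_cases)
  qed
  also have "p * (real (card ?B) * (exp (- 3) - 1)) \<le> 19 / 10 * x ^ 6 * (- (14 / 15))"
  proof -
    have "(5 / 2) ^ 3 \<le> exp (1 :: real) ^ 3" using exp_lower_Taylor_quadratic[of 1] by (intro power_mono) auto
    moreover have "exp (1 :: real) ^ 3 = exp 3" by (simp flip: exp_of_nat_mult)
    ultimately have "15 \<le> exp (3 :: real)" by (simp add: power3_eq_cube)
    then have e: "exp (- 3 :: real) - 1 \<le> - (14 / 15)" by (simp add: exp_minus field_simps)
    have "19 / 10 * x ^ 6 = p * (19 / 10 * real (card (triangular_words n))) / real n"
      using n card_T_pos by (simp add: p_def x6)
    also have "\<dots> \<le> p * (real n * real (card ?B)) / real n"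
      using card_touching_ge_average[OF s n] p_nonneg n by (intro divide_right_mono mult_left_mono) auto
    also have "\<dots> = p * real (card ?B)" using n by simp
    finally have "19 / 10 * x ^ 6 \<le> p * real (card ?B)" .
    then have "19 / 10 * x ^ 6 * (14 / 15) \<le> p * real (card ?B) * (1 - exp (- 3))"
      by (rule mult_mono) (use e p_nonneg in auto)
    then show ?thesis by (simp add: algebra_simps)
  qed
  finally have "prob (\<lambda>R. real (card (R \<inter> ?B)) < x ^ 6 / 20) \<le> exp (19 / 10 * x ^ 6 * (- (14 / 15)) - (- (3 / 20) * x ^ 6))"
    by simp
  also have "\<dots> \<le> exp (- (8 / 5) * x ^ 6)" by simp
  finally show ?thesis .
qed

definition concentrated_at :: "nat \<Rightarrow> (nat \<times> bool) list set \<Rightarrow> bool"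
  where "concentrated_at i R \<longleftrightarrow> (\<forall>z. \<bar>(\<Sum>r\<in>R. z (r ! i) * z (edge_end i r))
      - p * (\<Sum>r\<in>triangular_words n. z (r ! i) * z (edge_end i r))\<bar>
    \<le> 344 * x ^ 5 * (\<Sum>s\<in>letters n. (z s)\<^sup>2))"

lemma prob_not_concentrated_at:
  assumes i: "i < 3"
  shows "prob (\<lambda>R. \<not> concentrated_at i R) \<le> 4 * real n * exp (- 5 * x ^ 6) + 3 * exp (- (x ^ 4) / 3) + 4 * exp (- 4 * real n)"
proof -
  interpret g: random_graph "triangular_words n" m "letters n" "\<lambda>r. r ! i" "\<lambda>r. edge_end i r" "2 * real n" x
  proof unfold_locales
    show "finite (letters n)" by (rule finite_letters)
    show "letters n \<noteq> {}" using n card_letters[of n] by auto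
    show "(\<lambda>r. r ! i) ` triangular_words n \<subseteq> letters n" "(\<lambda>r. edge_end i r) ` triangular_words n \<subseteq> letters n"
      using i by (auto simp: nth_in_letters)
    show "real (card {r \<in> triangular_words n. r ! i = s \<and> edge_end i r = t}) \<le> 2 * real n"
      if "s \<in> letters n" "t \<in> letters n" for s t
    proof -
      have "card (middle_letters n s t) \<le> card (letters n)"
        by (rule card_mono[OF finite_letters]) (auto simp: middle_letters_def)
      then show ?thesis using card_fibre[OF i that] by (simp add: card_letters)
    qed
    show "p * (2 * real n) * real (card (letters n)) \<le> x ^ 6" using p_le by (simp add: card_letters)
    show "5 / 4 \<le> x" by (rule x)
  qed
  have "concentrated_at i = g.concentrated"
    by (rule ext) (simp only: concentrated_at_def g.concentrated_def)
  then show ?thesis using g.prob_not_concentrated by (simp add: card_letters)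
qed

text \<open>Three positions in two directions give N = 6 (344 + 1/2) x^5 = 2067 x^5, where 1/2
  accounts for the nonconstant fibres. With \<delta> = x^6 / 20 the contraction factor 2 N /
  \<delta> is 82680 / x, and 413400 = 5 * 82680.\<close>

lemma c_ub_ge_of_good:
  assumes R: "R \<in> subsets_of_card (triangular_words n) m"
    and conc: "\<And>i. i < 3 \<Longrightarrow> concentrated_at i R"
    and degree: "\<And>s. s \<in> letters n \<Longrightarrow> real (card (R \<inter> touching n s)) \<ge> x ^ 6 / 20"
  shows "c_ub (presented_group {..<n} R) \<ge> ereal (x / 413400)"
proof (rule c_ub_ge)
  fix c :: real assume c: "c \<ge> 1" "c < x / 413400"
  have x0: "x > 0" using x by simp
  have fR: "finite R" using R by (rule finite_member)
  show "property_T TYPE(nat \<Rightarrow> complex) c (presented_group {..<n} R)"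
  proof (rule property_T_presented_group[where \<delta> = "x ^ 6 / 20" and \<rho> = "6 * p * (2 * real n - 2)" and N = "2067 * x ^ 5"])
    show "R \<subseteq> triangular_words n" using R by (simp add: subsets_of_card_def)
    show "n \<ge> 1" using n by simp
    show "x ^ 6 / 20 > 0" using x0 by simp
    show "6 * p * (2 * real n - 2) > 0" using p_pos n by simp
    show "c \<ge> 1" by (rule c)
    have "2 * (2067 * x ^ 5) / (x ^ 6 / 20) = 82680 / x"
      using x0 by (simp add: eval_nat_numeral)
    then have "c * (2 * (2067 * x ^ 5) / (x ^ 6 / 20)) = c * 82680 / x" by simp
    also have "\<dots> \<le> 1 / 5" using c x0 by (simp add: divide_le_eq)
    finally show "c * (2 * (2067 * x ^ 5) / (x ^ 6 / 20)) \<le> 1 / 5" .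
    show "real (card (R \<inter> touching n s)) \<ge> x ^ 6 / 20" if "s \<in> letters n" for s by (rule degree[OF that])
    fix z :: "nat \<times> bool \<Rightarrow> real"
    define S where "S = (\<Sum>s\<in>letters n. (z s)\<^sup>2)"
    define \<sigma> where "\<sigma> = (\<Sum>s\<in>letters n. z s)\<^sup>2"
    define X where "X i A = (\<Sum>r\<in>A. z (r ! i) * z (edge_end i r))" for i A
    have S: "S \<ge> 0" by (simp add: S_def sum_nonneg)
    have small: "p * (2 * real n) \<le> x ^ 5 / 2"
    proof -
      have "p * (2 * real n) * (2 * real n) \<le> x ^ 5 * x" using p_le by (simp add: eval_nat_numeral mult_ac)
      also have "\<dots> \<le> x ^ 5 * real n" using x_le_n x0 by (intro mult_left_mono) auto
      also have "\<dots> = x ^ 5 / 2 * (2 * real n)" by simp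
      finally show ?thesis using n by (simp only: mult_le_cancel_right)
    qed
    have each: "\<bar>X i R - p * (2 * real n - 2) * \<sigma>\<bar> \<le> 344 * x ^ 5 * S + x ^ 5 / 2 * S" if i: "i < 3" for i
    proof -
      have "\<bar>X i R - p * X i (triangular_words n)\<bar> \<le> 344 * x ^ 5 * S"
        using conc[OF i] unfolding concentrated_at_def X_def S_def by blast
      moreover have "\<bar>p * X i (triangular_words n) - p * (2 * real n - 2) * \<sigma>\<bar> \<le> x ^ 5 / 2 * S"
      proof -
        have "\<bar>p * X i (triangular_words n) - p * (2 * real n - 2) * \<sigma>\<bar> = p * \<bar>X i (triangular_words n) - (2 * real n - 2) * \<sigma>\<bar>"
        proof -
          have "p * X i (triangular_words n) - p * (2 * real n - 2) * \<sigma> = p * (X i (triangular_words n) - (2 * real n - 2) * \<sigma>)"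
            by (simp add: algebra_simps)
          then show ?thesis using p_nonneg by (simp only: abs_mult abs_of_nonneg)
        qed
        also have "\<dots> \<le> p * (2 * real n * S)"
          using sum_triangular_words[OF i, of n z] n p_nonneg unfolding X_def S_def \<sigma>_def by (intro mult_left_mono) auto
        also have "\<dots> = p * (2 * real n) * S" by simp
        also have "\<dots> \<le> x ^ 5 / 2 * S" by (intro mult_right_mono small S)
        finally show ?thesis .
      qed
      ultimately show ?thesis by linarith
    qed
    have relations: "(\<Sum>j\<in>relation_indices R. z (rel_src j) * z (rel_tgt j)) = 2 * (X 0 R + X 1 R + X 2 R)"
      using sum_relations[OF fR, of z] by (simp add: X_def lessThan_3)
    have "\<bar>X i R - p * (2 * real n - 2) * \<sigma>\<bar> \<le> 689 / 2 * (x ^ 5 * S)" if "i < 3" for i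
      using each[OF that] by (simp add: mult.commute)
    moreover have "\<bar>2 * (a + b + c) - 6 * q\<bar> \<le> 2067 * B"
      if "\<bar>a - q\<bar> \<le> 689 / 2 * B" "\<bar>b - q\<bar> \<le> 689 / 2 * B" "\<bar>c - q\<bar> \<le> 689 / 2 * B" for a b c q B :: real
      using that[THEN abs_le_D1] that[THEN abs_le_D2] by (intro abs_leI; simp add: algebra_simps)
    ultimately have "\<bar>2 * (X 0 R + X 1 R + X 2 R) - 6 * (p * (2 * real n - 2) * \<sigma>)\<bar> \<le> 2067 * (x ^ 5 * S)"
      by simp
    with relations have "\<bar>(\<Sum>j\<in>relation_indices R. z (rel_src j) * z (rel_tgt j)) - 6 * p * (2 * real n - 2) * \<sigma>\<bar> \<le> 2067 * x ^ 5 * S"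
      by (simp only: mult.assoc)
    then show "\<bar>(\<Sum>j\<in>relation_indices R. z (rel_src j) * z (rel_tgt j)) - 6 * p * (2 * real n - 2) * (\<Sum>s\<in>letters n. z s)\<^sup>2\<bar>
        \<le> 2067 * x ^ 5 * (\<Sum>s\<in>letters n. (z s)\<^sup>2)"
      by (simp add: S_def \<sigma>_def)
  qed
qed

lemma prob_c_ub_ge:
  "prob (\<lambda>R. c_ub (presented_group {..<n} R) \<ge> ereal (x / 413400))
    \<ge> 1 - (12 * real n * exp (- 5 * x ^ 6) + 9 * exp (- (x ^ 4) / 3) + 12 * exp (- 4 * real n) + 2 * real n * exp (- (8 / 5) * x ^ 6))"
proof -
  let ?good = "\<lambda>R. c_ub (presented_group {..<n} R) \<ge> ereal (x / 413400)"
  let ?b = "4 * real n * exp (- 5 * x ^ 6) + 3 * exp (- (x ^ 4) / 3) + 4 * exp (- 4 * real n)"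
  have "prob (\<lambda>R. \<not> ?good R) \<le> prob (\<lambda>R. (\<exists>i\<in>{..<3}. \<not> concentrated_at i R)
      \<or> (\<exists>s\<in>letters n. real (card (R \<inter> touching n s)) < x ^ 6 / 20))"
  proof (rule prob_mono)
    fix R assume R: "R \<in> subsets_of_card (triangular_words n) m" and bad: "\<not> ?good R"
    show "(\<exists>i\<in>{..<3}. \<not> concentrated_at i R) \<or> (\<exists>s\<in>letters n. real (card (R \<inter> touching n s)) < x ^ 6 / 20)"
    proof (rule ccontr)
      assume "\<not> ?thesis"
      then have "?good R" by (intro c_ub_ge_of_good R) (auto simp: not_less)
      then show False using bad by blast
    qed
  qed
  also have "\<dots> \<le> prob (\<lambda>R. \<exists>i\<in>{..<3}. \<not> concentrated_at i R) + prob (\<lambda>R. \<exists>s\<in>letters n. real (card (R \<inter> touching n s)) < x ^ 6 / 20)"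
    by (rule prob_disj)
  also have "\<dots> \<le> (\<Sum>i\<in>{..<3 :: nat}. ?b) + (\<Sum>s\<in>letters n. exp (- (8 / 5) * x ^ 6))"
    by (intro add_mono prob_Bex prob_not_concentrated_at prob_small_touching) (auto simp: finite_letters)
  also have "\<dots> = 12 * real n * exp (- 5 * x ^ 6) + 9 * exp (- (x ^ 4) / 3) + 12 * exp (- 4 * real n) + 2 * real n * exp (- (8 / 5) * x ^ 6)"
    by (simp add: card_letters)
  finally show ?thesis using prob_not[of ?good] by linarith
qed

end

section \<open>The triangular density model\<close>

lemma power_powr: "x > 0 \<Longrightarrow> (x ^ k) powr a = x powr (real k * a)" for x a :: real
  by (subst powr_realpow[symmetric]) (simp_all add: powr_powr)

text \<open>With n powr e = ln n / (2 - \<eta>) the hypothesis reads 3 d \<ge> 1 + e. Since ln n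
  \<ge> 2 - \<eta>, the exponent e is nonnegative and the base n may be raised to 2 n - 1.
  Estimating 1 / (2 - \<eta>) by 1/2 makes the result uniform in \<eta>.\<close>

lemma card_relators_ge:
  fixes n :: nat and d \<eta> :: real
  assumes "0 < \<eta>" "\<eta> < 2" and n: "n \<ge> 2" and ln: "ln (real n) \<ge> 2"
    and d: "d \<ge> 1 / 3 + (ln (ln (real n)) - ln (2 - \<eta>)) / (3 * ln (real n))"
  shows "(2 * real n - 1) * ln (real n) / 2 \<le> (2 * real n - 1) powr (3 * d)"
proof -
  define L where "L = ln (real n)"
  define e where "e = (ln L - ln (2 - \<eta>)) / L"
  have L: "L \<ge> 2" using ln by (simp add: L_def)
  have "ln (2 - \<eta>) \<le> ln L" using assms(1,2) L by (intro ln_mono) auto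
  then have e: "e \<ge> 0" using L by (simp add: e_def)
  have "(2 * real n - 1) * ln (real n) / 2 \<le> (2 * real n - 1) * (L / (2 - \<eta>))"
  proof -
    have "L / 2 \<le> L / (2 - \<eta>)" using assms(1,2) L by (intro divide_left_mono) auto
    then have "(2 * real n - 1) * (L / 2) \<le> (2 * real n - 1) * (L / (2 - \<eta>))"
      using n by (intro mult_left_mono) auto
    then show ?thesis by (simp add: L_def)
  qed
  also have "L / (2 - \<eta>) = exp (e * L)"
    using assms(1,2) L by (simp add: e_def exp_diff)
  also have "\<dots> = real n powr e" using n by (simp add: powr_def L_def)
  also have "(2 * real n - 1) * real n powr e \<le> (2 * real n - 1) * (2 * real n - 1) powr e"
    using n e by (intro mult_left_mono powr_mono2) auto
  also have "\<dots> = (2 * real n - 1) powr (1 + e)"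
    using n by (simp add: powr_add)
  also have "\<dots> \<le> (2 * real n - 1) powr (3 * d)"
  proof (rule powr_mono)
    have e3: "(ln L - ln (2 - \<eta>)) / (3 * L) = e / 3" by (simp add: e_def)
    have "1 / 3 + e / 3 \<le> d" using d unfolding L_def[symmetric] e3 .
    then show "1 + e \<le> 3 * d" by simp
  qed (use n in auto)
  finally show ?thesis .
qed

text \<open>The bound of \<open>prob_c_ub_ge\<close> at the smallest admissible value x^6 = 4/5 ln
  n; the last term equals 2 n^(- 7/25).\<close>

definition failure_bound :: "nat \<Rightarrow> real"
  where "failure_bound n = 12 * real n * exp (- 4 * ln (real n)) + 9 * exp (- ((4 / 5 * ln (real n)) powr (2 / 3)) / 3)
    + 12 * exp (- 4 * real n) + 2 * real n * exp (- (32 / 25) * ln (real n))"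

lemma failure_bound_tendsto: "failure_bound \<longlonglongrightarrow> 0"
  unfolding failure_bound_def by real_asymp

lemma failure_bound_pos: "failure_bound n > 0"
  unfolding failure_bound_def
  by (rule add_pos_nonneg[OF add_nonneg_pos]) (auto intro!: add_nonneg_pos)

text \<open>The third condition ensures x \<ge> 5/4. In the last one the left side is asymptotic to
  n ln n, so the constant 4/5 leaves room for the rounding error 1/2 in the number of
  relators.\<close>

lemma eventually_large:
  "\<forall>\<^sub>F n :: nat in sequentially. n \<ge> 4 \<and> ln (real n) \<ge> 2 \<and> 4 / 5 * ln (real n) \<ge> (5 / 4) ^ 6
    \<and> (2 * real n - 1) * ln (real n) / 2 - 1 / 2 \<ge> 4 / 5 * ln (real n) * real n"
proof (intro eventually_conj)
  show "\<forall>\<^sub>F n :: nat in sequentially. n \<ge> 4" by (rule eventually_ge_at_top)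
  show "\<forall>\<^sub>F n :: nat in sequentially. ln (real n) \<ge> 2" by real_asymp
  show "\<forall>\<^sub>F n :: nat in sequentially. 4 / 5 * ln (real n) \<ge> (5 / 4) ^ 6" by real_asymp
  show "\<forall>\<^sub>F n :: nat in sequentially. (2 * real n - 1) * ln (real n) / 2 - 1 / 2 \<ge> 4 / 5 * ln (real n) * real n"
    by real_asymp
qed

lemma prob_c_ub_triangular_model:
  fixes n :: nat and d \<eta> :: real
  assumes \<eta>: "0 < \<eta>" "\<eta> < 2" and n4: "n \<ge> 4" and ln: "ln (real n) \<ge> 2" and ln': "4 / 5 * ln (real n) \<ge> (5 / 4) ^ 6"
    and large: "(2 * real n - 1) * ln (real n) / 2 - 1 / 2 \<ge> 4 / 5 * ln (real n) * real n"
    and d: "d < 1" "d \<ge> 1 / 3 + (ln (ln (real n)) - ln (2 - \<eta>)) / (3 * ln (real n))"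
  shows "measure_pmf.prob (triangular_model n d)
      {\<Gamma>. c_ub \<Gamma> \<ge> ereal (1 / 826800 * ((2 * real n - 1) powr (3 * d) / real n) powr (1 / 6))} \<ge> 1 - failure_bound n"
proof -
  define y where "y = (2 * real n - 1) powr (3 * d)"
  define m where "m = nat (round y)"
  define x where "x = (real m / real n) powr (1 / 6)"
  define L where "L = ln (real n)"
  have L: "L \<ge> 2" using ln by (simp add: L_def)
  have "(2 * real n - 1) * ln (real n) / 2 \<le> y"
    unfolding y_def using \<eta> n4 ln d by (intro card_relators_ge) auto
  then have y_ge: "y - 1 / 2 \<ge> 4 / 5 * L * real n" using large by (simp add: L_def)
  have "4 / 5 * 2 * 4 \<le> 4 / 5 * L * real n" using L n4 by (intro mult_mono) auto
  then have y1: "y \<ge> 1" using y_ge by simp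
  have m_real: "real m = of_int (round y)" using y1 by (simp add: m_def round_mono[of 0 y, simplified])
  have m_ge: "real m \<ge> y - 1 / 2" and m_le: "real m \<le> y + 1 / 2"
    using of_int_round_ge[of y] of_int_round_le[of y] by (simp_all add: m_real)
  have avg: "real m / real n \<ge> 4 / 5 * L"
    using y_ge m_ge n4 by (simp add: le_divide_eq)
  have avg_pos: "real m / real n > 0" using avg L by linarith
  have x_pos: "x > 0" unfolding x_def powr_gt_zero using avg_pos by (metis less_irrefl)
  have x6: "x ^ 6 = real m / real n"
  proof -
    have "x ^ 6 = x powr real 6" using x_pos by (subst powr_realpow) auto
    also have "\<dots> = (real m / real n) powr (1 / 6 * real 6)" unfolding x_def by (rule powr_powr)
    finally show ?thesis using avg_pos by simp
  qed
  have x_ge: "x \<ge> 5 / 4"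
  proof (rule power_le_imp_le_base[of _ 5])
    have "(5 / 4) ^ 6 \<le> x ^ 6" unfolding x6 using ln'[folded L_def] avg by (rule order_trans)
    then show "(5 / 4) ^ Suc 5 \<le> x ^ Suc 5" by simp
  qed (use x_pos in simp)
  have sets: "relator_sets n d = subsets_of_card (triangular_words n) m"
    by (simp add: relator_sets_def subsets_of_card_def m_def y_def)
  have "relator_sets n d \<noteq> {}" using n4 d by (intro relator_sets_nonempty) auto
  then obtain R where "R \<subseteq> triangular_words n" "card R = m" unfolding sets subsets_of_card_def by blast
  then have m_card: "m \<le> card (triangular_words n)" using card_mono[OF finite_triangular_words] by blast
  interpret random_relators n m x
    by unfold_locales (use n4 m_card x_ge x6 in auto)
  \<comment> \<open>Rounding may make m smaller than y, but y \<le> 2 m; the factor 2 under the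
    sixth root is generously replaced by 2^6, which gives the final constant 826800 = 2 *
    413400.\<close>
  have "1 / 826800 * (y / real n) powr (1 / 6) \<le> 1 / 826800 * (2 * x)"
  proof (rule mult_left_mono)
    have "y / real n \<le> (2 * real m) / real n" using m_ge y1 by (intro divide_right_mono) auto
    also have "\<dots> = 2 * (real m / real n)" by simp
    also have "\<dots> \<le> 2 ^ 6 * x ^ 6" unfolding x6[symmetric] using x_pos by (intro mult_right_mono) auto
    also have "\<dots> = (2 * x) ^ 6" by (simp only: power_mult_distrib)
    finally have "(y / real n) powr (1 / 6) \<le> ((2 * x) ^ 6) powr (1 / 6)"
      using y1 n4 by (intro powr_mono2) auto
    also have "\<dots> = 2 * x" using power_powr[of "2 * x" 6 "1 / 6"] x_pos by simp
    finally show "(y / real n) powr (1 / 6) \<le> 2 * x" .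
  qed simp
  then have target: "1 / 826800 * (y / real n) powr (1 / 6) \<le> x / 413400" by simp
  have fail: "12 * real n * exp (- 5 * x ^ 6) + 9 * exp (- (x ^ 4) / 3) + 12 * exp (- 4 * real n) + 2 * real n * exp (- (8 / 5) * x ^ 6)
      \<le> failure_bound n"
  proof -
    have x6_ge: "x ^ 6 \<ge> 4 / 5 * L" using x6 avg by simp
    have "(4 / 5 * L) powr (2 / 3) \<le> (x ^ 6) powr (2 / 3)" using x6_ge L by (intro powr_mono2) auto
    also have "\<dots> = x powr real 4" using power_powr[of x 6 "2 / 3"] x_pos by simp
    also have "\<dots> = x ^ 4" using x_pos by (rule powr_realpow)
    finally have x4_ge: "(4 / 5 * L) powr (2 / 3) \<le> x ^ 4" .
    show ?thesis
      unfolding failure_bound_def L_def[symmetric]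
      by (intro add_mono mult_left_mono) (use x6_ge x4_ge in auto)
  qed
  have "1 - failure_bound n \<le> prob (\<lambda>R. c_ub (presented_group {..<n} R) \<ge> ereal (x / 413400))"
    using prob_c_ub_ge fail by linarith
  also have "\<dots> \<le> prob (\<lambda>R. c_ub (presented_group {..<n} R) \<ge> ereal (1 / 826800 * (y / real n) powr (1 / 6)))"
    by (rule prob_mono) (use target in \<open>auto intro: order_trans[rotated]\<close>)
  also have "\<dots> = measure_pmf.prob (triangular_model n d) {\<Gamma>. c_ub \<Gamma> \<ge> ereal (1 / 826800 * (y / real n) powr (1 / 6))}"
    by (simp add: triangular_model_def sets vimage_def)
  finally show ?thesis by (simp add: y_def)
qed

theorem corollary10p5:
  fixes \<eta> :: real
  assumes "0 < \<eta>" and "\<eta> < 2"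
  shows "\<exists>K' > (0 :: real). \<exists>u :: nat \<Rightarrow> real.
    (\<forall>n. u n > 0) \<and> u \<longlonglongrightarrow> 0 \<and>
    (\<forall>(n :: nat) \<ge> 2. \<forall>d :: real. 0 < d \<and> d < 1 \<and>
      d \<ge> 1 / 3 + (ln (ln (real n)) - ln (2 - \<eta>)) / (3 * ln (real n)) \<longrightarrow>
      measure_pmf.prob (triangular_model n d)
        {\<Gamma>. c_ub \<Gamma> \<ge> ereal (K' * ((2 * real n - 1) powr (3 * d) / real n) powr (1 / 6))}
      \<ge> 1 - u n)"
proof -
  obtain n0 where n0: "\<And>n. n \<ge> n0 \<Longrightarrow> n \<ge> 4 \<and> ln (real n) \<ge> 2 \<and> 4 / 5 * ln (real n) \<ge> (5 / 4) ^ 6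
    \<and> (2 * real n - 1) * ln (real n) / 2 - 1 / 2 \<ge> 4 / 5 * ln (real n) * real n"
    using eventually_large unfolding eventually_sequentially by blast
  \<comment> \<open>For the finitely many small n the value 1 makes the probability bound
    trivial.\<close>
  define u where "u n = (if n \<ge> n0 then failure_bound n else 1)" for n
  have "\<forall>n. u n > 0" by (simp add: u_def failure_bound_pos)
  moreover have "u \<longlonglongrightarrow> 0"
  proof (rule Lim_transform_eventually[OF failure_bound_tendsto])
    show "\<forall>\<^sub>F n in sequentially. failure_bound n = u n"
      using eventually_ge_at_top[of n0] by eventually_elim (simp add: u_def)
  qed
  moreover have "measure_pmf.prob (triangular_model n d)
        {\<Gamma>. c_ub \<Gamma> \<ge> ereal (1 / 826800 * ((2 * real n - 1) powr (3 * d) / real n) powr (1 / 6))} \<ge> 1 - u n"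
    if "0 < d \<and> d < 1 \<and> d \<ge> 1 / 3 + (ln (ln (real n)) - ln (2 - \<eta>)) / (3 * ln (real n))" for n d
  proof (cases "n \<ge> n0")
    case True
    then have "u n = failure_bound n" by (simp add: u_def)
    then show ?thesis using n0[OF True] that assms by (simp only:) (rule prob_c_ub_triangular_model, auto)
  next
    case False
    then show ?thesis by (simp add: u_def)
  qed
  ultimately show ?thesis by (intro exI[of _ "1 / 826800"] conjI exI[of _ u]) auto
qed

end
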